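(* Let $\Gamma=(\mathcal P,\mathcal L)$ be an embeddable non-degenerate polar space of finite rank $n>2$ which admits the absolutely universal embedding. Then the hyperplanes of $\Gamma$ are precisely the maximal subspaces of $\Gamma$ of rank at least $2$ (in fact, they have rank either $n-1$ or $n$).
   Context: Polar spaces. A point-line geometry is a pair $\Gamma=(\mathcal P,\mathcal L)$ with $\mathcal P$ a non-empty set of points and $\mathcal L$ a family of subsets of $\mathcal P$ called lines. Two points are collinear, $p\perp q$, if they lie on a common line; $p^\perp$ is the set of points collinear with $p$, with $p\in p^\perp$ by convention, and $X^\perp:=\bigcap_{p\in X}p^\perp$ for $X\subseteq\mathcal P$. A subspace of $\Gamma$ is a subset $\mathcal S\subseteq\mathcal P$ such that every line meeting $\mathcal S$ in two distinct points is contained in $\mathcal S$; it is proper if $\mathcal S\subset\mathcal P$. A maximal subspace is a maximal element of the family of proper subspaces of $\Gamma$. A hyperplane is a proper subspace $\mathcal S$ such that every line of $\Gamma$ meets $\mathcal S$ non-trivially. A polar space is (as usual) a point-line geometry satisfying the one-or-all axiom: each point is collinear with either exactly one or all points of any given line. A subspace $\mathcal S$ of a polar space, with the lines contained in it, is a possibly degenerate polar space, with radical $\mathrm{Rad}(\mathcal S)=\mathcal S^\perp\cap\mathcal S$; it is non-degenerate if $\mathrm{Rad}(\mathcal S)=\emptyset$. $\mathcal S$ is singular if $\mathcal S\subseteq\mathcal S^\perp$. The rank of a singular subspace (a projective space) is the size of a minimal spanning set of it; the rank of a polar space is the maximal rank of its singular subspaces. Embeddings. A (full projective) embedding of $\Gamma$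 is an injective map $\varepsilon:\mathcal P\to\mathrm{PG}(V)$, for a vector space $V$ over a division ring, such that $\varepsilon(\mathcal P)$ spans $\mathrm{PG}(V)$ and $\varepsilon(\ell)=\{\varepsilon(x)\}_{x\in\ell}$ is a (full) projective line for every $\ell\in\mathcal L$; $\Gamma$ is embeddable if it admits an embedding. For embeddings $\varepsilon_1:\Gamma\to\mathrm{PG}(V_1)$, $\varepsilon_2:\Gamma\to\mathrm{PG}(V_2)$ over the same division ring, a morphism (isomorphism) $\varepsilon_1\to\varepsilon_2$ is a (possibly partial) map (respectively, an isomorphism) $\varphi$ from $\mathrm{PG}(V_1)$ to $\mathrm{PG}(V_2)$ induced by a semilinear map $V_1\to V_2$ such that $\varepsilon_2=\varphi\cdot\varepsilon_1$. An embedding $\varepsilon$ is relatively universal if $\varepsilon'\cong\varepsilon$ for every embedding $\varepsilon'$ of $\Gamma$ with $\varepsilon'\to\varepsilon$; it is absolutely universal if moreover $\varepsilon\to\varepsilon'$ for every embedding $\varepsilon'$ of $\Gamma$. *)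

theory Defs
  imports "HOL-Algebra.QuotRing" "HOL-Algebra.Module" "HOL-Library.Extended_Nat"
begin

section \<open>Point-line geometries and polar spaces\<close>

record 'p geometry =
  points :: "'p set"
  lines :: "'p set set"

definition point_line_geometry :: "'p geometry \<Rightarrow> bool" where
  "point_line_geometry \<Gamma> \<longleftrightarrow> points \<Gamma> \<noteq> {} \<and> (\<forall>l\<in>lines \<Gamma>. l \<subseteq> points \<Gamma>)"

definition collinear_in :: "'p geometry \<Rightarrow> 'p \<Rightarrow> 'p \<Rightarrow> bool" where
  "collinear_in \<Gamma> p q \<longleftrightarrow> p = q \<or> (\<exists>l\<in>lines \<Gamma>. p \<in> l \<and> q \<in> l)"

definition perp :: "'p geometry \<Rightarrow> 'p set \<Rightarrow> 'p set" where
  "perp \<Gamma> X = {q \<in> points \<Gamma>. \<forall>p\<in>X. collinear_in \<Gamma> p q}"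

definition polar_space :: "'p geometry \<Rightarrow> bool" where
  "polar_space \<Gamma> \<longleftrightarrow> point_line_geometry \<Gamma> \<and>
     (\<forall>p\<in>points \<Gamma>. \<forall>l\<in>lines \<Gamma>.
        (\<exists>!q. q \<in> l \<and> collinear_in \<Gamma> p q) \<or> (\<forall>q\<in>l. collinear_in \<Gamma> p q))"

definition geo_subspace :: "'p geometry \<Rightarrow> 'p set \<Rightarrow> bool" where
  "geo_subspace \<Gamma> S \<longleftrightarrow> S \<subseteq> points \<Gamma> \<and>
     (\<forall>l\<in>lines \<Gamma>. (\<exists>p\<in>l \<inter> S. \<exists>q\<in>l \<inter> S. p \<noteq> q) \<longrightarrow> l \<subseteq> S)"

definition proper_subspace :: "'p geometry \<Rightarrow> 'p set \<Rightarrow> bool" where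
  "proper_subspace \<Gamma> S \<longleftrightarrow> geo_subspace \<Gamma> S \<and> S \<noteq> points \<Gamma>"

definition maximal_subspace :: "'p geometry \<Rightarrow> 'p set \<Rightarrow> bool" where
  "maximal_subspace \<Gamma> S \<longleftrightarrow> proper_subspace \<Gamma> S \<and>
     (\<forall>T. proper_subspace \<Gamma> T \<and> S \<subseteq> T \<longrightarrow> T = S)"

definition geo_hyperplane :: "'p geometry \<Rightarrow> 'p set \<Rightarrow> bool" where
  "geo_hyperplane \<Gamma> S \<longleftrightarrow> proper_subspace \<Gamma> S \<and> (\<forall>l\<in>lines \<Gamma>. l \<inter> S \<noteq> {})"

definition induced_geometry :: "'p geometry \<Rightarrow> 'p set \<Rightarrow> 'p geometry" where
  "induced_geometry \<Gamma> S = \<lparr>points = S, lines = {l \<in> lines \<Gamma>. l \<subseteq> S}\<rparr>"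

definition Rad :: "'p geometry \<Rightarrow> 'p set \<Rightarrow> 'p set" where
  "Rad \<Gamma> S = perp \<Gamma> S \<inter> S"

definition nondegenerate :: "'p geometry \<Rightarrow> bool" where
  "nondegenerate \<Gamma> \<longleftrightarrow> Rad \<Gamma> (points \<Gamma>) = {}"

definition singular_subspace :: "'p geometry \<Rightarrow> 'p set \<Rightarrow> bool" where
  "singular_subspace \<Gamma> S \<longleftrightarrow> geo_subspace \<Gamma> S \<and> S \<subseteq> perp \<Gamma> S"

definition geo_span :: "'p geometry \<Rightarrow> 'p set \<Rightarrow> 'p set" where
  "geo_span \<Gamma> X = \<Inter>{S. geo_subspace \<Gamma> S \<and> X \<subseteq> S}"

definition minimal_spanning_set :: "'p geometry \<Rightarrow> 'p set \<Rightarrow> 'p set \<Rightarrow> bool" where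
  "minimal_spanning_set \<Gamma> S X \<longleftrightarrow>
     X \<subseteq> S \<and> geo_span \<Gamma> X = S \<and> (\<forall>Y. Y \<subset> X \<longrightarrow> geo_span \<Gamma> Y \<noteq> S)"

definition ecard :: "'a set \<Rightarrow> enat" where
  "ecard X = (if finite X then enat (card X) else \<infinity>)"

text \<open>
  A singular subspace is a projective space, so all its minimal spanning sets have the
  same size and the supremum below is just that common value.
\<close>

definition singular_rank :: "'p geometry \<Rightarrow> 'p set \<Rightarrow> enat" where
  "singular_rank \<Gamma> S = (SUP X\<in>{X. minimal_spanning_set \<Gamma> S X}. ecard X)"

definition polar_rank :: "'p geometry \<Rightarrow> enat" where
  "polar_rank \<Gamma> = (SUP S\<in>{S. singular_subspace \<Gamma> S}. singular_rank \<Gamma> S)"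

abbreviation subspace_rank :: "'p geometry \<Rightarrow> 'p set \<Rightarrow> enat" where
  "subspace_rank \<Gamma> S \<equiv> polar_rank (induced_geometry \<Gamma> S)"


section \<open>Vector spaces over division rings and their projective spaces\<close>

text \<open>
  The locale \<open>module\<close> requires a commutative ring of scalars, whence a separate locale.
\<close>

locale skew_field = ring +
  assumes skew_field_Units: "Units R = carrier R - {\<zero>}"

locale left_vector_space = K?: skew_field K + V?: abelian_group V
  for K :: "('k, 'm) ring_scheme" and V :: "('k, 'v, 'w) module_scheme" +
  assumes smult_closed [simp, intro]:
      "\<lbrakk>a \<in> carrier K; x \<in> carrier V\<rbrakk> \<Longrightarrow> a \<odot>\<^bsub>V\<^esub> x \<in> carrier V"
    and smult_l_distr:
      "\<lbrakk>a \<in> carrier K; b \<in> carrier K; x \<in> carrier V\<rbrakk> \<Longrightarrow>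
       (a \<oplus>\<^bsub>K\<^esub> b) \<odot>\<^bsub>V\<^esub> x = a \<odot>\<^bsub>V\<^esub> x \<oplus>\<^bsub>V\<^esub> b \<odot>\<^bsub>V\<^esub> x"
    and smult_r_distr:
      "\<lbrakk>a \<in> carrier K; x \<in> carrier V; y \<in> carrier V\<rbrakk> \<Longrightarrow>
       a \<odot>\<^bsub>V\<^esub> (x \<oplus>\<^bsub>V\<^esub> y) = a \<odot>\<^bsub>V\<^esub> x \<oplus>\<^bsub>V\<^esub> a \<odot>\<^bsub>V\<^esub> y"
    and smult_assoc:
      "\<lbrakk>a \<in> carrier K; b \<in> carrier K; x \<in> carrier V\<rbrakk> \<Longrightarrow>
       (a \<otimes>\<^bsub>K\<^esub> b) \<odot>\<^bsub>V\<^esub> x = a \<odot>\<^bsub>V\<^esub> (b \<odot>\<^bsub>V\<^esub> x)"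
    and smult_one [simp]: "x \<in> carrier V \<Longrightarrow> \<one>\<^bsub>K\<^esub> \<odot>\<^bsub>V\<^esub> x = x"

definition lin_span ::
  "('k, 'm) ring_scheme \<Rightarrow> ('k, 'v, 'w) module_scheme \<Rightarrow> 'v set \<Rightarrow> 'v set" where
  "lin_span K V X = \<Inter>{H. submodule H K V \<and> X \<subseteq> H}"

definition pg_points ::
  "('k, 'm) ring_scheme \<Rightarrow> ('k, 'v, 'w) module_scheme \<Rightarrow> 'v set set" where
  "pg_points K V = {lin_span K V {v} | v. v \<in> carrier V \<and> v \<noteq> \<zero>\<^bsub>V\<^esub>}"

definition pg_lines ::
  "('k, 'm) ring_scheme \<Rightarrow> ('k, 'v, 'w) module_scheme \<Rightarrow> 'v set set set" where
  "pg_lines K V = {{z \<in> pg_points K V. z \<subseteq> lin_span K V (x \<union> y)} | x y.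
     x \<in> pg_points K V \<and> y \<in> pg_points K V \<and> x \<noteq> y}"

definition semilinear ::
  "('k1, 'm1) ring_scheme \<Rightarrow> ('k1, 'v1, 'w1) module_scheme \<Rightarrow>
   ('k2, 'm2) ring_scheme \<Rightarrow> ('k2, 'v2, 'w2) module_scheme \<Rightarrow>
   ('k1 \<Rightarrow> 'k2) \<Rightarrow> ('v1 \<Rightarrow> 'v2) \<Rightarrow> bool" where
  "semilinear K1 V1 K2 V2 \<sigma> f \<longleftrightarrow>
     \<sigma> \<in> ring_iso K1 K2 \<and> f \<in> carrier V1 \<rightarrow> carrier V2 \<and>
     (\<forall>x\<in>carrier V1. \<forall>y\<in>carrier V1. f (x \<oplus>\<^bsub>V1\<^esub> y) = f x \<oplus>\<^bsub>V2\<^esub> f y) \<and>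
     (\<forall>a\<in>carrier K1. \<forall>x\<in>carrier V1. f (a \<odot>\<^bsub>V1\<^esub> x) = \<sigma> a \<odot>\<^bsub>V2\<^esub> f x)"


section \<open>Embeddings\<close>

definition embedding ::
  "'p geometry \<Rightarrow> ('k, 'm) ring_scheme \<Rightarrow> ('k, 'v, 'w) module_scheme \<Rightarrow> ('p \<Rightarrow> 'v set) \<Rightarrow> bool"
  where
  "embedding \<Gamma> K V \<epsilon> \<longleftrightarrow>
     left_vector_space K V \<and>
     \<epsilon> \<in> points \<Gamma> \<rightarrow> pg_points K V \<and> inj_on \<epsilon> (points \<Gamma>) \<and>
     lin_span K V (\<Union>p\<in>points \<Gamma>. \<epsilon> p) = carrier V \<and>
     (\<forall>l\<in>lines \<Gamma>. \<epsilon> ` l \<in> pg_lines K V)"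

text \<open>
  A semilinear map \<open>f\<close> induces the partial map \<open>x \<mapsto> f ` x\<close> on projective points, which is
  defined at \<open>x\<close> unless \<open>f\<close> vanishes on \<open>x\<close>.  Below it is defined at all \<open>\<epsilon>1 p\<close>, since
  \<open>\<epsilon>2 p\<close> is a projective point.
\<close>

definition morphism_to ::
  "'p geometry \<Rightarrow>
   ('k1, 'm1) ring_scheme \<Rightarrow> ('k1, 'v1, 'w1) module_scheme \<Rightarrow> ('p \<Rightarrow> 'v1 set) \<Rightarrow>
   ('k2, 'm2) ring_scheme \<Rightarrow> ('k2, 'v2, 'w2) module_scheme \<Rightarrow> ('p \<Rightarrow> 'v2 set) \<Rightarrow> bool" where
  "morphism_to \<Gamma> K1 V1 \<epsilon>1 K2 V2 \<epsilon>2 \<longleftrightarrow>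
     (\<exists>\<sigma> f. semilinear K1 V1 K2 V2 \<sigma> f \<and> (\<forall>p\<in>points \<Gamma>. f ` \<epsilon>1 p = \<epsilon>2 p))"

definition isomorphic_embeddings ::
  "'p geometry \<Rightarrow>
   ('k1, 'm1) ring_scheme \<Rightarrow> ('k1, 'v1, 'w1) module_scheme \<Rightarrow> ('p \<Rightarrow> 'v1 set) \<Rightarrow>
   ('k2, 'm2) ring_scheme \<Rightarrow> ('k2, 'v2, 'w2) module_scheme \<Rightarrow> ('p \<Rightarrow> 'v2 set) \<Rightarrow> bool" where
  "isomorphic_embeddings \<Gamma> K1 V1 \<epsilon>1 K2 V2 \<epsilon>2 \<longleftrightarrow>
     (\<exists>\<sigma> f. semilinear K1 V1 K2 V2 \<sigma> f \<and> bij_betw f (carrier V1) (carrier V2) \<and>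
            (\<forall>p\<in>points \<Gamma>. f ` \<epsilon>1 p = \<epsilon>2 p))"

text \<open>
  Universality quantifies over all embeddings, hence over all division rings and vector spaces.
  HOL cannot quantify over types inside a formula, so the competing embedding ranges over all
  division rings carried by a subset of \<open>'p\<close> and all vector spaces carried by a subset of
  \<open>'p \<Rightarrow> 'p\<close>, where \<open>'p\<close> is the type of the points.  As soon as the geometry has a line this
  loses nothing: every embedding, with scalars and vectors of arbitrary types, has an isomorphic
  copy of this kind (lemma \<open>embedding_small_copy\<close> below).
\<close>

definition relatively_universal ::
  "'p geometry \<Rightarrow> ('k, 'm) ring_scheme \<Rightarrow> ('k, 'v, 'w) module_scheme \<Rightarrow> ('p \<Rightarrow> 'v set) \<Rightarrow> bool"
  where
  "relatively_universal \<Gamma> K V \<epsilon> \<longleftrightarrow> embedding \<Gamma> K V \<epsilon> \<and>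
     (\<forall>(K' :: 'p ring) (V' :: ('p, 'p \<Rightarrow> 'p) module) \<epsilon>'.
        embedding \<Gamma> K' V' \<epsilon>' \<and> morphism_to \<Gamma> K' V' \<epsilon>' K V \<epsilon> \<longrightarrow>
        isomorphic_embeddings \<Gamma> K' V' \<epsilon>' K V \<epsilon>)"

definition absolutely_universal ::
  "'p geometry \<Rightarrow> ('k, 'm) ring_scheme \<Rightarrow> ('k, 'v, 'w) module_scheme \<Rightarrow> ('p \<Rightarrow> 'v set) \<Rightarrow> bool"
  where
  "absolutely_universal \<Gamma> K V \<epsilon> \<longleftrightarrow> relatively_universal \<Gamma> K V \<epsilon> \<and>
     (\<forall>(K' :: 'p ring) (V' :: ('p, 'p \<Rightarrow> 'p) module) \<epsilon>'.
        embedding \<Gamma> K' V' \<epsilon>' \<longrightarrow> morphism_to \<Gamma> K V \<epsilon> K' V' \<epsilon>')"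


section \<open>The competing embeddings may be taken over the types \<open>'p\<close> and \<open>'p \<Rightarrow> 'p\<close>\<close>

text \<open>
  The scalars inject into a line minus a point, and a vector is determined by its coordinates
  with respect to representatives of the embedded points.  Hence universality, as defined above,
  implies the corresponding property for embeddings with scalars and vectors of arbitrary types.
\<close>

context left_vector_space
begin

lemma smult_l_null: assumes "x \<in> carrier V" shows "\<zero>\<^bsub>K\<^esub> \<odot>\<^bsub>V\<^esub> x = \<zero>\<^bsub>V\<^esub>"
proof -
  have "\<zero>\<^bsub>K\<^esub> \<odot>\<^bsub>V\<^esub> x \<oplus>\<^bsub>V\<^esub> \<zero>\<^bsub>K\<^esub> \<odot>\<^bsub>V\<^esub> x = \<zero>\<^bsub>K\<^esub> \<odot>\<^bsub>V\<^esub> x"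
    using smult_l_distr[of "\<zero>\<^bsub>K\<^esub>" "\<zero>\<^bsub>K\<^esub>" x] assms by simp
  then show ?thesis
    using assms by (metis V.add.l_cancel_one' K.zero_closed smult_closed)
qed

lemma smult_r_null: assumes "a \<in> carrier K" shows "a \<odot>\<^bsub>V\<^esub> \<zero>\<^bsub>V\<^esub> = \<zero>\<^bsub>V\<^esub>"
proof -
  have "a \<odot>\<^bsub>V\<^esub> \<zero>\<^bsub>V\<^esub> \<oplus>\<^bsub>V\<^esub> a \<odot>\<^bsub>V\<^esub> \<zero>\<^bsub>V\<^esub> = a \<odot>\<^bsub>V\<^esub> \<zero>\<^bsub>V\<^esub>"
    using smult_r_distr[of a "\<zero>\<^bsub>V\<^esub>" "\<zero>\<^bsub>V\<^esub>"] assms by simp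
  then show ?thesis
    using assms by (metis V.add.l_cancel_one' V.zero_closed smult_closed)
qed

lemma smult_minus_one:
  assumes "x \<in> carrier V" shows "(\<ominus>\<^bsub>K\<^esub> \<one>\<^bsub>K\<^esub>) \<odot>\<^bsub>V\<^esub> x = \<ominus>\<^bsub>V\<^esub> x"
proof -
  have "(\<ominus>\<^bsub>K\<^esub> \<one>\<^bsub>K\<^esub>) \<odot>\<^bsub>V\<^esub> x \<oplus>\<^bsub>V\<^esub> x = \<zero>\<^bsub>V\<^esub>"
    using smult_l_distr[of "\<ominus>\<^bsub>K\<^esub> \<one>\<^bsub>K\<^esub>" "\<one>\<^bsub>K\<^esub>" x] assms smult_l_null
    by (simp add: K.l_neg)
  then show ?thesis
    using assms by (metis V.minus_equality K.add.inv_closed K.one_closed smult_closed)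
qed

lemma skew_inverse:
  assumes "a \<in> carrier K" "a \<noteq> \<zero>\<^bsub>K\<^esub>"
  obtains b where "b \<in> carrier K" "b \<otimes>\<^bsub>K\<^esub> a = \<one>\<^bsub>K\<^esub>" "a \<otimes>\<^bsub>K\<^esub> b = \<one>\<^bsub>K\<^esub>"
  using assms skew_field_Units unfolding Units_def by blast

lemma smult_eq_zero:
  assumes "a \<in> carrier K" "x \<in> carrier V" "a \<odot>\<^bsub>V\<^esub> x = \<zero>\<^bsub>V\<^esub>" "x \<noteq> \<zero>\<^bsub>V\<^esub>"
  shows "a = \<zero>\<^bsub>K\<^esub>"
proof (rule ccontr)
  assume "a \<noteq> \<zero>\<^bsub>K\<^esub>"
  then obtain b where b: "b \<in> carrier K" "b \<otimes>\<^bsub>K\<^esub> a = \<one>\<^bsub>K\<^esub>"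
    using assms(1) skew_inverse by blast
  then have "x = b \<odot>\<^bsub>V\<^esub> (a \<odot>\<^bsub>V\<^esub> x)"
    using assms smult_assoc[of b a x] by simp
  then show False using assms b smult_r_null by simp
qed

lemma submoduleI:
  assumes "H \<subseteq> carrier V" "\<zero>\<^bsub>V\<^esub> \<in> H"
    and "\<And>x y. \<lbrakk>x \<in> H; y \<in> H\<rbrakk> \<Longrightarrow> x \<oplus>\<^bsub>V\<^esub> y \<in> H"
    and sm: "\<And>a x. \<lbrakk>a \<in> carrier K; x \<in> H\<rbrakk> \<Longrightarrow> a \<odot>\<^bsub>V\<^esub> x \<in> H"
  shows "submodule H K V"
proof -
  have "\<ominus>\<^bsub>V\<^esub> x \<in> H" if "x \<in> H" for x
    using that smult_minus_one[of x] sm[of "\<ominus>\<^bsub>K\<^esub> \<one>\<^bsub>K\<^esub>" x] assms(1) by auto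
  then show ?thesis
    using assms
    by (intro submodule.intro subgroup.intro) (auto simp: submodule_axioms_def a_inv_def)
qed

lemma submoduleD:
  assumes "submodule H K V"
  shows "H \<subseteq> carrier V" "\<zero>\<^bsub>V\<^esub> \<in> H"
    and "\<And>x y. \<lbrakk>x \<in> H; y \<in> H\<rbrakk> \<Longrightarrow> x \<oplus>\<^bsub>V\<^esub> y \<in> H"
    and "\<And>a x. \<lbrakk>a \<in> carrier K; x \<in> H\<rbrakk> \<Longrightarrow> a \<odot>\<^bsub>V\<^esub> x \<in> H"
proof -
  interpret submodule H K V by fact
  show "H \<subseteq> carrier V" "\<zero>\<^bsub>V\<^esub> \<in> H"
    and "\<And>x y. \<lbrakk>x \<in> H; y \<in> H\<rbrakk> \<Longrightarrow> x \<oplus>\<^bsub>V\<^esub> y \<in> H"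
    and "\<And>a x. \<lbrakk>a \<in> carrier K; x \<in> H\<rbrakk> \<Longrightarrow> a \<odot>\<^bsub>V\<^esub> x \<in> H"
    using subset one_closed m_closed by auto
qed

lemma carrier_submodule: "submodule (carrier V) K V"
  by (rule submoduleI) auto

lemma lin_span_submodule: assumes "X \<subseteq> carrier V" shows "submodule (lin_span K V X) K V"
proof (rule submoduleI)
  show "lin_span K V X \<subseteq> carrier V"
    using carrier_submodule assms unfolding lin_span_def by blast
qed (auto simp: lin_span_def dest: submoduleD)

lemma lin_span_incl: "X \<subseteq> lin_span K V X"
  unfolding lin_span_def by blast

lemma lin_span_least: "submodule H K V \<Longrightarrow> X \<subseteq> H \<Longrightarrow> lin_span K V X \<subseteq> H"
  unfolding lin_span_def by blast

lemma lin_span_singleton: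
  assumes v: "v \<in> carrier V"
  shows "lin_span K V {v} = {a \<odot>\<^bsub>V\<^esub> v | a. a \<in> carrier K}" (is "_ = ?L")
proof
  have "submodule ?L K V"
  proof (rule submoduleI)
    show "?L \<subseteq> carrier V" using v by auto
    show "\<zero>\<^bsub>V\<^esub> \<in> ?L"
      using smult_l_null[OF v, symmetric] K.zero_closed by blast
    show "x \<oplus>\<^bsub>V\<^esub> y \<in> ?L" if xy: "x \<in> ?L" "y \<in> ?L" for x y
    proof -
      from xy obtain a b where "a \<in> carrier K" "b \<in> carrier K" "x = a \<odot>\<^bsub>V\<^esub> v" "y = b \<odot>\<^bsub>V\<^esub> v"
        by blast
      then show ?thesis
        using smult_l_distr[of a b v] v by (auto intro!: exI[of _ "a \<oplus>\<^bsub>K\<^esub> b"])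
    qed
    show "a \<odot>\<^bsub>V\<^esub> x \<in> ?L" if ax: "a \<in> carrier K" "x \<in> ?L" for a x
    proof -
      from ax obtain b where "b \<in> carrier K" "x = b \<odot>\<^bsub>V\<^esub> v" by blast
      then show ?thesis
        using smult_assoc[of a b v] v ax by (auto intro!: exI[of _ "a \<otimes>\<^bsub>K\<^esub> b"])
    qed
  qed
  moreover have "{v} \<subseteq> ?L"
    using smult_one[OF v, symmetric] K.one_closed by blast
  ultimately show "lin_span K V {v} \<subseteq> ?L" by (rule lin_span_least)
  show "?L \<subseteq> lin_span K V {v}"
    using submoduleD(4)[OF lin_span_submodule[of "{v}"]] lin_span_incl[of "{v}"] v by auto
qed

lemma pg_line_scalars:
  assumes "L \<in> pg_lines K V"
  shows "\<exists>g. inj_on g (carrier K) \<and> g ` carrier K \<subseteq> L"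
proof -
  obtain x y where xy: "x \<in> pg_points K V" "y \<in> pg_points K V" "x \<noteq> y"
    and L: "L = {z \<in> pg_points K V. z \<subseteq> lin_span K V (x \<union> y)}"
    using assms unfolding pg_lines_def by blast
  obtain a b where a: "a \<in> carrier V" "a \<noteq> \<zero>\<^bsub>V\<^esub>" "x = lin_span K V {a}"
    and b: "b \<in> carrier V" "b \<noteq> \<zero>\<^bsub>V\<^esub>" "y = lin_span K V {b}"
    using xy unfolding pg_points_def by blast
  have indep: False if c: "c \<in> carrier K" and ab: "a = c \<odot>\<^bsub>V\<^esub> b" for c
  proof -
    have "c \<noteq> \<zero>\<^bsub>K\<^esub>" using ab a b smult_l_null by auto
    then obtain d where d: "d \<in> carrier K" "d \<otimes>\<^bsub>K\<^esub> c = \<one>\<^bsub>K\<^esub>" using c skew_inverse by blast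
    then have ba: "b = d \<odot>\<^bsub>V\<^esub> a" using ab c b smult_assoc[of d c b] by simp
    have "b \<in> x" "a \<in> y"
      unfolding a(3) b(3) lin_span_singleton[OF a(1)] lin_span_singleton[OF b(1)]
      using ab ba c d by auto
    then have "x \<subseteq> y" "y \<subseteq> x"
      using lin_span_least[OF lin_span_submodule] a b by auto
    then show False using xy by auto
  qed
  let ?w = "\<lambda>t. a \<oplus>\<^bsub>V\<^esub> t \<odot>\<^bsub>V\<^esub> b"
  let ?g = "\<lambda>t. lin_span K V {?w t}"
  have span_sub: "x \<union> y \<subseteq> carrier V"
    using a b submoduleD(1)[OF lin_span_submodule] by auto
  note S = lin_span_submodule[OF span_sub]
  have ab_in: "a \<in> lin_span K V (x \<union> y)" "b \<in> lin_span K V (x \<union> y)"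
    using lin_span_incl a b by blast+
  have "?g t \<in> L" if t: "t \<in> carrier K" for t
  proof -
    have w: "?w t \<in> carrier V" using a b t by auto
    have "?w t \<noteq> \<zero>\<^bsub>V\<^esub>"
    proof
      assume "?w t = \<zero>\<^bsub>V\<^esub>"
      then have "a = \<ominus>\<^bsub>V\<^esub> (t \<odot>\<^bsub>V\<^esub> b)"
        using a b t by (metis V.minus_equality smult_closed)
      also have "\<dots> = (\<ominus>\<^bsub>K\<^esub> \<one>\<^bsub>K\<^esub> \<otimes>\<^bsub>K\<^esub> t) \<odot>\<^bsub>V\<^esub> b"
        using smult_minus_one[of "t \<odot>\<^bsub>V\<^esub> b"] smult_assoc b t by simp
      finally show False using indep[of "\<ominus>\<^bsub>K\<^esub> \<one>\<^bsub>K\<^esub> \<otimes>\<^bsub>K\<^esub> t"] t by simp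
    qed
    moreover have "?g t \<subseteq> lin_span K V (x \<union> y)"
      using lin_span_least[OF S, of "{?w t}"] ab_in t submoduleD(3,4)[OF S] by auto
    ultimately show ?thesis unfolding L pg_points_def using w by blast
  qed
  moreover have "inj_on ?g (carrier K)"
  proof (rule inj_onI)
    fix t u assume t: "t \<in> carrier K" and u: "u \<in> carrier K" and eq: "?g t = ?g u"
    have w: "?w t \<in> carrier V" "?w u \<in> carrier V" using a b t u by auto
    obtain s where s: "s \<in> carrier K" "?w t = s \<odot>\<^bsub>V\<^esub> ?w u"
      using eq lin_span_incl[of "{?w t}"] lin_span_singleton[OF w(2)] by auto
    then have *: "a \<oplus>\<^bsub>V\<^esub> t \<odot>\<^bsub>V\<^esub> b = s \<odot>\<^bsub>V\<^esub> a \<oplus>\<^bsub>V\<^esub> (s \<otimes>\<^bsub>K\<^esub> u) \<odot>\<^bsub>V\<^esub> b"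
      using smult_r_distr smult_assoc a b u by simp
    let ?m = "\<lambda>c. \<ominus>\<^bsub>K\<^esub> \<one>\<^bsub>K\<^esub> \<otimes>\<^bsub>K\<^esub> c"
    have neg: "(?m c) \<odot>\<^bsub>V\<^esub> z = \<ominus>\<^bsub>V\<^esub> (c \<odot>\<^bsub>V\<^esub> z)" if "c \<in> carrier K" "z \<in> carrier V" for c z
      using that smult_minus_one[of "c \<odot>\<^bsub>V\<^esub> z"] smult_assoc by simp
    have rearr: "p \<oplus>\<^bsub>V\<^esub> \<ominus>\<^bsub>V\<^esub> r = q \<oplus>\<^bsub>V\<^esub> \<ominus>\<^bsub>V\<^esub> v" if "p \<oplus>\<^bsub>V\<^esub> v = r \<oplus>\<^bsub>V\<^esub> q"
      "p \<in> carrier V" "q \<in> carrier V" "r \<in> carrier V" "v \<in> carrier V" for p q r v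
    proof -
      have "p = (p \<oplus>\<^bsub>V\<^esub> v) \<oplus>\<^bsub>V\<^esub> \<ominus>\<^bsub>V\<^esub> v"
        using that(2-) by (simp add: V.a_assoc V.r_neg)
      also have "\<dots> = (q \<oplus>\<^bsub>V\<^esub> \<ominus>\<^bsub>V\<^esub> v) \<oplus>\<^bsub>V\<^esub> r"
        unfolding that(1) using that(2-) by (simp add: V.a_ac)
      finally show ?thesis
        using that(2-) by (metis V.a_assoc V.r_neg V.r_zero V.a_closed V.a_inv_closed)
    qed
    have key: "(\<one>\<^bsub>K\<^esub> \<oplus>\<^bsub>K\<^esub> ?m s) \<odot>\<^bsub>V\<^esub> a = ((s \<otimes>\<^bsub>K\<^esub> u) \<oplus>\<^bsub>K\<^esub> ?m t) \<odot>\<^bsub>V\<^esub> b"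
      using rearr[OF *] a b s t u by (simp add: smult_l_distr neg)
    have neg_cancel: "c = d" if "c \<oplus>\<^bsub>K\<^esub> ?m d = \<zero>\<^bsub>K\<^esub>" "c \<in> carrier K" "d \<in> carrier K" for c d
    proof -
      have "c \<ominus>\<^bsub>K\<^esub> d = \<zero>\<^bsub>K\<^esub>"
        using that by (simp add: K.l_minus K.minus_eq)
      then show ?thesis
        using that by (metis K.minus_eq K.minus_equality K.minus_minus K.add.inv_closed)
    qed
    have s1: "\<one>\<^bsub>K\<^esub> \<oplus>\<^bsub>K\<^esub> ?m s = \<zero>\<^bsub>K\<^esub>"
    proof (rule ccontr)
      assume "\<one>\<^bsub>K\<^esub> \<oplus>\<^bsub>K\<^esub> ?m s \<noteq> \<zero>\<^bsub>K\<^esub>"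
      then obtain d where d: "d \<in> carrier K" "d \<otimes>\<^bsub>K\<^esub> (\<one>\<^bsub>K\<^esub> \<oplus>\<^bsub>K\<^esub> ?m s) = \<one>\<^bsub>K\<^esub>"
        using skew_inverse[of "\<one>\<^bsub>K\<^esub> \<oplus>\<^bsub>K\<^esub> ?m s"] s by auto
      have "a = (d \<otimes>\<^bsub>K\<^esub> (\<one>\<^bsub>K\<^esub> \<oplus>\<^bsub>K\<^esub> ?m s)) \<odot>\<^bsub>V\<^esub> a" using d a by simp
      also have "\<dots> = d \<odot>\<^bsub>V\<^esub> ((\<one>\<^bsub>K\<^esub> \<oplus>\<^bsub>K\<^esub> ?m s) \<odot>\<^bsub>V\<^esub> a)"
        using d s a by (intro smult_assoc) auto
      also have "\<dots> = (d \<otimes>\<^bsub>K\<^esub> ((s \<otimes>\<^bsub>K\<^esub> u) \<oplus>\<^bsub>K\<^esub> ?m t)) \<odot>\<^bsub>V\<^esub> b"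
        unfolding key using d s t u b by (intro smult_assoc[symmetric]) auto
      finally show False using indep[of "d \<otimes>\<^bsub>K\<^esub> ((s \<otimes>\<^bsub>K\<^esub> u) \<oplus>\<^bsub>K\<^esub> ?m t)"] d s t u by simp
    qed
    have "((s \<otimes>\<^bsub>K\<^esub> u) \<oplus>\<^bsub>K\<^esub> ?m t) \<odot>\<^bsub>V\<^esub> b = \<zero>\<^bsub>V\<^esub>"
      using key s1 smult_l_null[OF a(1)] by simp
    then have "(s \<otimes>\<^bsub>K\<^esub> u) \<oplus>\<^bsub>K\<^esub> ?m t = \<zero>\<^bsub>K\<^esub>"
      using smult_eq_zero b s t u by auto
    moreover have "s = \<one>\<^bsub>K\<^esub>"
      using neg_cancel[of "\<one>\<^bsub>K\<^esub>" s] s1 s by simp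
    ultimately show "t = u"
      using neg_cancel[of u t] t u by simp
  qed
  ultimately show ?thesis by blast
qed


lemma finsum_smult:
  assumes "finite F" "a \<in> carrier K" "f \<in> F \<rightarrow> carrier V"
  shows "a \<odot>\<^bsub>V\<^esub> finsum V f F = finsum V (\<lambda>p. a \<odot>\<^bsub>V\<^esub> f p) F"
  using assms
proof (induction F rule: finite_induct)
  case empty
  then show ?case by (simp add: smult_r_null)
next
  case (insert p F)
  then have "f \<in> F \<rightarrow> carrier V" "f p \<in> carrier V" by auto
  moreover from this have "(\<lambda>p. a \<odot>\<^bsub>V\<^esub> f p) \<in> F \<rightarrow> carrier V" using insert by auto
  ultimately show ?case
    using insert by (simp add: V.finsum_insert smult_r_distr V.finsum_closed)
qed

lemma coordinates:
  fixes v :: "'p \<Rightarrow> 'v"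
  assumes v: "v \<in> P \<rightarrow> carrier V" and span: "lin_span K V (v ` P) = carrier V"
  shows "\<exists>h :: 'v \<Rightarrow> 'p \<Rightarrow> 'k. inj_on h (carrier V) \<and> (\<forall>x\<in>carrier V. \<forall>p. h x p \<in> carrier K)"
proof -
  define N where "N c = {p \<in> P. c p \<noteq> \<zero>\<^bsub>K\<^esub>}" for c :: "'p \<Rightarrow> 'k"
  define \<Phi> where "\<Phi> c = finsum V (\<lambda>p. c p \<odot>\<^bsub>V\<^esub> v p) (N c)" for c
  define A where "A = {c. (\<forall>p. c p \<in> carrier K) \<and> finite (N c)}"
  have clos: "(\<lambda>p. c p \<odot>\<^bsub>V\<^esub> v p) \<in> F \<rightarrow> carrier V" if "c \<in> A" "F \<subseteq> P" for c F
    using that v unfolding A_def by fastforce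
  have ext: "\<Phi> c = finsum V (\<lambda>p. c p \<odot>\<^bsub>V\<^esub> v p) F"
    if "c \<in> A" "finite F" "N c \<subseteq> F" "F \<subseteq> P" for c F
    unfolding \<Phi>_def
  proof (rule V.add.finprod_mono_neutral_cong_left)
    show "c p \<odot>\<^bsub>V\<^esub> v p = \<zero>\<^bsub>V\<^esub>" if "p \<in> F - N c" for p
    proof -
      have "p \<in> P" "c p = \<zero>\<^bsub>K\<^esub>" using that \<open>F \<subseteq> P\<close> unfolding N_def by auto
      then show ?thesis using v smult_l_null[of "v p"] by auto
    qed
  qed (use that clos[of c F] in auto)
  have "submodule (\<Phi> ` A) K V"
  proof (rule submoduleI)
    show "\<Phi> ` A \<subseteq> carrier V"
    proof
      fix x assume "x \<in> \<Phi> ` A"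
      then obtain c where c: "c \<in> A" "x = \<Phi> c" by blast
      show "x \<in> carrier V"
        unfolding c(2) \<Phi>_def by (rule V.finsum_closed, rule clos[OF c(1)]) (auto simp: N_def)
    qed
    have z: "(\<lambda>_. \<zero>\<^bsub>K\<^esub>) \<in> A" "\<Phi> (\<lambda>_. \<zero>\<^bsub>K\<^esub>) = \<zero>\<^bsub>V\<^esub>"
      unfolding A_def \<Phi>_def N_def by auto
    then show "\<zero>\<^bsub>V\<^esub> \<in> \<Phi> ` A" by (metis image_eqI)
    show "x \<oplus>\<^bsub>V\<^esub> y \<in> \<Phi> ` A" if xy: "x \<in> \<Phi> ` A" "y \<in> \<Phi> ` A" for x y
    proof -
      from xy obtain c d where c: "c \<in> A" "x = \<Phi> c" and d: "d \<in> A" "y = \<Phi> d" by blast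
      let ?e = "\<lambda>p. c p \<oplus>\<^bsub>K\<^esub> d p" and ?F = "N c \<union> N d"
      have F: "finite ?F" "?F \<subseteq> P" "N ?e \<subseteq> ?F"
        using c d unfolding A_def N_def by auto
      then have e: "?e \<in> A"
        using c d finite_subset[OF F(3,1)] unfolding A_def by auto
      have "\<Phi> ?e = finsum V (\<lambda>p. ?e p \<odot>\<^bsub>V\<^esub> v p) ?F"
        using ext[OF e F(1) F(3) F(2)] .
      also have "\<dots> = finsum V (\<lambda>p. c p \<odot>\<^bsub>V\<^esub> v p \<oplus>\<^bsub>V\<^esub> d p \<odot>\<^bsub>V\<^esub> v p) ?F"
      proof (rule V.finsum_cong')
        show "(\<lambda>p. c p \<odot>\<^bsub>V\<^esub> v p \<oplus>\<^bsub>V\<^esub> d p \<odot>\<^bsub>V\<^esub> v p) \<in> ?F \<rightarrow> carrier V"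
          using clos[OF c(1) F(2)] clos[OF d(1) F(2)] by blast
        show "?e p \<odot>\<^bsub>V\<^esub> v p = c p \<odot>\<^bsub>V\<^esub> v p \<oplus>\<^bsub>V\<^esub> d p \<odot>\<^bsub>V\<^esub> v p" if "p \<in> ?F" for p
          using that F(2) v c d unfolding A_def by (intro smult_l_distr) auto
      qed simp
      also have "\<dots> = finsum V (\<lambda>p. c p \<odot>\<^bsub>V\<^esub> v p) ?F \<oplus>\<^bsub>V\<^esub> finsum V (\<lambda>p. d p \<odot>\<^bsub>V\<^esub> v p) ?F"
        by (rule V.finsum_addf[OF clos[OF c(1) F(2)] clos[OF d(1) F(2)]])
      also have "\<dots> = x \<oplus>\<^bsub>V\<^esub> y"
        unfolding c(2) d(2) using ext[OF c(1) F(1) _ F(2)] ext[OF d(1) F(1) _ F(2)] by simp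
      finally show ?thesis using e by (metis image_eqI)
    qed
    show "a \<odot>\<^bsub>V\<^esub> x \<in> \<Phi> ` A" if a: "a \<in> carrier K" and x: "x \<in> \<Phi> ` A" for a x
    proof -
      from x obtain c where c: "c \<in> A" "x = \<Phi> c" by blast
      let ?e = "\<lambda>p. a \<otimes>\<^bsub>K\<^esub> c p"
      have F: "finite (N c)" "N c \<subseteq> P" "N ?e \<subseteq> N c"
        using c a unfolding A_def N_def by auto
      then have e: "?e \<in> A"
        using c a finite_subset[OF F(3,1)] unfolding A_def by auto
      have "\<Phi> ?e = finsum V (\<lambda>p. ?e p \<odot>\<^bsub>V\<^esub> v p) (N c)"
        using ext[OF e F(1) F(3) F(2)] .
      also have "\<dots> = finsum V (\<lambda>p. a \<odot>\<^bsub>V\<^esub> (c p \<odot>\<^bsub>V\<^esub> v p)) (N c)"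
      proof (rule V.finsum_cong')
        show "(\<lambda>p. a \<odot>\<^bsub>V\<^esub> (c p \<odot>\<^bsub>V\<^esub> v p)) \<in> N c \<rightarrow> carrier V"
          using clos[OF c(1) F(2)] a by blast
        show "?e p \<odot>\<^bsub>V\<^esub> v p = a \<odot>\<^bsub>V\<^esub> (c p \<odot>\<^bsub>V\<^esub> v p)" if "p \<in> N c" for p
          using that F(2) v a c unfolding A_def by (intro smult_assoc) auto
      qed simp
      also have "\<dots> = a \<odot>\<^bsub>V\<^esub> x"
        unfolding c(2) \<Phi>_def by (rule finsum_smult[OF F(1) a clos[OF c(1) F(2)], symmetric])
      finally show ?thesis using e by (metis image_eqI)
    qed
  qed
  moreover have "v ` P \<subseteq> \<Phi> ` A"
  proof
    fix x assume "x \<in> v ` P"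
    then obtain p where p: "p \<in> P" "x = v p" by blast
    let ?e = "\<lambda>q. if q = p then \<one>\<^bsub>K\<^esub> else \<zero>\<^bsub>K\<^esub>"
    have "N ?e \<subseteq> {p}" unfolding N_def by auto
    moreover from this have e: "?e \<in> A" unfolding A_def by (auto dest: finite_subset)
    ultimately have "\<Phi> ?e = finsum V (\<lambda>q. ?e q \<odot>\<^bsub>V\<^esub> v q) {p}"
      using ext[of ?e "{p}"] p by simp
    also have "\<dots> = x" using p v by (auto simp: Pi_iff)
    finally show "x \<in> \<Phi> ` A" using e by (metis image_eqI)
  qed
  ultimately have sub: "carrier V \<subseteq> \<Phi> ` A"
    using lin_span_least span by metis
  have "inj_on (inv_into A \<Phi>) (carrier V)"
    using inj_on_inv_into[OF sub] .
  moreover have "inv_into A \<Phi> x p \<in> carrier K" if "x \<in> carrier V" for x p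
    using inv_into_into[of x \<Phi> A] sub that unfolding A_def by blast
  ultimately show ?thesis by blast
qed

end

lemma transport:
  fixes K :: "('k, 'm) ring_scheme" and V :: "('k, 'v, 'w) module_scheme"
    and i :: "'k \<Rightarrow> 'a" and j :: "'v \<Rightarrow> 'b"
  assumes "left_vector_space K V" and i: "inj_on i (carrier K)" and j: "inj_on j (carrier V)"
  shows "\<exists>(K' :: 'a ring) (V' :: ('a, 'b) module). left_vector_space K' V' \<and>
    semilinear K V K' V' i j \<and> bij_betw j (carrier V) (carrier V')"
proof -
  interpret left_vector_space K V by fact
  let ?i = "inv_into (carrier K) i" and ?j = "inv_into (carrier V) j"
  define K' :: "'a ring" where
    "K' = \<lparr>carrier = i ` carrier K, mult = \<lambda>x y. i (?i x \<otimes>\<^bsub>K\<^esub> ?i y), one = i \<one>\<^bsub>K\<^esub>,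
           zero = i \<zero>\<^bsub>K\<^esub>, add = \<lambda>x y. i (?i x \<oplus>\<^bsub>K\<^esub> ?i y)\<rparr>"
  define V' :: "('a, 'b) module" where
    "V' = \<lparr>carrier = j ` carrier V, mult = undefined, one = undefined,
           zero = j \<zero>\<^bsub>V\<^esub>, add = \<lambda>x y. j (?j x \<oplus>\<^bsub>V\<^esub> ?j y),
           smult = \<lambda>a x. j (?i a \<odot>\<^bsub>V\<^esub> ?j x)\<rparr>"
  have ii [simp]: "?i (i a) = a" if "a \<in> carrier K" for a using i that by simp
  have jj [simp]: "?j (j x) = x" if "x \<in> carrier V" for x using j that by simp
  have K'_simps [simp]: "carrier K' = i ` carrier K" "mult K' = (\<lambda>x y. i (?i x \<otimes>\<^bsub>K\<^esub> ?i y))"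
    "one K' = i \<one>\<^bsub>K\<^esub>" "zero K' = i \<zero>\<^bsub>K\<^esub>" "add K' = (\<lambda>x y. i (?i x \<oplus>\<^bsub>K\<^esub> ?i y))"
    unfolding K'_def by simp_all
  have V'_simps [simp]: "carrier V' = j ` carrier V" "zero V' = j \<zero>\<^bsub>V\<^esub>"
    "add V' = (\<lambda>x y. j (?j x \<oplus>\<^bsub>V\<^esub> ?j y))" "smult V' = (\<lambda>a x. j (?i a \<odot>\<^bsub>V\<^esub> ?j x))"
    unfolding V'_def by simp_all
  have K'_ring: "ring K'"
  proof (rule ringI)
    show "abelian_group K'"
    proof (rule abelian_groupI)
      show "\<exists>y\<in>carrier K'. y \<oplus>\<^bsub>K'\<^esub> x = \<zero>\<^bsub>K'\<^esub>" if x: "x \<in> carrier K'" for x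
      proof -
        from x obtain a where "a \<in> carrier K" "x = i a" by auto
        then show ?thesis by (intro bexI[of _ "i (\<ominus>\<^bsub>K\<^esub> a)"]) (auto simp: K.l_neg)
      qed
    qed (auto simp: K.a_ac)
    show "monoid K'" by (rule monoidI) (auto simp: K.m_assoc)
  qed (auto simp: K.l_distr K.r_distr)
  have V'_group: "abelian_group V'"
  proof (rule abelian_groupI)
    show "\<exists>y\<in>carrier V'. y \<oplus>\<^bsub>V'\<^esub> x = \<zero>\<^bsub>V'\<^esub>" if x: "x \<in> carrier V'" for x
    proof -
      from x obtain a where "a \<in> carrier V" "x = j a" by auto
      then show ?thesis by (intro bexI[of _ "j (\<ominus>\<^bsub>V\<^esub> a)"]) (auto simp: V.l_neg)
    qed
  qed (auto simp: V.a_ac)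
  have "Units K' = carrier K' - {\<zero>\<^bsub>K'\<^esub>}"
  proof -
    have "i a \<in> Units K' \<longleftrightarrow> a \<in> Units K" if "a \<in> carrier K" for a
      using that i unfolding Units_def by (auto simp: inj_on_eq_iff[OF i])
    moreover have "Units K' \<subseteq> i ` carrier K" unfolding Units_def by auto
    ultimately have "Units K' = i ` Units K"
      using K.Units_closed by blast
    also have "\<dots> = carrier K' - {\<zero>\<^bsub>K'\<^esub>}"
      unfolding skew_field_Units using i by (auto simp: inj_on_eq_iff[OF i])
    finally show ?thesis .
  qed
  then have "skew_field K'"
    using K'_ring by (intro skew_field.intro skew_field_axioms.intro)
  moreover have "left_vector_space_axioms K' V'"
    by (rule left_vector_space_axioms.intro)
       (auto simp: smult_l_distr smult_r_distr smult_assoc)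
  ultimately have "left_vector_space K' V'"
    using V'_group by (intro left_vector_space.intro)
  moreover have "semilinear K V K' V' i j"
    unfolding semilinear_def using i
    by (auto intro!: ring_iso_memI simp: bij_betw_def)
  moreover have "bij_betw j (carrier V) (carrier V')"
    using j by (simp add: bij_betw_def)
  ultimately show ?thesis by blast
qed

lemma semilinear_span:
  assumes "left_vector_space K1 V1" "left_vector_space K2 V2" and f: "semilinear K1 V1 K2 V2 \<sigma> f"
    and X: "X \<subseteq> carrier V1"
  shows "f ` lin_span K1 V1 X = lin_span K2 V2 (f ` X)"
proof
  interpret A: left_vector_space K1 V1 by fact
  interpret B: left_vector_space K2 V2 by fact
  have f_in: "f x \<in> carrier V2" if "x \<in> carrier V1" for x
    using f that unfolding semilinear_def by auto
  have f_add: "f (x \<oplus>\<^bsub>V1\<^esub> y) = f x \<oplus>\<^bsub>V2\<^esub> f y" if "x \<in> carrier V1" "y \<in> carrier V1" for x y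
    using f that unfolding semilinear_def by auto
  have f_smult: "f (a \<odot>\<^bsub>V1\<^esub> x) = \<sigma> a \<odot>\<^bsub>V2\<^esub> f x" if "a \<in> carrier K1" "x \<in> carrier V1" for a x
    using f that unfolding semilinear_def by auto
  have \<sigma>: "\<sigma> ` carrier K1 = carrier K2"
    using f unfolding semilinear_def ring_iso_def bij_betw_def by auto
  have f0: "f \<zero>\<^bsub>V1\<^esub> = \<zero>\<^bsub>V2\<^esub>"
    using f_add[of "\<zero>\<^bsub>V1\<^esub>" "\<zero>\<^bsub>V1\<^esub>"] f_in[of "\<zero>\<^bsub>V1\<^esub>"] by simp
  note S1 = A.lin_span_submodule[OF X]
  have S2: "submodule (lin_span K2 V2 (f ` X)) K2 V2"
    using X f_in by (intro B.lin_span_submodule) auto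
  let ?H = "{x \<in> carrier V1. f x \<in> lin_span K2 V2 (f ` X)}"
  have "submodule ?H K1 V1"
    using \<sigma> by (intro A.submoduleI) (auto simp: f_add f_smult f0 intro!: B.submoduleD(2-4)[OF S2])
  moreover have "X \<subseteq> ?H" using X B.lin_span_incl[of "f ` X"] by auto
  ultimately have "lin_span K1 V1 X \<subseteq> ?H" by (rule A.lin_span_least)
  then show "f ` lin_span K1 V1 X \<subseteq> lin_span K2 V2 (f ` X)" by blast
  have sub: "lin_span K1 V1 X \<subseteq> carrier V1" using A.submoduleD(1)[OF S1] .
  have "submodule (f ` lin_span K1 V1 X) K2 V2"
  proof (rule B.submoduleI)
    show "f ` lin_span K1 V1 X \<subseteq> carrier V2" using sub f_in by blast
    show "\<zero>\<^bsub>V2\<^esub> \<in> f ` lin_span K1 V1 X"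
      using f0 A.submoduleD(2)[OF S1] by (metis image_eqI)
    show "x \<oplus>\<^bsub>V2\<^esub> y \<in> f ` lin_span K1 V1 X"
      if xy: "x \<in> f ` lin_span K1 V1 X" "y \<in> f ` lin_span K1 V1 X" for x y
    proof -
      from xy obtain a b where ab: "a \<in> lin_span K1 V1 X" "b \<in> lin_span K1 V1 X" "x = f a" "y = f b"
        by blast
      then show ?thesis
        using f_add[of a b] sub A.submoduleD(3)[OF S1, of a b] by (metis image_eqI subsetD)
    qed
    show "a \<odot>\<^bsub>V2\<^esub> x \<in> f ` lin_span K1 V1 X"
      if ax: "a \<in> carrier K2" "x \<in> f ` lin_span K1 V1 X" for a x
    proof -
      from ax obtain b c where ab: "c \<in> lin_span K1 V1 X" "b \<in> carrier K1" "a = \<sigma> b" "x = f c"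
        using \<sigma> by blast
      then show ?thesis
        using f_smult[of b c] sub A.submoduleD(4)[OF S1, of b c] by (metis image_eqI subsetD)
    qed
  qed
  moreover have "f ` X \<subseteq> f ` lin_span K1 V1 X" using A.lin_span_incl[of X] by blast
  ultimately show "lin_span K2 V2 (f ` X) \<subseteq> f ` lin_span K1 V1 X" by (rule B.lin_span_least)
qed

lemma embedding_transport:
  assumes emb: "embedding \<Gamma> K1 V1 \<epsilon>" and V2: "left_vector_space K2 V2"
    and f: "semilinear K1 V1 K2 V2 \<sigma> f" and bij: "bij_betw f (carrier V1) (carrier V2)"
    and \<Gamma>: "\<forall>l\<in>lines \<Gamma>. l \<subseteq> points \<Gamma>"
  shows "embedding \<Gamma> K2 V2 (\<lambda>p. f ` \<epsilon> p)"
proof -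
  have V1: "left_vector_space K1 V1" using emb unfolding embedding_def by auto
  interpret A: left_vector_space K1 V1 by fact
  interpret B: left_vector_space K2 V2 by fact
  note span = semilinear_span[OF V1 V2 f]
  have inj: "inj_on f (carrier V1)" and im: "f ` carrier V1 = carrier V2"
    using bij by (auto simp: bij_betw_def)
  have f0: "f \<zero>\<^bsub>V1\<^esub> = \<zero>\<^bsub>V2\<^esub>"
  proof -
    have "f (\<zero>\<^bsub>V1\<^esub> \<oplus>\<^bsub>V1\<^esub> \<zero>\<^bsub>V1\<^esub>) = f \<zero>\<^bsub>V1\<^esub> \<oplus>\<^bsub>V2\<^esub> f \<zero>\<^bsub>V1\<^esub>" "f \<zero>\<^bsub>V1\<^esub> \<in> carrier V2"
      using f A.V.zero_closed unfolding semilinear_def by blast+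
    then show ?thesis by simp
  qed
  have pg: "pg_points K2 V2 = (`) f ` pg_points K1 V1"
  proof
    show "pg_points K2 V2 \<subseteq> (`) f ` pg_points K1 V1"
    proof
      fix z assume "z \<in> pg_points K2 V2"
      then obtain w where w: "w \<in> carrier V2" "w \<noteq> \<zero>\<^bsub>V2\<^esub>" "z = lin_span K2 V2 {w}"
        unfolding pg_points_def by blast
      then obtain v where v: "v \<in> carrier V1" "w = f v" using im by blast
      then have "v \<noteq> \<zero>\<^bsub>V1\<^esub>" "z = f ` lin_span K1 V1 {v}" using w f0 span[of "{v}"] by auto
      then show "z \<in> (`) f ` pg_points K1 V1" unfolding pg_points_def using v by blast
    qed
    show "(`) f ` pg_points K1 V1 \<subseteq> pg_points K2 V2"
    proof
      fix z assume "z \<in> (`) f ` pg_points K1 V1"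
      then obtain v where v: "v \<in> carrier V1" "v \<noteq> \<zero>\<^bsub>V1\<^esub>" "z = f ` lin_span K1 V1 {v}"
        unfolding pg_points_def by blast
      have "f v \<in> carrier V2" using v im by blast
      moreover have "f v \<noteq> \<zero>\<^bsub>V2\<^esub>"
        using v f0 inj_on_eq_iff[OF inj v(1) A.V.zero_closed] by simp
      moreover have "z = lin_span K2 V2 {f v}" using v span[of "{v}"] by simp
      ultimately show "z \<in> pg_points K2 V2" unfolding pg_points_def by blast
    qed
  qed
  have pg_sub: "z \<subseteq> carrier V1" if z: "z \<in> pg_points K1 V1" for z
  proof -
    from z obtain v where "v \<in> carrier V1" "z = lin_span K1 V1 {v}"
      unfolding pg_points_def by blast
    then show ?thesis using A.submoduleD(1)[OF A.lin_span_submodule[of "{v}"]] by simp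
  qed
  have \<epsilon>: "\<epsilon> p \<in> pg_points K1 V1" if "p \<in> points \<Gamma>" for p
    using emb that unfolding embedding_def by auto
  have inj2: "inj_on ((`) f) (pg_points K1 V1)"
    using inj_on_image_eq_iff[OF inj] pg_sub by (auto intro!: inj_onI)
  have "(\<lambda>p. f ` \<epsilon> p) \<in> points \<Gamma> \<rightarrow> pg_points K2 V2"
    unfolding pg using \<epsilon> by auto
  moreover have "inj_on (\<lambda>p. f ` \<epsilon> p) (points \<Gamma>)"
  proof (rule inj_onI)
    fix p q assume "p \<in> points \<Gamma>" "q \<in> points \<Gamma>" "f ` \<epsilon> p = f ` \<epsilon> q"
    moreover from this have "\<epsilon> p = \<epsilon> q" using inj_onD[OF inj2] \<epsilon> by blast
    ultimately show "p = q" using emb unfolding embedding_def inj_on_def by blast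
  qed
  moreover have "lin_span K2 V2 (\<Union>p\<in>points \<Gamma>. f ` \<epsilon> p) = carrier V2"
  proof -
    have "lin_span K2 V2 (f ` (\<Union>p\<in>points \<Gamma>. \<epsilon> p)) = f ` lin_span K1 V1 (\<Union>p\<in>points \<Gamma>. \<epsilon> p)"
      using span[of "\<Union>p\<in>points \<Gamma>. \<epsilon> p"] \<epsilon> pg_sub by blast
    also have "\<dots> = carrier V2" using emb im unfolding embedding_def by simp
    finally show ?thesis by (simp add: image_UN)
  qed
  moreover have "(\<lambda>p. f ` \<epsilon> p) ` l \<in> pg_lines K2 V2" if l: "l \<in> lines \<Gamma>" for l
  proof -
    have "\<epsilon> ` l \<in> pg_lines K1 V1" using emb l unfolding embedding_def by blast
    then obtain x y where xy: "x \<in> pg_points K1 V1" "y \<in> pg_points K1 V1" "x \<noteq> y"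
      and l': "\<epsilon> ` l = {z \<in> pg_points K1 V1. z \<subseteq> lin_span K1 V1 (x \<union> y)}"
      unfolding pg_lines_def by blast
    have xy_sub: "x \<union> y \<subseteq> carrier V1" using xy pg_sub by blast
    note sub = A.submoduleD(1)[OF A.lin_span_submodule[OF xy_sub]]
    have "(\<lambda>p. f ` \<epsilon> p) ` l = (`) f ` (\<epsilon> ` l)" by (simp add: image_image)
    also have "\<dots> = {z \<in> pg_points K2 V2. z \<subseteq> f ` lin_span K1 V1 (x \<union> y)}"
    proof -
      have "f ` z \<subseteq> f ` lin_span K1 V1 (x \<union> y) \<longleftrightarrow> z \<subseteq> lin_span K1 V1 (x \<union> y)"
        if "z \<in> pg_points K1 V1" for z
        using inj_on_image_mem_iff[OF inj _ sub] pg_sub[OF that] by blast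
      then show ?thesis unfolding l' pg by blast
    qed
    also have "\<dots> = {z \<in> pg_points K2 V2. z \<subseteq> lin_span K2 V2 (f ` x \<union> f ` y)}"
      using span[OF xy_sub] by (simp add: image_Un)
    finally have L: "(\<lambda>p. f ` \<epsilon> p) ` l = \<dots>" .
    have "f ` x \<in> pg_points K2 V2" "f ` y \<in> pg_points K2 V2" "f ` x \<noteq> f ` y"
      using xy inj_onD[OF inj2] unfolding pg by auto
    then show ?thesis unfolding L pg_lines_def by blast
  qed
  ultimately show ?thesis using V2 unfolding embedding_def by blast
qed

lemma semilinear_inv:
  assumes V1: "left_vector_space K1 V1"
    and f: "semilinear K1 V1 K2 V2 \<sigma> f" and bij: "bij_betw f (carrier V1) (carrier V2)"
  shows "semilinear K2 V2 K1 V1 (inv_into (carrier K1) \<sigma>) (inv_into (carrier V1) f)"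
proof -
  interpret left_vector_space K1 V1 by fact
  let ?\<sigma> = "inv_into (carrier K1) \<sigma>" and ?f = "inv_into (carrier V1) f"
  have \<sigma>: "\<sigma> \<in> ring_iso K1 K2" using f unfolding semilinear_def by blast
  then have \<sigma>b: "bij_betw \<sigma> (carrier K1) (carrier K2)" unfolding ring_iso_def by blast
  have inj: "inj_on f (carrier V1)" using bij by (simp add: bij_betw_def)
  have "?f (f x \<oplus>\<^bsub>V2\<^esub> f y) = x \<oplus>\<^bsub>V1\<^esub> y" if "x \<in> carrier V1" "y \<in> carrier V1" for x y
  proof -
    have "f x \<oplus>\<^bsub>V2\<^esub> f y = f (x \<oplus>\<^bsub>V1\<^esub> y)" using f that unfolding semilinear_def by simp
    then show ?thesis using inv_into_f_f[OF inj, of "x \<oplus>\<^bsub>V1\<^esub> y"] that by simp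
  qed
  moreover have "?f (\<sigma> a \<odot>\<^bsub>V2\<^esub> f x) = a \<odot>\<^bsub>V1\<^esub> x" if "a \<in> carrier K1" "x \<in> carrier V1" for a x
  proof -
    have "\<sigma> a \<odot>\<^bsub>V2\<^esub> f x = f (a \<odot>\<^bsub>V1\<^esub> x)" using f that unfolding semilinear_def by simp
    then show ?thesis using inv_into_f_f[OF inj, of "a \<odot>\<^bsub>V1\<^esub> x"] that by simp
  qed
  moreover have "\<exists>x\<in>carrier V1. y = f x" if "y \<in> carrier V2" for y
    using bij that by (auto simp: bij_betw_def)
  moreover have "\<exists>a\<in>carrier K1. b = \<sigma> a" if "b \<in> carrier K2" for b
    using \<sigma>b that by (auto simp: bij_betw_def)
  ultimately have *: "?f (x \<oplus>\<^bsub>V2\<^esub> y) = ?f x \<oplus>\<^bsub>V1\<^esub> ?f y" "?f (b \<odot>\<^bsub>V2\<^esub> x) = ?\<sigma> b \<odot>\<^bsub>V1\<^esub> ?f x"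
    if "x \<in> carrier V2" "y \<in> carrier V2" "b \<in> carrier K2" for x y b
    using that inv_into_f_f[OF inj] inv_into_f_f[OF bij_betw_imp_inj_on[OF \<sigma>b]] by metis+
  have "\<one>\<^bsub>K2\<^esub> \<in> carrier K2"
    using ring_iso_memE(1)[OF \<sigma> K.one_closed] ring_iso_memE(4)[OF \<sigma>] by simp
  moreover have "?f \<in> carrier V2 \<rightarrow> carrier V1"
    using bij_betw_apply[OF bij_betw_inv_into[OF bij]] by blast
  ultimately show ?thesis
    unfolding semilinear_def using ring_iso_set_sym[OF K.ring_axioms \<sigma>] *
    by (intro conjI ballI) assumption+
qed

lemma semilinear_comp:
  assumes f: "semilinear K1 V1 K2 V2 \<sigma> f" and g: "semilinear K2 V2 K3 V3 \<tau> g"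
  shows "semilinear K1 V1 K3 V3 (\<tau> \<circ> \<sigma>) (g \<circ> f)"
proof -
  have \<sigma>: "\<sigma> \<in> ring_iso K1 K2" and \<tau>: "\<tau> \<in> ring_iso K2 K3"
    and f': "f \<in> carrier V1 \<rightarrow> carrier V2" and g': "g \<in> carrier V2 \<rightarrow> carrier V3"
    using f g unfolding semilinear_def by simp_all
  have "(g \<circ> f) (x \<oplus>\<^bsub>V1\<^esub> y) = (g \<circ> f) x \<oplus>\<^bsub>V3\<^esub> (g \<circ> f) y"
    if "x \<in> carrier V1" "y \<in> carrier V1" for x y
    using f g that funcset_mem[OF f'] unfolding semilinear_def by simp
  moreover have "(g \<circ> f) (a \<odot>\<^bsub>V1\<^esub> x) = (\<tau> \<circ> \<sigma>) a \<odot>\<^bsub>V3\<^esub> (g \<circ> f) x"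
    if "a \<in> carrier K1" "x \<in> carrier V1" for a x
    using f g that funcset_mem[OF f'] ring_iso_memE(1)[OF \<sigma>] unfolding semilinear_def by simp
  moreover have "g \<circ> f \<in> carrier V1 \<rightarrow> carrier V3"
    using f' g' by auto
  ultimately show ?thesis
    unfolding semilinear_def using ring_iso_set_trans[OF \<sigma> \<tau>] by simp
qed

lemma isomorphic_sym:
  assumes "embedding \<Gamma> K1 V1 \<epsilon>1" and iso: "isomorphic_embeddings \<Gamma> K1 V1 \<epsilon>1 K2 V2 \<epsilon>2"
  shows "isomorphic_embeddings \<Gamma> K2 V2 \<epsilon>2 K1 V1 \<epsilon>1"
proof -
  have V1: "left_vector_space K1 V1" using assms(1) unfolding embedding_def by blast
  interpret left_vector_space K1 V1 by fact
  obtain \<sigma> f where f: "semilinear K1 V1 K2 V2 \<sigma> f" "bij_betw f (carrier V1) (carrier V2)"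
    "\<forall>p\<in>points \<Gamma>. f ` \<epsilon>1 p = \<epsilon>2 p"
    using iso unfolding isomorphic_embeddings_def by blast
  have "inv_into (carrier V1) f ` \<epsilon>2 p = \<epsilon>1 p" if p: "p \<in> points \<Gamma>" for p
  proof -
    have "\<epsilon>1 p \<in> pg_points K1 V1" using assms(1) p unfolding embedding_def by blast
    then have "\<epsilon>1 p \<subseteq> carrier V1"
      using submoduleD(1)[OF lin_span_submodule] unfolding pg_points_def by auto
    then show ?thesis
      using inv_into_image_cancel[OF bij_betw_imp_inj_on[OF f(2)]] f(3) p by metis
  qed
  then show ?thesis
    unfolding isomorphic_embeddings_def
    using semilinear_inv[OF V1 f(1,2)] bij_betw_inv_into[OF f(2)]
    by (intro exI conjI ballI) assumption+
qed

lemma isomorphic_trans: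
  assumes "isomorphic_embeddings \<Gamma> K1 V1 \<epsilon>1 K2 V2 \<epsilon>2" "isomorphic_embeddings \<Gamma> K2 V2 \<epsilon>2 K3 V3 \<epsilon>3"
  shows "isomorphic_embeddings \<Gamma> K1 V1 \<epsilon>1 K3 V3 \<epsilon>3"
proof -
  obtain \<sigma> f where f: "semilinear K1 V1 K2 V2 \<sigma> f" "bij_betw f (carrier V1) (carrier V2)"
    "\<forall>p\<in>points \<Gamma>. f ` \<epsilon>1 p = \<epsilon>2 p"
    using assms(1) unfolding isomorphic_embeddings_def by (elim exE conjE)
  obtain \<tau> g where g: "semilinear K2 V2 K3 V3 \<tau> g" "bij_betw g (carrier V2) (carrier V3)"
    "\<forall>p\<in>points \<Gamma>. g ` \<epsilon>2 p = \<epsilon>3 p"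
    using assms(2) unfolding isomorphic_embeddings_def by (elim exE conjE)
  have "\<forall>p\<in>points \<Gamma>. (g \<circ> f) ` \<epsilon>1 p = \<epsilon>3 p"
    using f(3) g(3) by (metis image_comp)
  then show ?thesis
    unfolding isomorphic_embeddings_def
    using semilinear_comp[OF f(1) g(1)] bij_betw_trans[OF f(2) g(2)]
    by (intro exI conjI)
qed

lemma morphism_trans:
  assumes "morphism_to \<Gamma> K1 V1 \<epsilon>1 K2 V2 \<epsilon>2" "morphism_to \<Gamma> K2 V2 \<epsilon>2 K3 V3 \<epsilon>3"
  shows "morphism_to \<Gamma> K1 V1 \<epsilon>1 K3 V3 \<epsilon>3"
proof -
  obtain \<sigma> f where f: "semilinear K1 V1 K2 V2 \<sigma> f" "\<forall>p\<in>points \<Gamma>. f ` \<epsilon>1 p = \<epsilon>2 p"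
    using assms(1) unfolding morphism_to_def by (elim exE conjE)
  obtain \<tau> g where g: "semilinear K2 V2 K3 V3 \<tau> g" "\<forall>p\<in>points \<Gamma>. g ` \<epsilon>2 p = \<epsilon>3 p"
    using assms(2) unfolding morphism_to_def by (elim exE conjE)
  have "\<forall>p\<in>points \<Gamma>. (g \<circ> f) ` \<epsilon>1 p = \<epsilon>3 p"
    using f(2) g(2) by (metis image_comp)
  then show ?thesis
    unfolding morphism_to_def using semilinear_comp[OF f(1) g(1)] by (intro exI conjI)
qed

lemma isomorphic_imp_morphism:
  "isomorphic_embeddings \<Gamma> K1 V1 \<epsilon>1 K2 V2 \<epsilon>2 \<Longrightarrow> morphism_to \<Gamma> K1 V1 \<epsilon>1 K2 V2 \<epsilon>2"
  unfolding isomorphic_embeddings_def morphism_to_def by blast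

lemma embedding_small_copy:
  fixes \<Gamma> :: "'p geometry" and K :: "('k, 'm) ring_scheme" and V :: "('k, 'v, 'w) module_scheme"
  assumes \<Gamma>: "point_line_geometry \<Gamma>" "lines \<Gamma> \<noteq> {}" and emb: "embedding \<Gamma> K V \<epsilon>"
  shows "\<exists>(K' :: 'p ring) (V' :: ('p, 'p \<Rightarrow> 'p) module) \<epsilon>'.
    embedding \<Gamma> K' V' \<epsilon>' \<and> isomorphic_embeddings \<Gamma> K V \<epsilon> K' V' \<epsilon>'"
proof -
  have V: "left_vector_space K V" using emb unfolding embedding_def by blast
  interpret left_vector_space K V by fact
  obtain l where l: "l \<in> lines \<Gamma>" using \<Gamma> by blast
  then have "\<epsilon> ` l \<in> pg_lines K V" using emb unfolding embedding_def by blast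
  then obtain g where g: "inj_on g (carrier K)" "g ` carrier K \<subseteq> \<epsilon> ` l"
    using pg_line_scalars by blast
  define i where "i = inv_into l \<epsilon> \<circ> g"
  have i: "inj_on i (carrier K)"
    unfolding i_def using comp_inj_on[OF g(1) inj_on_inv_into[OF g(2)]] .
  have "\<forall>p\<in>points \<Gamma>. \<exists>v. v \<in> carrier V \<and> \<epsilon> p = lin_span K V {v}"
    using emb unfolding embedding_def pg_points_def by blast
  then obtain v where v: "\<And>p. p \<in> points \<Gamma> \<Longrightarrow> v p \<in> carrier V"
    "\<And>p. p \<in> points \<Gamma> \<Longrightarrow> \<epsilon> p = lin_span K V {v p}" by metis
  have vs: "v ` points \<Gamma> \<subseteq> carrier V" using v(1) by blast
  have "\<epsilon> p \<subseteq> lin_span K V (v ` points \<Gamma>)" if "p \<in> points \<Gamma>" for p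
    unfolding v(2)[OF that]
    using that lin_span_incl[of "v ` points \<Gamma>"] by (intro lin_span_least[OF lin_span_submodule[OF vs]]) auto
  then have "carrier V \<subseteq> lin_span K V (v ` points \<Gamma>)"
    using emb lin_span_least[OF lin_span_submodule[OF vs], of "\<Union>p\<in>points \<Gamma>. \<epsilon> p"]
    unfolding embedding_def by blast
  then have "lin_span K V (v ` points \<Gamma>) = carrier V"
    using submoduleD(1)[OF lin_span_submodule[OF vs]] by blast
  then obtain h :: "'v \<Rightarrow> 'p \<Rightarrow> 'k" where h: "inj_on h (carrier V)"
    "\<forall>x\<in>carrier V. \<forall>p. h x p \<in> carrier K"
    using coordinates[of v "points \<Gamma>"] v(1) by blast
  define j where "j x = i \<circ> h x" for x
  have j: "inj_on j (carrier V)"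
  proof (rule inj_onI)
    fix x y assume xy: "x \<in> carrier V" "y \<in> carrier V" "j x = j y"
    have "h x p = h y p" for p
      using xy(3) h(2) xy(1,2) inj_onD[OF i, of "h x p" "h y p"] unfolding j_def
      by (metis comp_apply)
    then show "x = y" using inj_onD[OF h(1)] xy(1,2) by blast
  qed
  obtain K' :: "'p ring" and V' :: "('p, 'p \<Rightarrow> 'p) module" where
    W: "left_vector_space K' V'" "semilinear K V K' V' i j" "bij_betw j (carrier V) (carrier V')"
    using transport[OF V i j] by blast
  have "embedding \<Gamma> K' V' (\<lambda>p. j ` \<epsilon> p)"
    using embedding_transport[OF emb W] \<Gamma> unfolding point_line_geometry_def by blast
  moreover have "isomorphic_embeddings \<Gamma> K V \<epsilon> K' V' (\<lambda>p. j ` \<epsilon> p)"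
    unfolding isomorphic_embeddings_def using W by blast
  ultimately show ?thesis by blast
qed

lemma relatively_universal_isomorphic:
  fixes \<Gamma> :: "'p geometry"
  assumes "point_line_geometry \<Gamma>" "lines \<Gamma> \<noteq> {}" and univ: "relatively_universal \<Gamma> K V \<epsilon>"
    and emb: "embedding \<Gamma> K' V' \<epsilon>'" and mor: "morphism_to \<Gamma> K' V' \<epsilon>' K V \<epsilon>"
  shows "isomorphic_embeddings \<Gamma> K' V' \<epsilon>' K V \<epsilon>"
proof -
  obtain K'' :: "'p ring" and V'' :: "('p, 'p \<Rightarrow> 'p) module" and \<epsilon>''
    where c: "embedding \<Gamma> K'' V'' \<epsilon>''" "isomorphic_embeddings \<Gamma> K' V' \<epsilon>' K'' V'' \<epsilon>''"
    and univ': "morphism_to \<Gamma> K'' V'' \<epsilon>'' K V \<epsilon> \<Longrightarrow> isomorphic_embeddings \<Gamma> K'' V'' \<epsilon>'' K V \<epsilon>"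
    using embedding_small_copy[OF assms(1,2) emb] univ unfolding relatively_universal_def by blast
  then show ?thesis
    using isomorphic_trans[OF c(2) univ'] isomorphic_sym[OF emb c(2)]
      morphism_trans[OF isomorphic_imp_morphism mor] by blast
qed

lemma absolutely_universal_morphism:
  fixes \<Gamma> :: "'p geometry"
  assumes "point_line_geometry \<Gamma>" "lines \<Gamma> \<noteq> {}" and univ: "absolutely_universal \<Gamma> K V \<epsilon>"
    and emb: "embedding \<Gamma> K' V' \<epsilon>'"
  shows "morphism_to \<Gamma> K V \<epsilon> K' V' \<epsilon>'"
proof -
  obtain K'' :: "'p ring" and V'' :: "('p, 'p \<Rightarrow> 'p) module" and \<epsilon>''
    where c: "embedding \<Gamma> K'' V'' \<epsilon>''" "isomorphic_embeddings \<Gamma> K' V' \<epsilon>' K'' V'' \<epsilon>''"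
    and univ': "morphism_to \<Gamma> K V \<epsilon> K'' V'' \<epsilon>''"
    using embedding_small_copy[OF assms(1,2) emb] univ unfolding absolutely_universal_def by blast
  then show ?thesis
    using morphism_trans[OF univ' isomorphic_imp_morphism[OF isomorphic_sym[OF emb c(2)]]] by blast
qed

end

theory Submission
  imports Defs
begin

text \<open>
  One direction is elementary. In a polar space with two opposite lines the complement of a
  hyperplane is connected (lemma \<open>hyperplane_complement_connected\<close>), so nothing lies between a
  hyperplane and the whole space; and moving an independent singular set into a hyperplane along
  the lines through one of its points loses at most that one point, whence the ranks
  (\<open>hyperplane_rank\<close>).

  Conversely let \<open>S\<close> be a maximal subspace that contains a line. If \<open>S\<close> has a point \<open>r\<close> in its
  radical, then \<open>S \<subseteq> r\<^sup>\<bottom>\<close>, and \<open>S = r\<^sup>\<bottom>\<close> by maximality. Otherwise \<open>S\<close> contains two opposite lines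
  \<open>L\<close> and \<open>M\<close>. Let \<open>W\<close> be the span of \<open>\<epsilon>(S)\<close>. If \<open>W \<noteq> V\<close>, then \<open>S\<close> is the preimage of \<open>W\<close>, and for
  \<open>x \<notin> S\<close> the preimage of \<open>W + \<epsilon>(x)\<close> is strictly larger, hence everything; so \<open>W\<close> is a hyperplane of
  \<open>V\<close> and meets every line (\<open>maximal_nonspanning_hyperplane\<close>).

  It remains to see that \<open>W = V\<close> forces \<open>S\<close> to be the whole space (\<open>spanning_subspace\<close>). Adjoin to
  \<open>L \<union> M\<close> the points of a finite subset of \<open>S\<close>, one after the other. Each step enlarges the span by
  at most one dimension, so the preimage of the old span is a hyperplane of the preimage of the new
  one, and connectedness of its complement shows that \<open>S\<close> contains the new preimage if it contains
  the old one. So everything depends on the start of this induction: \<open>S\<close> has to contain all points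
  that are embedded in the span of \<open>L \<union> M\<close> (\<open>regulus_closed\<close>).

  This is where universality matters; it fails, say, for the grid generated by two opposite
  lines of the symplectic space \<open>W(3, F)\<close> with \<open>F\<close> of characteristic 2, which is a proper subspace and
  spans. Universality is used twice. Firstly, the hyperplanes of \<open>V\<close> spanned by the sets \<open>p\<^sup>\<bottom>\<close> define an embedding of the
  polar space into the dual of \<open>V\<close>, over the opposite ring (\<open>dual_embedding\<close>). A morphism from \<open>\<epsilon>\<close>
  to it is the same as a sesquilinear form \<open>f\<close> on \<open>V\<close> that describes collinearity, and such a form
  satisfies \<open>f(y,x) = e \<sigma>(f(x,y))\<close> (\<open>form_exists\<close>). Secondly, put \<open>\<Lambda> = {t - e \<sigma>(t)}\<close>. The cocycle \<open>f\<close>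
  modulo \<open>\<Lambda>\<close> defines an extension of \<open>V\<close> by a part of \<open>K/\<Lambda>\<close> into which the polar space lifts. By
  universality the lifting is induced by a semilinear map, and comparing the two sides on a sum of
  vectors gives: if \<open>x\<close>, \<open>y\<close> and \<open>x + y\<close> represent points, then \<open>f(x,y) \<in> \<Lambda>\<close> (\<open>hyperbolic_value\<close>). For
  \<open>x\<close> on \<open>L\<close> and \<open>y\<close> on \<open>M\<close> a solution \<open>t\<close> of \<open>f(x,y) = t - e \<sigma>(t)\<close> allows one to write \<open>x + y\<close> as a sum of
  two orthogonal vectors, each representing a point on a line that joins \<open>L\<close> to \<open>M\<close>.
\<close>

section \<open>Subspaces of polar spaces\<close>

definition opposite :: "'p geometry \<Rightarrow> 'p set \<Rightarrow> 'p set \<Rightarrow> bool" where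
  "opposite \<Gamma> L M \<longleftrightarrow> L \<in> lines \<Gamma> \<and> M \<in> lines \<Gamma> \<and>
     (\<forall>c\<in>L. \<exists>d\<in>M. \<not> collinear_in \<Gamma> c d) \<and> (\<forall>d\<in>M. \<exists>c\<in>L. \<not> collinear_in \<Gamma> c d)"

lemma oppositeE:
  assumes "opposite \<Gamma> L M"
  shows "L \<in> lines \<Gamma>" "M \<in> lines \<Gamma>"
    and "c \<in> L \<Longrightarrow> \<exists>d\<in>M. \<not> collinear_in \<Gamma> c d" "d \<in> M \<Longrightarrow> \<exists>c\<in>L. \<not> collinear_in \<Gamma> c d"
  using assms unfolding opposite_def by simp_all

lemma col_refl [simp]: "collinear_in \<Gamma> p p"
  unfolding collinear_in_def by simp

lemma col_sym: "collinear_in \<Gamma> p q \<longleftrightarrow> collinear_in \<Gamma> q p"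
  unfolding collinear_in_def by blast

lemma col_line: "\<lbrakk>l \<in> lines \<Gamma>; p \<in> l; q \<in> l\<rbrakk> \<Longrightarrow> collinear_in \<Gamma> p q"
  unfolding collinear_in_def by blast

lemma col_lineE:
  assumes "collinear_in \<Gamma> p q" "p \<noteq> q"
  obtains l where "l \<in> lines \<Gamma>" "p \<in> l" "q \<in> l"
  using assms unfolding collinear_in_def by blast

lemma geo_subspaceD:
  "\<lbrakk>geo_subspace \<Gamma> S; l \<in> lines \<Gamma>; a \<in> l; b \<in> l; a \<in> S; b \<in> S; a \<noteq> b\<rbrakk> \<Longrightarrow> l \<subseteq> S"
  unfolding geo_subspace_def by (meson IntI)

lemma geo_subspace_points: "geo_subspace \<Gamma> S \<Longrightarrow> S \<subseteq> points \<Gamma>"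
  unfolding geo_subspace_def by blast

lemma maximal_subspaceD:
  "\<lbrakk>maximal_subspace \<Gamma> S; proper_subspace \<Gamma> T; S \<subseteq> T\<rbrakk> \<Longrightarrow> T = S"
  unfolding maximal_subspace_def by iprover

text \<open>
  The last two assumptions hold in embeddable polar spaces because a projective line has at least
  three points and is determined by any two of them.
\<close>

locale thick_polar_space =
  fixes \<Gamma> :: "'p geometry"
  assumes polar: "polar_space \<Gamma>"
    and two_points: "l \<in> lines \<Gamma> \<Longrightarrow> \<exists>p\<in>l. \<exists>q\<in>l. p \<noteq> q"
    and third_point: "\<lbrakk>l \<in> lines \<Gamma>; p \<in> l; q \<in> l\<rbrakk> \<Longrightarrow> \<exists>r\<in>l. r \<noteq> p \<and> r \<noteq> q"
    and line_unique:
      "\<lbrakk>l \<in> lines \<Gamma>; m \<in> lines \<Gamma>; p \<in> l; q \<in> l; p \<in> m; q \<in> m; p \<noteq> q\<rbrakk> \<Longrightarrow> l = m"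
begin

abbreviation col :: "'p \<Rightarrow> 'p \<Rightarrow> bool" where "col \<equiv> collinear_in \<Gamma>"

lemma line_points: "l \<in> lines \<Gamma> \<Longrightarrow> l \<subseteq> points \<Gamma>"
  using polar unfolding polar_space_def point_line_geometry_def by blast

lemma other_point:
  assumes "l \<in> lines \<Gamma>" obtains q where "q \<in> l" "q \<noteq> p"
  using two_points[OF assms] by blast

lemma ex_col:
  assumes "p \<in> points \<Gamma>" "l \<in> lines \<Gamma>" obtains q where "q \<in> l" "col p q"
  using polar assms two_points[OF assms(2)] unfolding polar_space_def by blast

lemma col_all:
  assumes "p \<in> points \<Gamma>" "l \<in> lines \<Gamma>" "a \<in> l" "b \<in> l" "a \<noteq> b" "col p a" "col p b" "c \<in> l"
  shows "col p c"
  using polar assms unfolding polar_space_def by blast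

lemma perp_iff: "q \<in> perp \<Gamma> X \<longleftrightarrow> q \<in> points \<Gamma> \<and> (\<forall>p\<in>X. col p q)"
  unfolding perp_def by blast

lemma perp_points: "perp \<Gamma> X \<subseteq> points \<Gamma>"
  unfolding perp_def by blast

lemma perp_subspace:
  assumes "X \<subseteq> points \<Gamma>" shows "geo_subspace \<Gamma> (perp \<Gamma> X)"
  unfolding geo_subspace_def
proof (intro conjI ballI impI subsetI)
  fix l c assume l: "l \<in> lines \<Gamma>" "\<exists>p\<in>l \<inter> perp \<Gamma> X. \<exists>q\<in>l \<inter> perp \<Gamma> X. p \<noteq> q" and c: "c \<in> l"
  from l(2) obtain a b where ab: "a \<in> l" "b \<in> l" "a \<in> perp \<Gamma> X" "b \<in> perp \<Gamma> X" "a \<noteq> b" by blast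
  have "col p c" if "p \<in> X" for p
    using col_all[OF _ l(1) ab(1,2,5) _ _ c, of p] ab(3,4) that assms unfolding perp_iff by blast
  then show "c \<in> perp \<Gamma> X" using line_points[OF l(1)] c unfolding perp_iff by blast
qed (auto simp: perp_def)

lemma Rad_empty_iff:
  assumes "X \<subseteq> points \<Gamma>"
  shows "Rad \<Gamma> X = {} \<longleftrightarrow> (\<forall>x\<in>X. \<exists>y\<in>X. \<not> col x y)"
proof -
  have "x \<in> Rad \<Gamma> X \<longleftrightarrow> x \<in> X \<and> (\<forall>y\<in>X. col y x)" for x
    using assms unfolding Rad_def perp_def by blast
  then have "x \<in> Rad \<Gamma> X \<longleftrightarrow> x \<in> X \<and> (\<forall>y\<in>X. col x y)" for x
    using col_sym[of \<Gamma> x] by simp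
  then show ?thesis by blast
qed

text \<open>
  Nondegeneracy provides a point \<open>y\<close> with a single neighbour \<open>a\<close> on \<open>L\<close> and then a point \<open>z\<close> not
  collinear with \<open>a\<close>. The line joining \<open>z\<close> to its neighbour \<open>b\<close> on the line \<open>ya\<close> is opposite to \<open>L\<close>,
  because \<open>a\<close>, the only point of \<open>L\<close> collinear with \<open>b\<close>, is not collinear with \<open>z\<close>.
\<close>

lemma opposite_line:
  assumes X: "geo_subspace \<Gamma> X" "Rad \<Gamma> X = {}" and L: "L \<in> lines \<Gamma>" "L \<subseteq> X"
  obtains M where "M \<subseteq> X" "opposite \<Gamma> L M"
proof -
  note P = geo_subspace_points[OF X(1)]
  have nd: "\<exists>y\<in>X. \<not> col x y" if "x \<in> X" for x
    using X(2) that unfolding Rad_empty_iff[OF P] by blast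
  obtain x where x: "x \<in> L" using two_points[OF L(1)] by blast
  obtain y where y: "y \<in> X" "\<not> col x y" using nd x L by blast
  obtain a where a: "a \<in> L" "col y a" using ex_col[OF _ L(1)] y P by blast
  have ya: "y \<noteq> a" using y x a col_line[OF L(1)] by blast
  obtain N where N: "N \<in> lines \<Gamma>" "y \<in> N" "a \<in> N" using col_lineE[OF a(2) ya] .
  have NX: "N \<subseteq> X" using geo_subspaceD[OF X(1) N(1,2,3)] y a L ya by blast
  obtain z where z: "z \<in> X" "\<not> col a z" using nd a L by blast
  obtain b where b: "b \<in> N" "col z b" using ex_col[OF _ N(1)] z P by blast
  have ba: "b \<noteq> a" using z b by (auto simp: col_sym)
  have xb: "\<not> col x b"
    using col_all[OF _ N(1) b(1) N(3) ba _ _ N(2), of x] col_line[OF L(1) x a(1)] y x L P by blast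
  have zb: "z \<noteq> b" using z col_line[OF N(1) N(3) b(1)] by blast
  obtain M where M: "M \<in> lines \<Gamma>" "z \<in> M" "b \<in> M" using col_lineE[OF b(2) zb] .
  have MX: "M \<subseteq> X" using geo_subspaceD[OF X(1) M(1,2,3)] z b NX zb by blast
  have only_a: "c = a" if "c \<in> L" "col b c" for c
  proof (rule ccontr)
    assume "c \<noteq> a"
    then have "col b x"
      using col_all[OF _ L(1) a(1) that(1) _ col_line[OF N(1) b(1) N(3)] that(2) x] b(1) NX P by blast
    then show False using xb by (simp add: col_sym)
  qed
  have "\<exists>d\<in>M. \<not> col c d" if c: "c \<in> L" for c
  proof (cases "c = a")
    case True then show ?thesis using z(2) M(2) by blast
  next
    case False
    then have "\<not> col c b" using only_a[OF c] by (auto simp: col_sym)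
    then show ?thesis using M(3) by blast
  qed
  moreover have "\<exists>c\<in>L. \<not> col c d" if d: "d \<in> M" for d
  proof (rule ccontr)
    assume "\<not> ?thesis"
    then have *: "col c d" if "c \<in> L" for c using that by blast
    have "d \<noteq> b" using *[OF x] xb by blast
    moreover have "a \<in> points \<Gamma>" using a(1) L(2) P by blast
    ultimately have "col a z"
      using col_all[OF _ M(1) d M(3) _ *[OF a(1)] col_line[OF N(1) N(3) b(1)] M(2)] by blast
    then show False using z(2) by blast
  qed
  ultimately have "opposite \<Gamma> L M" using L(1) M(1) unfolding opposite_def by blast
  then show thesis using that MX by blast
qed

lemma opposite_sym: "opposite \<Gamma> L M \<Longrightarrow> opposite \<Gamma> M L"
  unfolding opposite_def by (simp add: col_sym)

lemma opposite_disjoint: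
  assumes "opposite \<Gamma> L M" shows "L \<inter> M = {}"
proof -
  have "c \<notin> M" if c: "c \<in> L" for c
  proof
    assume "c \<in> M"
    moreover obtain d where "d \<in> M" "\<not> col c d" using oppositeE(3)[OF assms c] by blast
    ultimately show False using col_line[OF oppositeE(2)[OF assms]] by blast
  qed
  then show ?thesis by blast
qed

lemma oppositeD:
  assumes "opposite \<Gamma> L M" "c \<in> L" "a \<in> M" "b \<in> M" "a \<noteq> b" "col c a" "col c b"
  shows False
proof -
  note L = oppositeE(1)[OF assms(1)] and M = oppositeE(2)[OF assms(1)]
  obtain d where "d \<in> M" "\<not> col c d" using oppositeE(3)[OF assms(1,2)] by blast
  then show False using col_all[OF _ M assms(3-7)] assms(2) line_points[OF L] by blast
qed

text \<open>
  If all neighbours of \<open>x\<close> were mutually collinear, then \<open>x\<close> would have just one neighbour \<open>a\<close> on \<open>L\<close>.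
  Its neighbour \<open>c\<close> on another line \<open>a'b'\<close> joining \<open>L\<close> to \<open>M\<close> would be collinear with \<open>a\<close>, and the only
  point of \<open>a'b'\<close> with this property is \<open>a'\<close>, a second neighbour of \<open>x\<close> on \<open>L\<close>.
\<close>

lemma noncollinear_in_point_perp:
  assumes X: "geo_subspace \<Gamma> X" and LM: "opposite \<Gamma> L M" "L \<subseteq> X" "M \<subseteq> X" and x: "x \<in> X"
  shows "\<exists>a\<in>X. \<exists>b\<in>X. col x a \<and> col x b \<and> \<not> col a b"
proof (rule ccontr)
  assume "\<not> ?thesis"
  then have clique: "col a b" if "a \<in> X" "b \<in> X" "col x a" "col x b" for a b
    using that by blast
  note P = geo_subspace_points[OF X]
  note L = oppositeE(1)[OF LM(1)] and M = oppositeE(2)[OF LM(1)]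
  have xP: "x \<in> points \<Gamma>" using x P by blast
  obtain a where a: "a \<in> L" "col x a" using ex_col[OF xP L] .
  obtain b where b: "b \<in> M" "col x b" using ex_col[OF xP M] .
  obtain c0 where c0: "c0 \<in> L" "\<not> col c0 b" using oppositeE(4)[OF LM(1) b(1)] by blast
  have "\<not> col x c0" using clique[of c0 b] c0 b LM(2,3) by blast
  then have only_a: "c = a" if "c \<in> L" "col x c" for c
    using that a col_all[OF xP L that(1) a(1) _ that(2) a(2) c0(1)] by blast
  have ab: "col a b" using clique[of a b] a b LM by blast
  obtain a' where a': "a' \<in> L" "a' \<noteq> a" using other_point[OF L] .
  obtain b' where b': "b' \<in> M" "col a' b'" using ex_col[OF _ M] a'(1) line_points[OF L] by blast
  have ne: "b' \<noteq> b" "a' \<noteq> b'"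
    using oppositeD[OF opposite_sym[OF LM(1)] b(1) a(1) a'(1)] a' ab b' opposite_disjoint[OF LM(1)]
      col_sym[of \<Gamma> a b] col_sym[of \<Gamma> a' b] by blast+
  obtain N where N: "N \<in> lines \<Gamma>" "a' \<in> N" "b' \<in> N" using col_lineE[OF b'(2) ne(2)] .
  have NX: "N \<subseteq> X" using geo_subspaceD[OF X N] a'(1) b'(1) LM(2,3) ne(2) by blast
  obtain c where c: "c \<in> N" "col x c" using ex_col[OF xP N(1)] .
  have ac: "col a c" using clique[of a c] a c NX LM by blast
  have "c = a'"
  proof (rule ccontr)
    assume "c \<noteq> a'"
    then have "col a b'"
      using col_all[OF _ N(1) N(2) c(1) _ col_line[OF L a(1) a'(1)] ac N(3)] a(1) line_points[OF L]
      by blast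
    then show False using oppositeD[OF LM(1) a(1) b(1) b'(1) _ ab] ne(1) by blast
  qed
  then show False using only_a a' c by blast
qed

text \<open>
  Project two noncollinear neighbours of \<open>x\<close> from \<open>x\<close> into the perp of \<open>y\<close>.
\<close>

lemma noncollinear_common_neighbours:
  assumes X: "geo_subspace \<Gamma> X" and LM: "opposite \<Gamma> L M" "L \<subseteq> X" "M \<subseteq> X"
    and xy: "x \<in> X" "y \<in> X" "\<not> col x y"
  obtains h m where "h \<in> X" "m \<in> X" "col x h" "col x m" "col y h" "col y m" "\<not> col h m"
proof -
  note P = geo_subspace_points[OF X]
  obtain a b where ab: "a \<in> X" "b \<in> X" "col x a" "col x b" "\<not> col a b"
    using noncollinear_in_point_perp[OF X LM xy(1)] by blast
  have ne: "x \<noteq> a" "x \<noteq> b" using ab by (auto simp: col_sym)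
  obtain A where A: "A \<in> lines \<Gamma>" "x \<in> A" "a \<in> A" using col_lineE[OF ab(3) ne(1)] .
  obtain B where B: "B \<in> lines \<Gamma>" "x \<in> B" "b \<in> B" using col_lineE[OF ab(4) ne(2)] .
  have AX: "A \<subseteq> X" "B \<subseteq> X" using geo_subspaceD[OF X] A B xy ab ne by metis+
  obtain h where h: "h \<in> A" "col y h" using ex_col[OF _ A(1)] xy P by blast
  obtain m where m: "m \<in> B" "col y m" using ex_col[OF _ B(1)] xy P by blast
  have hx: "h \<noteq> x" "m \<noteq> x" using h m xy by (auto simp: col_sym)
  have "\<not> col h m"
  proof
    assume hm: "col h m"
    have "col m a"
      using col_all[OF _ A(1) h(1) A(2) hx(1) _ col_line[OF B(1) m(1) B(2)] A(3)] hm m AX P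
      by (metis col_sym subsetD)
    then have "col a b"
      using col_all[OF _ B(1) m(1) B(2) hx(2) _ col_line[OF A(1) A(3) A(2)] B(3)] ab P
      by (metis col_sym subsetD)
    then show False using ab by blast
  qed
  then show thesis
    using that[of h m] h m AX col_line[OF A(1,2) h(1)] col_line[OF B(1,2) m(1)] by blast
qed

text \<open>
  The complement of the hyperplane \<open>Y\<close> of \<open>X\<close> is connected: two noncollinear points \<open>x\<close> and \<open>y\<close> of it
  with no common neighbour outside \<open>Y\<close> are joined by a path of length 3. Hence a subspace above \<open>Y\<close>
  that contains one point of the complement contains all of \<open>X\<close>. Instead of nondegeneracy of \<open>X\<close> only
  a pair of opposite lines is required, so that the lemma also covers point perps and sections of
  the polar space by arbitrary projective subspaces.
\<close>

lemma hyperplane_complement_connected: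
  assumes X: "geo_subspace \<Gamma> X" and LM: "opposite \<Gamma> L M" "L \<subseteq> X" "M \<subseteq> X"
    and Y: "geo_subspace \<Gamma> Y" "Y \<subseteq> X" "\<And>l. \<lbrakk>l \<in> lines \<Gamma>; l \<subseteq> X\<rbrakk> \<Longrightarrow> l \<inter> Y \<noteq> {}"
    and T: "geo_subspace \<Gamma> T" "Y \<subseteq> T" and x: "x \<in> T" "x \<in> X" "x \<notin> Y"
  shows "X \<subseteq> T"
proof
  note P = geo_subspace_points[OF X]
  have step: "v \<in> T" if "u \<in> T" "u \<in> X" "u \<notin> Y" "v \<in> X" "col u v" for u v
  proof (cases "u = v")
    case False
    then obtain l where l: "l \<in> lines \<Gamma>" "u \<in> l" "v \<in> l" using col_lineE[OF \<open>col u v\<close> False] by blast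
    then have "l \<subseteq> X" using geo_subspaceD[OF X] that False by metis
    then obtain s where s: "s \<in> l" "s \<in> Y" using Y(3)[OF l(1)] by blast
    then have "l \<subseteq> T" using geo_subspaceD[OF T(1) l(1,2) s(1)] that T(2) by blast
    then show ?thesis using l by blast
  qed (use that in simp)
  fix y assume y: "y \<in> X"
  show "y \<in> T"
  proof (rule ccontr)
    assume yT: "y \<notin> T"
    then have yY: "y \<notin> Y" using T by blast
    have nc: "\<not> col x y" using step[OF x y] yT by blast
    obtain h m where hm: "h \<in> X" "m \<in> X" "col x h" "col x m" "col y h" "col y m" "\<not> col h m"
      using noncollinear_common_neighbours[OF X LM x(2) y nc] .
    have in_Y: "k \<in> Y" if "u \<in> T" "u \<in> X" "u \<notin> Y" "k \<in> X" "col u k" "col y k" for u k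
      using step[of u k] step[of k y] that y yT by (auto simp: col_sym)
    have hY: "h \<in> Y" and mY: "m \<in> Y" using in_Y[OF x] hm by blast+
    have xh: "x \<noteq> h" and ym: "y \<noteq> m" using hY mY x yY by blast+
    obtain A where A: "A \<in> lines \<Gamma>" "x \<in> A" "h \<in> A" using col_lineE[OF hm(3) xh] .
    obtain B where B: "B \<in> lines \<Gamma>" "y \<in> B" "m \<in> B" using col_lineE[OF hm(6) ym] .
    have AX: "A \<subseteq> X" "B \<subseteq> X" using geo_subspaceD[OF X] A B x y hm xh ym by metis+
    \<comment> \<open>A third point \<open>x'\<close> of the line \<open>xh\<close> can replace \<open>x\<close>. It is not collinear with \<open>m\<close>, hence with some
      other point \<open>w\<close> of the line \<open>ym\<close>, and \<open>x'\<close>, \<open>w\<close>, \<open>y\<close> is a path outside \<open>Y\<close>.\<close>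
    obtain x' where x': "x' \<in> A" "x' \<noteq> x" "x' \<noteq> h" using third_point[OF A] by blast
    have x'Y: "x' \<notin> Y"
      using geo_subspaceD[OF Y(1) A(1) x'(1) A(3)] hY x'(3) A(2) x(3) by blast
    have x'T: "x' \<in> T" using step[OF x _ col_line[OF A(1,2) x'(1)]] x' AX by blast
    have yx': "\<not> col y x'"
      using col_all[OF _ A(1) x'(1) A(3) x'(3) _ hm(5) A(2)] nc y P by (auto simp: col_sym)
    have mx': "\<not> col m x'"
      using col_all[OF _ A(1) x'(1) A(2) x'(2) _ _ A(3), of m] hm P by (auto simp: col_sym)
    obtain w where w: "w \<in> B" "col x' w" using ex_col[OF _ B(1)] x' AX P by blast
    have "w \<noteq> m" using w mx' by (auto simp: col_sym)
    then have "w \<notin> Y" using geo_subspaceD[OF Y(1) B(1) w(1) B(3)] mY B(2) yY by blast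
    then show False
      using in_Y[of x' w] x'T x' AX x'Y w col_line[OF B(1,2) w(1)] by blast
  qed
qed

lemma perp_meets_line:
  assumes "p \<in> points \<Gamma>" "l \<in> lines \<Gamma>" shows "l \<inter> perp \<Gamma> {p} \<noteq> {}"
proof -
  obtain q where "q \<in> l" "col p q" using ex_col[OF assms] .
  moreover from this have "q \<in> perp \<Gamma> {p}" using line_points[OF assms(2)] unfolding perp_iff by auto
  ultimately show ?thesis by blast
qed

lemma points_subspace: "geo_subspace \<Gamma> (points \<Gamma>)"
  unfolding geo_subspace_def using line_points by simp

end

locale nondegenerate_polar_space = thick_polar_space +
  assumes nondeg: "nondegenerate \<Gamma>"
begin

lemma noncollinear_point:
  assumes "p \<in> points \<Gamma>" obtains q where "q \<in> points \<Gamma>" "\<not> col p q"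
  using nondeg assms Rad_empty_iff[OF subset_refl] unfolding nondegenerate_def by blast

lemma opposite_line_points:
  assumes "L \<in> lines \<Gamma>" obtains M where "opposite \<Gamma> L M"
  using opposite_line[OF points_subspace _ assms line_points[OF assms]] nondeg
  unfolding nondegenerate_def by blast

lemma hyperplane_maximal:
  assumes "lines \<Gamma> \<noteq> {}" "geo_hyperplane \<Gamma> S" shows "maximal_subspace \<Gamma> S"
proof -
  obtain L where L: "L \<in> lines \<Gamma>" using assms by blast
  obtain M where LM: "opposite \<Gamma> L M" using opposite_line_points[OF L] .
  note M = oppositeE(2)[OF LM]
  have S: "geo_subspace \<Gamma> S" "S \<noteq> points \<Gamma>" "\<And>l. l \<in> lines \<Gamma> \<Longrightarrow> l \<inter> S \<noteq> {}"
    using assms(2) unfolding geo_hyperplane_def proper_subspace_def by auto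
  have "T = S" if T: "proper_subspace \<Gamma> T" "S \<subseteq> T" for T
  proof (rule ccontr)
    assume "T \<noteq> S"
    then obtain x where x: "x \<in> T" "x \<notin> S" using T by blast
    have T': "geo_subspace \<Gamma> T" "T \<noteq> points \<Gamma>" using T unfolding proper_subspace_def by auto
    have "points \<Gamma> \<subseteq> T"
      using hyperplane_complement_connected[OF points_subspace LM line_points[OF L] line_points[OF M]
          S(1) geo_subspace_points[OF S(1)] S(3) T'(1) T(2) x(1) _ x(2)]
        x geo_subspace_points[OF T'(1)] by blast
    then show False using T' geo_subspace_points by blast
  qed
  then show ?thesis using assms(2) unfolding maximal_subspace_def geo_hyperplane_def by simp
qed

lemma perp_hyperplane:
  assumes "p \<in> points \<Gamma>" shows "geo_hyperplane \<Gamma> (perp \<Gamma> {p})"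
proof -
  obtain q where "q \<in> points \<Gamma>" "\<not> col p q" using noncollinear_point[OF assms] .
  then have "perp \<Gamma> {p} \<noteq> points \<Gamma>" unfolding perp_def by blast
  moreover have "geo_subspace \<Gamma> (perp \<Gamma> {p})" using perp_subspace assms by simp
  ultimately show ?thesis
    using perp_meets_line[OF assms] unfolding geo_hyperplane_def proper_subspace_def by simp
qed

lemma perp_subset_imp_eq:
  assumes "lines \<Gamma> \<noteq> {}" "p \<in> points \<Gamma>" "r \<in> points \<Gamma>" "perp \<Gamma> {p} \<subseteq> perp \<Gamma> {r}"
  shows "perp \<Gamma> {p} = perp \<Gamma> {r}"
proof -
  have "proper_subspace \<Gamma> (perp \<Gamma> {r})"
    using perp_hyperplane[OF assms(3)] unfolding geo_hyperplane_def by simp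
  then have "perp \<Gamma> {r} = perp \<Gamma> {p}"
    by (rule maximal_subspaceD[OF hyperplane_maximal[OF assms(1) perp_hyperplane[OF assms(2)]] _ assms(4)])
  then show ?thesis by simp
qed

text \<open>
  If \<open>p\<close> and \<open>r\<close> have the same perp, they lie on a line, and a line opposite to it contains a point
  collinear with \<open>p\<close> but not with \<open>r\<close>.
\<close>

lemma perp_inj:
  assumes ln: "lines \<Gamma> \<noteq> {}" and pr: "p \<in> points \<Gamma>" "r \<in> points \<Gamma>" "perp \<Gamma> {p} = perp \<Gamma> {r}"
  shows "p = r"
proof (rule ccontr)
  assume ne: "p \<noteq> r"
  have "r \<in> perp \<Gamma> {r}" using pr(2) unfolding perp_iff by simp
  then have "col p r" unfolding pr(3)[symmetric] perp_iff by simp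
  then obtain l where l: "l \<in> lines \<Gamma>" "p \<in> l" "r \<in> l" using col_lineE[OF _ ne] by blast
  obtain M where M: "opposite \<Gamma> l M" using opposite_line_points[OF l(1)] .
  note Ml = oppositeE(2)[OF M]
  obtain d' where d': "d' \<in> M" "col p d'" using ex_col[OF pr(1) Ml] .
  have dP: "d' \<in> points \<Gamma>" using line_points[OF Ml] d' by blast
  then have "d' \<in> perp \<Gamma> {r}" using d' unfolding pr(3)[symmetric] perp_iff by simp
  then have "col r d'" unfolding perp_iff by simp
  then show False
    using oppositeD[OF opposite_sym[OF M] d'(1) l(2,3) ne] d'(2) col_sym[of \<Gamma> d'] by simp
qed

text \<open>
  A radical point \<open>r\<close> of \<open>{p,q}\<^sup>\<bottom>\<close> is collinear with a second point on every line through \<open>p\<close>, so that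
  \<open>p\<^sup>\<bottom> \<subseteq> r\<^sup>\<bottom>\<close>. These are maximal subspaces, hence equal, although \<open>q\<close> belongs to the second only.
\<close>

lemma perp_pair_nondegenerate:
  assumes ln: "lines \<Gamma> \<noteq> {}" and pq: "p \<in> points \<Gamma>" "q \<in> points \<Gamma>" "\<not> col p q"
  shows "Rad \<Gamma> (perp \<Gamma> {p, q}) = {}"
proof (rule ccontr)
  assume "\<not> ?thesis"
  then obtain r where r: "r \<in> points \<Gamma>" "col p r" "col q r"
    and all: "\<And>d. d \<in> perp \<Gamma> {p, q} \<Longrightarrow> col d r"
    unfolding Rad_def perp_def by auto
  have "perp \<Gamma> {p} \<subseteq> perp \<Gamma> {r}"
  proof
    fix x assume "x \<in> perp \<Gamma> {p}"
    then have x: "x \<in> points \<Gamma>" "col p x" unfolding perp_def by auto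
    show "x \<in> perp \<Gamma> {r}"
    proof (cases "x = p")
      case True then show ?thesis using r x unfolding perp_def by (auto simp: col_sym)
    next
      case False
      then obtain l where l: "l \<in> lines \<Gamma>" "p \<in> l" "x \<in> l" using col_lineE[OF x(2)] False by blast
      obtain d where d: "d \<in> l" "col q d" using ex_col[OF pq(2) l(1)] .
      have "col d r" using all[of d] d l line_points[OF l(1)] col_line[OF l(1,2) d(1)]
        unfolding perp_def by auto
      moreover have "d \<noteq> p" using d pq by (auto simp: col_sym)
      ultimately have "col r x"
        using col_all[OF r(1) l(1) d(1) l(2) _ _ _ l(3)] r by (auto simp: col_sym)
      then show ?thesis using x unfolding perp_def by auto
    qed
  qed
  then have eq: "perp \<Gamma> {p} = perp \<Gamma> {r}" by (rule perp_subset_imp_eq[OF ln pq(1) r(1)])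
  have "col r q" using r(3) col_sym by metis
  then have "q \<in> perp \<Gamma> {p}" unfolding eq perp_iff using pq(2) by simp
  then show False using pq(3) unfolding perp_iff by simp
qed

text \<open>
  Project the line \<open>N\<close> of a singular plane through \<open>x\<close> from \<open>x\<close> into the perp of \<open>p\<close>.
\<close>

lemma line_in_perp_pair:
  assumes N: "N \<in> lines \<Gamma>" "N \<subseteq> perp \<Gamma> {x}" "x \<notin> N" and xp: "x \<in> points \<Gamma>" "p \<in> points \<Gamma>" "\<not> col p x"
  obtains N' where "N' \<in> lines \<Gamma>" "N' \<subseteq> perp \<Gamma> {p, x}"
proof -
  obtain a b where ab: "a \<in> N" "b \<in> N" "a \<noteq> b" using two_points[OF N(1)] by blast
  have xab: "col x a" "col x b" "x \<noteq> a" "x \<noteq> b" using ab N unfolding perp_def by auto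
  obtain A where A: "A \<in> lines \<Gamma>" "x \<in> A" "a \<in> A" using col_lineE[OF xab(1,3)] .
  obtain B where B: "B \<in> lines \<Gamma>" "x \<in> B" "b \<in> B" using col_lineE[OF xab(2,4)] .
  obtain a' where a': "a' \<in> A" "col p a'" using ex_col[OF xp(2) A(1)] .
  obtain b' where b': "b' \<in> B" "col p b'" using ex_col[OF xp(2) B(1)] .
  note PA = line_points[OF A(1)] and PB = line_points[OF B(1)]
  have ne: "a' \<noteq> x" "b' \<noteq> x" using a' b' xp by (auto simp: col_sym)
  have "col b a'"
    using col_all[OF _ A(1) A(2,3) xab(3) _ _ a'(1), of b] xab PB B col_line[OF N(1) ab(2,1)]
    by (auto simp: col_sym)
  then have ab': "col a' b'"
    using col_all[OF _ B(1) B(2,3) xab(4) _ _ b'(1), of a'] PA a' col_line[OF A(1) a'(1) A(2)]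
    by (auto simp: col_sym)
  have "a' \<noteq> b'"
  proof
    assume "a' = b'"
    then have "A = B" using line_unique[OF A(1) B(1) a'(1) A(2) _ B(2) ne(1)] b' by blast
    then have "A = N" using line_unique[OF A(1) N(1) A(3) _ ab(1,2,3)] B by blast
    then show False using A N by blast
  qed
  then obtain N' where N': "N' \<in> lines \<Gamma>" "a' \<in> N'" "b' \<in> N'" using col_lineE[OF ab'] by blast
  have "a' \<in> perp \<Gamma> {p, x}" "b' \<in> perp \<Gamma> {p, x}"
    using a' b' PA PB col_line[OF A(1,2) a'(1)] col_line[OF B(1,2) b'(1)] unfolding perp_def by auto
  moreover have "geo_subspace \<Gamma> (perp \<Gamma> {p, x})" using perp_subspace xp by simp
  ultimately have "N' \<subseteq> perp \<Gamma> {p, x}"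
    using geo_subspaceD[OF _ N'] \<open>a' \<noteq> b'\<close> by simp
  then show thesis by (rule that[OF N'(1)])
qed

text \<open>
  A single nontrivial plane suffices: it yields a line in \<open>{p,x}\<^sup>\<bottom>\<close> for every \<open>p\<close> not collinear with
  \<open>x\<close>, and from there one reaches every other point in a second step. Opposite lines then exist
  because \<open>{p,y}\<^sup>\<bottom>\<close> is nondegenerate.
\<close>

lemma opposite_lines_in_perp:
  assumes N: "N \<in> lines \<Gamma>" "N \<subseteq> perp \<Gamma> {x}" "x \<notin> N" "x \<in> points \<Gamma>" and p: "p \<in> points \<Gamma>"
  obtains L M where "opposite \<Gamma> L M" "L \<subseteq> perp \<Gamma> {p}" "M \<subseteq> perp \<Gamma> {p}"
proof -
  have ln: "lines \<Gamma> \<noteq> {}" using N by blast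
  obtain y N1 where y: "y \<in> points \<Gamma>" "\<not> col p y" and N1: "N1 \<in> lines \<Gamma>" "N1 \<subseteq> perp \<Gamma> {p, y}"
  proof (cases "col p x")
    case False
    then show ?thesis using that[OF N(4) False] line_in_perp_pair[OF N p] by blast
  next
    case True
    \<comment> \<open>A point collinear with neither: on a line opposite to \<open>px\<close>, the neighbour of a third point.\<close>
    obtain z where z: "z \<in> points \<Gamma>" "\<not> col z x" "\<not> col z p"
    proof (cases "p = x")
      case True
      obtain z where "z \<in> points \<Gamma>" "\<not> col x z" using noncollinear_point[OF N(4)] .
      then show ?thesis using that[of z] True by (simp add: col_sym)
    next
      case False
      then obtain l where l: "l \<in> lines \<Gamma>" "p \<in> l" "x \<in> l" using col_lineE[OF True] by blast
      obtain r where r: "r \<in> l" "r \<noteq> p" "r \<noteq> x" using third_point[OF l] by blast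
      obtain M where M: "opposite \<Gamma> l M" using opposite_line_points[OF l(1)] .
      note M' = oppositeE(2)[OF M]
      obtain d where d: "d \<in> M" "col r d" using ex_col[OF _ M'] r line_points[OF l(1)] by blast
      show ?thesis
        using that[of d] oppositeD[OF opposite_sym[OF M] d(1) r(1) l(2) r(2)] oppositeD[OF opposite_sym[OF M] d(1) r(1) l(3) r(3)]
          d line_points[OF M'] by (auto simp: col_sym)
    qed
    obtain N0 where N0: "N0 \<in> lines \<Gamma>" "N0 \<subseteq> perp \<Gamma> {z, x}"
      using line_in_perp_pair[OF N z(1,2)] by blast
    have "N0 \<subseteq> perp \<Gamma> {z}" "z \<notin> N0" using N0(2) z(2) unfolding perp_def by (auto simp: col_sym)
    have pz: "\<not> col p z" using z(3) by (simp add: col_sym)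
    obtain N1 where "N1 \<in> lines \<Gamma>" "N1 \<subseteq> perp \<Gamma> {p, z}"
      using line_in_perp_pair[OF N0(1) \<open>N0 \<subseteq> perp \<Gamma> {z}\<close> \<open>z \<notin> N0\<close> z(1) p pz] .
    then show ?thesis using that[OF z(1) pz] by blast
  qed
  have sub: "geo_subspace \<Gamma> (perp \<Gamma> {p, y})" using perp_subspace p y by simp
  obtain M where M: "M \<subseteq> perp \<Gamma> {p, y}" "opposite \<Gamma> N1 M"
    using opposite_line[OF sub perp_pair_nondegenerate[OF ln p y] N1] .
  have "perp \<Gamma> {p, y} \<subseteq> perp \<Gamma> {p}" unfolding perp_def by blast
  then show thesis using that[OF M(2)] N1(2) M(1) by blast
qed

end

section \<open>Ranks\<close>

lemma geo_span_incl: "X \<subseteq> geo_span \<Gamma> X"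
  unfolding geo_span_def by auto

lemma geo_span_least: "\<lbrakk>geo_subspace \<Gamma> S; X \<subseteq> S\<rbrakk> \<Longrightarrow> geo_span \<Gamma> X \<subseteq> S"
  unfolding geo_span_def by auto

lemma geo_span_mono: "X \<subseteq> Y \<Longrightarrow> geo_span \<Gamma> X \<subseteq> geo_span \<Gamma> Y"
  unfolding geo_span_def by auto

lemma subspace_geo_span:
  assumes P: "geo_subspace \<Gamma> (points \<Gamma>)" and Y: "Y \<subseteq> points \<Gamma>" shows "geo_subspace \<Gamma> (geo_span \<Gamma> Y)"
  unfolding geo_subspace_def
proof (intro conjI ballI impI subsetI)
  show "x \<in> points \<Gamma>" if "x \<in> geo_span \<Gamma> Y" for x
    using geo_span_least[OF P Y] that by blast
  show "x \<in> geo_span \<Gamma> Y" if l: "l \<in> lines \<Gamma>" "\<exists>p\<in>l \<inter> geo_span \<Gamma> Y. \<exists>q\<in>l \<inter> geo_span \<Gamma> Y. p \<noteq> q"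
    and x: "x \<in> l" for x l
    unfolding geo_span_def
  proof (rule InterI)
    fix T assume "T \<in> {S. geo_subspace \<Gamma> S \<and> Y \<subseteq> S}"
    then have T: "geo_subspace \<Gamma> T" "geo_span \<Gamma> Y \<subseteq> T" using geo_span_least by auto
    then show "x \<in> T" using geo_subspaceD[OF T(1) l(1)] l(2) x by blast
  qed
qed

text \<open>
  Minimality of a spanning set is independence; in this form it passes to subsets and can be
  checked pointwise.
\<close>

lemma minimal_spanning_set_iff:
  "minimal_spanning_set \<Gamma> S B \<longleftrightarrow>
     B \<subseteq> S \<and> geo_span \<Gamma> B = S \<and> (\<forall>b\<in>B. b \<notin> geo_span \<Gamma> (B - {b}))"
  if P: "geo_subspace \<Gamma> (points \<Gamma>)" "B \<subseteq> points \<Gamma>"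
proof -
  show ?thesis
  proof (intro iffI conjI ballI)
    assume m: "minimal_spanning_set \<Gamma> S B"
    then show "B \<subseteq> S" "geo_span \<Gamma> B = S" unfolding minimal_spanning_set_def by auto
    fix b assume b: "b \<in> B"
    show "b \<notin> geo_span \<Gamma> (B - {b})"
    proof
      assume "b \<in> geo_span \<Gamma> (B - {b})"
      then have "B \<subseteq> geo_span \<Gamma> (B - {b})" using geo_span_incl[of "B - {b}" \<Gamma>] by blast
      moreover have "geo_subspace \<Gamma> (geo_span \<Gamma> (B - {b}))" using subspace_geo_span[OF P(1), of "B - {b}"] P(2) by blast
      ultimately have "geo_span \<Gamma> B \<subseteq> geo_span \<Gamma> (B - {b})" using geo_span_least by blast
      moreover have "geo_span \<Gamma> (B - {b}) \<subseteq> geo_span \<Gamma> B" by (rule geo_span_mono) auto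
      ultimately have "geo_span \<Gamma> (B - {b}) = S" using m unfolding minimal_spanning_set_def by auto
      moreover have "B - {b} \<subset> B" using b by auto
      ultimately show False using m unfolding minimal_spanning_set_def by auto
    qed
  next
    assume *: "B \<subseteq> S \<and> geo_span \<Gamma> B = S \<and> (\<forall>b\<in>B. b \<notin> geo_span \<Gamma> (B - {b}))"
    show "minimal_spanning_set \<Gamma> S B"
      unfolding minimal_spanning_set_def
    proof (intro conjI allI impI notI)
      fix Y assume Y: "Y \<subset> B" "geo_span \<Gamma> Y = S"
      then obtain b where b: "b \<in> B" "b \<notin> Y" by blast
      then have "geo_span \<Gamma> Y \<subseteq> geo_span \<Gamma> (B - {b})" using Y by (intro geo_span_mono) auto
      then show False using Y * b by auto
    qed (use * in auto)
  qed
qed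

lemma ecard_subset:
  assumes "enat j < ecard B" obtains C where "C \<subseteq> B" "finite C" "card C = Suc j"
proof (cases "finite B")
  case True
  then have "Suc j \<le> card B" using assms unfolding ecard_def by simp
  then show ?thesis using that obtain_subset_with_card_n[of "Suc j" B] by metis
next
  case False
  then show ?thesis using that infinite_arbitrarily_large[of B "Suc j"] by metis
qed

context thick_polar_space
begin

lemmas geo_span_subspace = subspace_geo_span[OF points_subspace]

lemma geo_span_singular:
  assumes C: "C \<subseteq> points \<Gamma>" "\<And>p q. \<lbrakk>p \<in> C; q \<in> C\<rbrakk> \<Longrightarrow> col p q"
  shows "singular_subspace \<Gamma> (geo_span \<Gamma> C)"
proof -
  note sub = geo_span_subspace[OF C(1)]
  have "C \<subseteq> perp \<Gamma> C" using C unfolding perp_def by auto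
  then have 1: "geo_span \<Gamma> C \<subseteq> perp \<Gamma> C" using geo_span_least[OF perp_subspace[OF C(1)]] by blast
  have "col p q" if "q \<in> C" "p \<in> geo_span \<Gamma> C" for p q
  proof -
    have "p \<in> perp \<Gamma> C" using 1 that(2) by blast
    then have "col q p" using that(1) unfolding perp_iff by simp
    then show ?thesis by (simp add: col_sym)
  qed
  then have "C \<subseteq> perp \<Gamma> (geo_span \<Gamma> C)" using C(1) unfolding perp_def by auto
  then have "geo_span \<Gamma> C \<subseteq> perp \<Gamma> (geo_span \<Gamma> C)"
    using geo_span_least[OF perp_subspace[OF geo_subspace_points[OF sub]]] by blast
  then show ?thesis using sub unfolding singular_subspace_def by simp
qed

lemma collinear_in_induced:
  assumes S: "geo_subspace \<Gamma> S" and pq: "p \<in> S" "q \<in> S"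
  shows "collinear_in (induced_geometry \<Gamma> S) p q \<longleftrightarrow> col p q"
proof (cases "p = q")
  case False
  have "l \<subseteq> S" if "l \<in> lines \<Gamma>" "p \<in> l" "q \<in> l" for l
    using geo_subspaceD[OF S that pq False] .
  then show ?thesis using False unfolding collinear_in_def induced_geometry_def by auto
qed simp

lemma geo_subspace_induced:
  assumes S: "geo_subspace \<Gamma> S"
  shows "geo_subspace (induced_geometry \<Gamma> S) T \<longleftrightarrow> geo_subspace \<Gamma> T \<and> T \<subseteq> S"
proof
  assume T: "geo_subspace (induced_geometry \<Gamma> S) T"
  then have TS: "T \<subseteq> S" unfolding geo_subspace_def induced_geometry_def by simp
  have "l \<subseteq> T" if l: "l \<in> lines \<Gamma>" "p \<in> l \<inter> T" "q \<in> l \<inter> T" "p \<noteq> q" for l p q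
  proof -
    have "l \<subseteq> S" using geo_subspaceD[OF S l(1) _ _ _ _ l(4)] l TS by auto
    then have "l \<in> lines (induced_geometry \<Gamma> S)" using l unfolding induced_geometry_def by simp
    then show ?thesis using geo_subspaceD[OF T _ _ _ _ _ l(4)] l by auto
  qed
  then show "geo_subspace \<Gamma> T \<and> T \<subseteq> S"
    using TS geo_subspace_points[OF S] unfolding geo_subspace_def by blast
next
  assume T: "geo_subspace \<Gamma> T \<and> T \<subseteq> S"
  then show "geo_subspace (induced_geometry \<Gamma> S) T"
    unfolding geo_subspace_def induced_geometry_def by simp
qed

lemma geo_span_induced:
  assumes S: "geo_subspace \<Gamma> S" and X: "X \<subseteq> S"
  shows "geo_span (induced_geometry \<Gamma> S) X = geo_span \<Gamma> X"
proof
  show "geo_span \<Gamma> X \<subseteq> geo_span (induced_geometry \<Gamma> S) X"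
    unfolding geo_span_def using geo_subspace_induced[OF S] by (intro Inter_anti_mono) auto
  have "geo_subspace (induced_geometry \<Gamma> S) (geo_span \<Gamma> X)"
    unfolding geo_subspace_induced[OF S]
    using geo_span_subspace[of X] geo_span_least[OF S X] X geo_subspace_points[OF S] by auto
  then show "geo_span (induced_geometry \<Gamma> S) X \<subseteq> geo_span \<Gamma> X"
    by (rule geo_span_least[OF _ geo_span_incl])
qed

lemma singular_subspace_induced:
  assumes S: "geo_subspace \<Gamma> S"
  shows "singular_subspace (induced_geometry \<Gamma> S) T \<longleftrightarrow> singular_subspace \<Gamma> T \<and> T \<subseteq> S"
proof (cases "T \<subseteq> S")
  case True
  then have "perp (induced_geometry \<Gamma> S) T = perp \<Gamma> T \<inter> S"
    using geo_subspace_points[OF S] collinear_in_induced[OF S]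
    unfolding perp_def by (auto simp: induced_geometry_def subset_iff)
  then show ?thesis using True unfolding singular_subspace_def geo_subspace_induced[OF S] by auto
qed (auto simp: singular_subspace_def geo_subspace_induced[OF S])

text \<open>
  This eliminates the suprema and the induced geometry: ranks are measured by finite independent
  sets of mutually collinear points.
\<close>

lemma less_subspace_rank_iff:
  assumes S: "geo_subspace \<Gamma> S"
  shows "enat j < subspace_rank \<Gamma> S \<longleftrightarrow>
    (\<exists>C. finite C \<and> card C = Suc j \<and> C \<subseteq> S \<and> (\<forall>p\<in>C. \<forall>q\<in>C. col p q) \<and>
         (\<forall>b\<in>C. b \<notin> geo_span \<Gamma> (C - {b})))" (is "_ \<longleftrightarrow> (\<exists>C. ?ind C)")
proof -
  let ?I = "induced_geometry \<Gamma> S"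
  have PI: "geo_subspace ?I (points ?I)" "points ?I = S"
    unfolding geo_subspace_induced[OF S] using S by (auto simp: induced_geometry_def)
  have "enat j < subspace_rank \<Gamma> S \<longleftrightarrow>
    (\<exists>T B. singular_subspace ?I T \<and> minimal_spanning_set ?I T B \<and> enat j < ecard B)"
    unfolding polar_rank_def singular_rank_def by (simp add: less_SUP_iff)
  also have "\<dots> \<longleftrightarrow> (\<exists>C. ?ind C)"
  proof
    assume "\<exists>T B. singular_subspace ?I T \<and> minimal_spanning_set ?I T B \<and> enat j < ecard B"
    then obtain T B where T: "singular_subspace \<Gamma> T" "T \<subseteq> S" and B: "minimal_spanning_set ?I T B"
      and j: "enat j < ecard B" unfolding singular_subspace_induced[OF S] by auto
    have BT: "B \<subseteq> T" using B unfolding minimal_spanning_set_def by simp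
    then have BS: "B \<subseteq> S" using T by blast
    then have BI: "B \<subseteq> points ?I" using PI(2) by simp
    have ind: "b \<notin> geo_span \<Gamma> (B - {b})" if "b \<in> B" for b
    proof -
      have "b \<notin> geo_span ?I (B - {b})"
        using B that unfolding minimal_spanning_set_iff[OF PI(1) BI] by simp
      moreover have "B - {b} \<subseteq> S" using BS by blast
      ultimately show ?thesis using geo_span_induced[OF S] by simp
    qed
    obtain C where C: "C \<subseteq> B" "finite C" "card C = Suc j" using ecard_subset[OF j] .
    have "b \<notin> geo_span \<Gamma> (C - {b})" if "b \<in> C" for b
      using ind[of b] geo_span_mono[of "C - {b}" "B - {b}" \<Gamma>] C(1) that by blast
    moreover have "col p q" if "p \<in> C" "q \<in> C" for p q
    proof -
      have "p \<in> T" "q \<in> T" using that C BT by auto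
      then show ?thesis using T(1) unfolding singular_subspace_def perp_def by auto
    qed
    ultimately show "\<exists>C. ?ind C" using C BS by (intro exI[of _ C]) auto
  next
    assume "\<exists>C. ?ind C"
    then obtain C where C: "?ind C" by blast
    then have CP: "C \<subseteq> points \<Gamma>" using geo_subspace_points[OF S] by blast
    have CS: "C \<subseteq> points ?I" using C PI by simp
    have "singular_subspace ?I (geo_span \<Gamma> C)"
      unfolding singular_subspace_induced[OF S]
      using geo_span_singular[OF CP] C geo_span_least[OF S] by auto
    moreover have "geo_span ?I (C - {b}) = geo_span \<Gamma> (C - {b})" for b
      using geo_span_induced[OF S, of "C - {b}"] C by auto
    then have "minimal_spanning_set ?I (geo_span \<Gamma> C) C"
      unfolding minimal_spanning_set_iff[OF PI(1) CS]
      using C geo_span_incl[of C \<Gamma>] geo_span_induced[OF S, of C] by auto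
    moreover have "enat j < ecard C" using C unfolding ecard_def by simp
    ultimately show
      "\<exists>T B. singular_subspace ?I T \<and> minimal_spanning_set ?I T B \<and> enat j < ecard B" by blast
  qed
  finally show ?thesis .
qed

lemma induced_points: "induced_geometry \<Gamma> (points \<Gamma>) = \<Gamma>"
proof -
  have "{l \<in> lines \<Gamma>. l \<subseteq> points \<Gamma>} = lines \<Gamma>" using line_points by blast
  then show ?thesis unfolding induced_geometry_def by simp
qed

lemma rank_2_line:
  assumes S: "geo_subspace \<Gamma> S" and rk: "2 \<le> subspace_rank \<Gamma> S"
  obtains L where "L \<in> lines \<Gamma>" "L \<subseteq> S"
proof -
  have "enat 1 < subspace_rank \<Gamma> S"
    using rk by (metis Suc_1 Suc_ile_eq numeral_eq_enat)
  then obtain C where C: "finite C" "card C = Suc 1" "C \<subseteq> S" "\<And>p q. p \<in> C \<Longrightarrow> q \<in> C \<Longrightarrow> col p q"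
    unfolding less_subspace_rank_iff[OF S] by blast
  then obtain a b where ab: "a \<in> C" "b \<in> C" "a \<noteq> b"
    by (auto simp: numeral_2_eq_2 card_Suc_eq)
  obtain L where L: "L \<in> lines \<Gamma>" "a \<in> L" "b \<in> L" using col_lineE[OF C(4)[OF ab(1,2)] ab(3)] .
  then show thesis using that geo_subspaceD[OF S L _ _ ab(3)] ab C(3) by blast
qed

lemma rank_3_plane:
  assumes "enat 2 < polar_rank \<Gamma>"
  obtains N x where "N \<in> lines \<Gamma>" "N \<subseteq> perp \<Gamma> {x}" "x \<notin> N" "x \<in> points \<Gamma>"
proof -
  have "enat 2 < subspace_rank \<Gamma> (points \<Gamma>)" using assms unfolding induced_points .
  then obtain C where C: "card C = Suc 2" "C \<subseteq> points \<Gamma>" "\<And>p q. p \<in> C \<Longrightarrow> q \<in> C \<Longrightarrow> col p q"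
    "\<And>b. b \<in> C \<Longrightarrow> b \<notin> geo_span \<Gamma> (C - {b})"
    unfolding less_subspace_rank_iff[OF points_subspace] by blast
  then obtain a b c where abc: "C = {a, b, c}" "a \<noteq> b" "c \<noteq> a" "c \<noteq> b"
    by (auto simp: numeral_2_eq_2 card_Suc_eq)
  obtain N where N: "N \<in> lines \<Gamma>" "a \<in> N" "b \<in> N" using col_lineE[OF C(3) abc(2)] abc(1) by blast
  have "C - {c} = {a, b}" using abc by auto
  then have c: "c \<notin> geo_span \<Gamma> {a, b}" using C(4)[of c] abc(1) by simp
  have ab: "a \<in> geo_span \<Gamma> {a, b}" "b \<in> geo_span \<Gamma> {a, b}"
    using geo_span_incl[of "{a, b}" \<Gamma>] by auto
  have "geo_subspace \<Gamma> (geo_span \<Gamma> {a, b})" using geo_span_subspace C(2) abc(1) by simp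
  then have "N \<subseteq> geo_span \<Gamma> {a, b}" using geo_subspaceD[OF _ N ab abc(2)] by simp
  then have "c \<notin> N" using c by blast
  moreover have cP: "c \<in> points \<Gamma>" using C(2) abc(1) by simp
  moreover have "N \<subseteq> perp \<Gamma> {c}"
    using geo_subspaceD[OF perp_subspace N _ _ abc(2), of "{c}"] C(2,3) abc(1) unfolding perp_def
    by auto
  ultimately show thesis using that N(1) by blast
qed

lemma subspace_rank_mono:
  assumes "geo_subspace \<Gamma> S" "geo_subspace \<Gamma> T" "S \<subseteq> T" "enat j < subspace_rank \<Gamma> S"
  shows "enat j < subspace_rank \<Gamma> T"
  using assms(3,4) unfolding less_subspace_rank_iff[OF assms(1)] less_subspace_rank_iff[OF assms(2)]
  by (meson subset_trans)

text \<open>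
  Let \<open>C\<close> be an independent singular set of \<open>n\<close> points, one of which, \<open>b\<close>, is not in \<open>S\<close>. Each line
  joining \<open>b\<close> to another point \<open>c\<close> of \<open>C\<close> meets \<open>S\<close> in a point \<open>g c\<close>, and these \<open>n - 1\<close> points are again
  independent: since \<open>b\<close> and \<open>g c\<close> span \<open>c\<close>, a dependence among them would be one among the points of
  \<open>C\<close>.
\<close>

lemma hyperplane_rank:
  assumes n: "polar_rank \<Gamma> = enat n" "2 \<le> n" and H: "geo_hyperplane \<Gamma> S"
  shows "subspace_rank \<Gamma> S = enat (n - 1) \<or> subspace_rank \<Gamma> S = enat n"
proof -
  have S: "geo_subspace \<Gamma> S" and meets: "\<And>l. l \<in> lines \<Gamma> \<Longrightarrow> l \<inter> S \<noteq> {}"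
    using H unfolding geo_hyperplane_def proper_subspace_def by auto
  have rk: "subspace_rank \<Gamma> (points \<Gamma>) = enat n" using n(1) unfolding induced_points .
  have upper: "subspace_rank \<Gamma> S \<le> enat n"
    using subspace_rank_mono[OF S points_subspace geo_subspace_points[OF S], of n] rk
    by (cases "subspace_rank \<Gamma> S \<le> enat n") (auto simp: not_le)
  have "enat (n - 1) < subspace_rank \<Gamma> (points \<Gamma>)" using rk n by simp
  then obtain C where C: "finite C" "card C = Suc (n - 1)" "C \<subseteq> points \<Gamma>"
    "\<And>p q. p \<in> C \<Longrightarrow> q \<in> C \<Longrightarrow> col p q" "\<And>b. b \<in> C \<Longrightarrow> b \<notin> geo_span \<Gamma> (C - {b})"
    unfolding less_subspace_rank_iff[OF points_subspace] by blast
  have lower: "enat (n - 2) < subspace_rank \<Gamma> S"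
  proof (cases "C \<subseteq> S")
    case True
    then have "enat (n - 1) < subspace_rank \<Gamma> S"
      unfolding less_subspace_rank_iff[OF S] using C by blast
    moreover have "enat (n - 2) \<le> enat (n - 1)" by simp
    ultimately show ?thesis using le_less_trans by blast
  next
    case False
    then obtain b where b: "b \<in> C" "b \<notin> S" by blast
    define D where "D = C - {b}"
    have "\<exists>x. x \<in> S \<and> (\<exists>l\<in>lines \<Gamma>. b \<in> l \<and> c \<in> l \<and> x \<in> l)" if "c \<in> D" for c
    proof -
      have "col b c" "b \<noteq> c" using C(4) b that unfolding D_def by auto
      then obtain l where "l \<in> lines \<Gamma>" "b \<in> l" "c \<in> l" using col_lineE by metis
      then show ?thesis using meets[of l] by blast
    qed
    then obtain g l where g: "\<And>c. c \<in> D \<Longrightarrow> g c \<in> S \<and> l c \<in> lines \<Gamma> \<and> b \<in> l c \<and> c \<in> l c \<and> g c \<in> l c"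
      by metis
    have g_in: "g c \<in> geo_span \<Gamma> X" if c: "c \<in> D" and X: "X \<subseteq> points \<Gamma>" "b \<in> X" "c \<in> X" for c X
    proof -
      have "l c \<subseteq> geo_span \<Gamma> X"
        using geo_subspaceD[OF geo_span_subspace[OF X(1)], of "l c" b c] g[OF c] X geo_span_incl[of X \<Gamma>] c
        unfolding D_def by auto
      then show ?thesis using g[OF c] by blast
    qed
    have g_notin: "g c \<notin> geo_span \<Gamma> (C - {c})" if c: "c \<in> D" for c
    proof
      assume in_span: "g c \<in> geo_span \<Gamma> (C - {c})"
      have "b \<in> geo_span \<Gamma> (C - {c})" using b c geo_span_incl[of "C - {c}" \<Gamma>] unfolding D_def by blast
      moreover have "b \<noteq> g c" using b g[OF c] by blast
      moreover have "geo_subspace \<Gamma> (geo_span \<Gamma> (C - {c}))" using geo_span_subspace[of "C - {c}"] C(3) by blast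
      ultimately have "l c \<subseteq> geo_span \<Gamma> (C - {c})"
        using geo_subspaceD[of \<Gamma> _ "l c" b "g c"] g[OF c] in_span by simp
      then show False using C(5)[of c] g[OF c] c unfolding D_def by blast
    qed
    have others: "g d \<in> geo_span \<Gamma> (C - {c})" if "c \<in> D" "d \<in> D" "d \<noteq> c" for c d
      using g_in[OF that(2), of "C - {c}"] C(3) b that unfolding D_def by blast
    have inj: "inj_on g D"
      using others g_notin by (intro inj_onI) metis
    have sing: "col p q" if "p \<in> g ` D" "q \<in> g ` D" for p q
    proof -
      have "p \<in> geo_span \<Gamma> C" "q \<in> geo_span \<Gamma> C" using that g_in[OF _ C(3) b(1)] unfolding D_def by auto
      then show ?thesis
        using geo_span_singular[OF C(3,4)] unfolding singular_subspace_def perp_def by auto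
    qed
    have ind: "g c \<notin> geo_span \<Gamma> (g ` D - {g c})" if c: "c \<in> D" for c
    proof -
      have "g ` D - {g c} \<subseteq> geo_span \<Gamma> (C - {c})" using others[OF c] by auto
      moreover have "geo_subspace \<Gamma> (geo_span \<Gamma> (C - {c}))" using geo_span_subspace[of "C - {c}"] C(3) by blast
      ultimately have "geo_span \<Gamma> (g ` D - {g c}) \<subseteq> geo_span \<Gamma> (C - {c})" using geo_span_least by simp
      then show ?thesis using g_notin[OF c] by blast
    qed
    have "card (g ` D) = Suc (n - 2)"
      using card_image[OF inj] C(1,2) b(1) n(2) unfolding D_def by simp
    moreover have "g ` D \<subseteq> S" using g by auto
    ultimately show ?thesis
      unfolding less_subspace_rank_iff[OF S] using sing ind C(1)
      by (intro exI[of _ "g ` D"]) (auto simp: D_def)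
  qed
  obtain m where m: "subspace_rank \<Gamma> S = enat m" using upper by (metis enat_ile)
  then show ?thesis using upper lower n(2) by auto
qed

end

section \<open>Linear algebra over division rings\<close>

context left_vector_space
begin

lemma lin_span_mono: "X \<subseteq> Y \<Longrightarrow> lin_span K V X \<subseteq> lin_span K V Y"
  unfolding lin_span_def by auto

lemma lin_span_idem: "submodule H K V \<Longrightarrow> lin_span K V H = H"
  using lin_span_least lin_span_incl by (simp add: subset_antisym)

lemma submodule_minus: "\<lbrakk>submodule H K V; x \<in> H\<rbrakk> \<Longrightarrow> \<ominus>\<^bsub>V\<^esub> x \<in> H"
  using submoduleD(1,4)[of H] smult_minus_one[of x] by (metis K.add.inv_closed K.one_closed subsetD)

lemma add_minus_cancel:
  assumes "x \<in> carrier V" "y \<in> carrier V" shows "(x \<oplus>\<^bsub>V\<^esub> y) \<oplus>\<^bsub>V\<^esub> \<ominus>\<^bsub>V\<^esub> y = x"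
  using assms by (simp add: V.a_assoc V.r_neg)

lemma lin_span_Un:
  assumes H: "submodule H K V" and N: "submodule N K V"
  shows "lin_span K V (H \<union> N) = {h \<oplus>\<^bsub>V\<^esub> n | h n. h \<in> H \<and> n \<in> N}" (is "_ = ?R")
proof
  note HD = submoduleD[OF H] and ND = submoduleD[OF N]
  have "submodule ?R K V"
  proof (rule submoduleI)
    show "?R \<subseteq> carrier V" using HD(1) ND(1) by auto
    have "\<zero>\<^bsub>V\<^esub> = \<zero>\<^bsub>V\<^esub> \<oplus>\<^bsub>V\<^esub> \<zero>\<^bsub>V\<^esub>" by simp
    then show "\<zero>\<^bsub>V\<^esub> \<in> ?R" using HD(2) ND(2) by blast
    show "x \<oplus>\<^bsub>V\<^esub> y \<in> ?R" if xy: "x \<in> ?R" "y \<in> ?R" for x y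
    proof -
      obtain h n h' n' where *: "h \<in> H" "n \<in> N" "h' \<in> H" "n' \<in> N"
        "x = h \<oplus>\<^bsub>V\<^esub> n" "y = h' \<oplus>\<^bsub>V\<^esub> n'" using xy by blast
      then have "h \<in> carrier V" "n \<in> carrier V" "h' \<in> carrier V" "n' \<in> carrier V"
        using HD(1) ND(1) by auto
      then have "x \<oplus>\<^bsub>V\<^esub> y = (h \<oplus>\<^bsub>V\<^esub> h') \<oplus>\<^bsub>V\<^esub> (n \<oplus>\<^bsub>V\<^esub> n')"
        using * by (simp add: V.a_ac)
      then show ?thesis using * HD(3) ND(3) by blast
    qed
    show "a \<odot>\<^bsub>V\<^esub> x \<in> ?R" if ax: "a \<in> carrier K" "x \<in> ?R" for a x
    proof -
      obtain h n where *: "h \<in> H" "n \<in> N" "x = h \<oplus>\<^bsub>V\<^esub> n" using ax by blast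
      then have "h \<in> carrier V" "n \<in> carrier V" using HD(1) ND(1) by auto
      then have "a \<odot>\<^bsub>V\<^esub> x = a \<odot>\<^bsub>V\<^esub> h \<oplus>\<^bsub>V\<^esub> a \<odot>\<^bsub>V\<^esub> n"
        using * ax by (simp add: smult_r_distr)
      then show ?thesis using * ax HD(4) ND(4) by blast
    qed
  qed
  moreover have "H \<subseteq> ?R"
  proof
    fix h assume "h \<in> H"
    moreover from this have "h = h \<oplus>\<^bsub>V\<^esub> \<zero>\<^bsub>V\<^esub>" using HD(1) by auto
    ultimately show "h \<in> ?R" using ND(2) by blast
  qed
  moreover have "N \<subseteq> ?R"
  proof
    fix n assume "n \<in> N"
    moreover from this have "n = \<zero>\<^bsub>V\<^esub> \<oplus>\<^bsub>V\<^esub> n" using ND(1) by auto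
    ultimately show "n \<in> ?R" using HD(2) by blast
  qed
  ultimately show "lin_span K V (H \<union> N) \<subseteq> ?R" using lin_span_least by simp
  have "submodule (lin_span K V (H \<union> N)) K V" using lin_span_submodule HD(1) ND(1) by simp
  note S = submoduleD[OF this]
  show "?R \<subseteq> lin_span K V (H \<union> N)" using S(3) lin_span_incl[of "H \<union> N"] by blast
qed

lemma lin_span_Un_lin_span:
  assumes "X \<subseteq> carrier V" "Y \<subseteq> carrier V"
  shows "lin_span K V (lin_span K V X \<union> Y) = lin_span K V (X \<union> Y)"
proof
  have S: "submodule (lin_span K V (X \<union> Y)) K V" using lin_span_submodule assms by simp
  have "lin_span K V X \<subseteq> lin_span K V (X \<union> Y)" by (rule lin_span_mono) simp
  moreover have "Y \<subseteq> lin_span K V (X \<union> Y)" using lin_span_incl[of "X \<union> Y"] by simp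
  ultimately show "lin_span K V (lin_span K V X \<union> Y) \<subseteq> lin_span K V (X \<union> Y)"
    by (intro lin_span_least[OF S]) simp
  show "lin_span K V (X \<union> Y) \<subseteq> lin_span K V (lin_span K V X \<union> Y)"
    using lin_span_incl[of X] by (intro lin_span_mono) auto
qed

lemma lin_span_finite_support:
  assumes A: "A \<subseteq> carrier V" and f: "\<And>i. i \<in> I \<Longrightarrow> f i \<subseteq> carrier V"
    and v: "v \<in> lin_span K V (A \<union> (\<Union>i\<in>I. f i))"
  obtains F where "finite F" "F \<subseteq> I" "v \<in> lin_span K V (A \<union> (\<Union>i\<in>F. f i))"
proof -
  let ?s = "\<lambda>F. lin_span K V (A \<union> (\<Union>i\<in>F. f i))"
  let ?U = "{u. \<exists>F. finite F \<and> F \<subseteq> I \<and> u \<in> ?s F}"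
  have sub: "submodule (?s F) K V" if "F \<subseteq> I" for F
    using A f that by (intro lin_span_submodule) blast
  have mono: "?s F \<subseteq> ?s G" if "F \<subseteq> G" for F G
    using that by (intro lin_span_mono) blast
  have "submodule ?U K V"
  proof (rule submoduleI)
    show "?U \<subseteq> carrier V" using submoduleD(1)[OF sub] by blast
    show "\<zero>\<^bsub>V\<^esub> \<in> ?U" using submoduleD(2)[OF sub[of "{}"]] by blast
    show "x \<oplus>\<^bsub>V\<^esub> y \<in> ?U" if xy: "x \<in> ?U" "y \<in> ?U" for x y
    proof -
      obtain F G where FG: "finite F" "F \<subseteq> I" "x \<in> ?s F" "finite G" "G \<subseteq> I" "y \<in> ?s G"
        using xy by blast
      then have "x \<in> ?s (F \<union> G)" "y \<in> ?s (F \<union> G)" using mono[of F "F \<union> G"] mono[of G "F \<union> G"] by auto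
      then have "x \<oplus>\<^bsub>V\<^esub> y \<in> ?s (F \<union> G)" using submoduleD(3)[OF sub[of "F \<union> G"]] FG by simp
      moreover have "finite (F \<union> G)" "F \<union> G \<subseteq> I" using FG by simp_all
      ultimately show ?thesis by blast
    qed
    show "a \<odot>\<^bsub>V\<^esub> x \<in> ?U" if ax: "a \<in> carrier K" "x \<in> ?U" for a x
    proof -
      obtain F where F: "finite F" "F \<subseteq> I" "x \<in> ?s F" using ax by blast
      then have "a \<odot>\<^bsub>V\<^esub> x \<in> ?s F" using submoduleD(4)[OF sub[OF F(2)] ax(1)] by simp
      then show ?thesis using F by blast
    qed
  qed
  moreover have "A \<union> (\<Union>i\<in>I. f i) \<subseteq> ?U"
  proof
    fix x assume "x \<in> A \<union> (\<Union>i\<in>I. f i)"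
    then consider "x \<in> A" | i where "i \<in> I" "x \<in> f i" by blast
    then show "x \<in> ?U"
    proof cases
      case 1
      then have "x \<in> ?s {}" using lin_span_incl by blast
      then show ?thesis by blast
    next
      case 2
      then have "x \<in> A \<union> (\<Union>i\<in>{i}. f i)" by simp
      then have "x \<in> ?s {i}" by (rule subsetD[OF lin_span_incl])
      moreover have "finite {i}" "{i} \<subseteq> I" using 2 by simp_all
      ultimately show ?thesis by blast
    qed
  qed
  ultimately have "lin_span K V (A \<union> (\<Union>i\<in>I. f i)) \<subseteq> ?U" by (rule lin_span_least)
  then have "v \<in> ?U" using v by (rule subsetD)
  then show thesis using that by blast
qed

lemma pg_pointE:
  assumes "z \<in> pg_points K V"
  obtains v where "v \<in> carrier V" "v \<noteq> \<zero>\<^bsub>V\<^esub>" "z = lin_span K V {v}"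
  using assms unfolding pg_points_def by blast

lemma pg_point_submodule: "z \<in> pg_points K V \<Longrightarrow> submodule z K V"
  by (auto elim!: pg_pointE intro: lin_span_submodule)

lemma pg_point_span:
  assumes z: "z \<in> pg_points K V" and u: "u \<in> z" "u \<noteq> \<zero>\<^bsub>V\<^esub>"
  shows "z = lin_span K V {u}"
proof -
  obtain v where v: "v \<in> carrier V" "z = lin_span K V {v}" using pg_pointE[OF z] by blast
  obtain a where a: "a \<in> carrier K" "u = a \<odot>\<^bsub>V\<^esub> v"
    using u(1) unfolding v(2) lin_span_singleton[OF v(1)] by blast
  then have "a \<noteq> \<zero>\<^bsub>K\<^esub>" using u(2) v smult_l_null by auto
  then obtain b where b: "b \<in> carrier K" "b \<otimes>\<^bsub>K\<^esub> a = \<one>\<^bsub>K\<^esub>" using skew_inverse a(1) by blast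
  then have "v = b \<odot>\<^bsub>V\<^esub> u" using a v smult_assoc[of b a v] by simp
  moreover have uV: "u \<in> carrier V" using a v by simp
  ultimately have "v \<in> lin_span K V {u}" unfolding lin_span_singleton[OF uV] using b by blast
  then have "z \<subseteq> lin_span K V {u}" unfolding v(2) using uV by (intro lin_span_least lin_span_submodule) auto
  moreover have "lin_span K V {u} \<subseteq> z"
    using u pg_point_submodule[OF z] by (intro lin_span_least) auto
  ultimately show ?thesis by blast
qed

lemma pg_point_subset:
  assumes "z \<in> pg_points K V" "u \<in> z" "u \<noteq> \<zero>\<^bsub>V\<^esub>" "submodule H K V" "u \<in> H"
  shows "z \<subseteq> H"
  unfolding pg_point_span[OF assms(1-3)] using assms by (intro lin_span_least) auto

lemma pg_points_eq:
  "\<lbrakk>z \<in> pg_points K V; y \<in> pg_points K V; u \<in> z; u \<in> y; u \<noteq> \<zero>\<^bsub>V\<^esub>\<rbrakk> \<Longrightarrow> z = y"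
  using pg_point_span[of z u] pg_point_span[of y u] by simp

text \<open>
  A criterion for a map to send the line \<open>l\<close> onto a full projective line; the last assumption is
  fullness, tested on sums of vectors.
\<close>

lemma pg_line_imageI:
  assumes \<epsilon>: "\<And>r. r \<in> l \<Longrightarrow> \<epsilon> r \<in> pg_points K V" and pq: "p \<in> l" "q \<in> l" "\<epsilon> p \<noteq> \<epsilon> q"
    and in_span: "\<And>r. r \<in> l \<Longrightarrow> \<epsilon> r \<subseteq> lin_span K V (\<epsilon> p \<union> \<epsilon> q)"
    and full: "\<And>v w. \<lbrakk>v \<in> \<epsilon> p; w \<in> \<epsilon> q\<rbrakk> \<Longrightarrow> \<exists>r\<in>l. v \<oplus>\<^bsub>V\<^esub> w \<in> \<epsilon> r"
  shows "\<epsilon> ` l \<in> pg_lines K V"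
proof -
  have "\<epsilon> ` l = {z \<in> pg_points K V. z \<subseteq> lin_span K V (\<epsilon> p \<union> \<epsilon> q)}" (is "_ = ?R")
  proof
    show "\<epsilon> ` l \<subseteq> ?R" using \<epsilon> in_span by blast
    show "?R \<subseteq> \<epsilon> ` l"
    proof
      fix z assume z: "z \<in> ?R"
      then obtain u where u: "u \<in> carrier V" "u \<noteq> \<zero>\<^bsub>V\<^esub>" "z = lin_span K V {u}"
        using pg_pointE by blast
      have uz: "u \<in> z" unfolding u(3) using lin_span_incl[of "{u}"] by simp
      then have "u \<in> lin_span K V (\<epsilon> p \<union> \<epsilon> q)" using z by blast
      then obtain v w where "v \<in> \<epsilon> p" "w \<in> \<epsilon> q" "u = v \<oplus>\<^bsub>V\<^esub> w"
        unfolding lin_span_Un[OF pg_point_submodule[OF \<epsilon>[OF pq(1)]] pg_point_submodule[OF \<epsilon>[OF pq(2)]]]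
        by blast
      then obtain r where r: "r \<in> l" "u \<in> \<epsilon> r" using full by blast
      then have "z = \<epsilon> r" using pg_points_eq[OF _ \<epsilon>[OF r(1)] uz r(2) u(2)] z by blast
      then show "z \<in> \<epsilon> ` l" using r by blast
    qed
  qed
  then show ?thesis unfolding pg_lines_def using \<epsilon> pq by blast
qed

lemma left_vector_space_submodule:
  assumes H: "submodule H K V" shows "left_vector_space K (V\<lparr>carrier := H\<rparr>)"
proof -
  note D = submoduleD[OF H]
  have in_V: "x \<in> carrier V" if "x \<in> H" for x using that D(1) by blast
  have "abelian_group (V\<lparr>carrier := H\<rparr>)"
  proof (rule abelian_groupI)
    show "\<exists>y\<in>carrier (V\<lparr>carrier := H\<rparr>). y \<oplus>\<^bsub>V\<lparr>carrier := H\<rparr>\<^esub> x = \<zero>\<^bsub>V\<lparr>carrier := H\<rparr>\<^esub>"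
      if "x \<in> carrier (V\<lparr>carrier := H\<rparr>)" for x
      using that submodule_minus[OF H, of x] in_V
      by (intro bexI[of _ "\<ominus>\<^bsub>V\<^esub> x"]) (auto simp: V.l_neg)
  qed (use D in_V in \<open>auto simp: V.a_ac\<close>)
  moreover have "left_vector_space_axioms K (V\<lparr>carrier := H\<rparr>)"
    by (rule left_vector_space_axioms.intro)
       (use D in_V in \<open>auto simp: smult_l_distr smult_r_distr smult_assoc\<close>)
  ultimately show ?thesis using K.skew_field_axioms by (intro left_vector_space.intro)
qed

lemma submodule_restrict_iff:
  assumes H: "submodule H K V"
  shows "submodule N K (V\<lparr>carrier := H\<rparr>) \<longleftrightarrow> submodule N K V \<and> N \<subseteq> H"
proof -
  interpret H: left_vector_space K "V\<lparr>carrier := H\<rparr>" by (rule left_vector_space_submodule[OF H])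
  show ?thesis
  proof
    assume "submodule N K (V\<lparr>carrier := H\<rparr>)"
    note N = H.submoduleD[OF this]
    show "submodule N K V \<and> N \<subseteq> H"
      using N submoduleD(1)[OF H] by (intro conjI submoduleI) auto
  next
    assume *: "submodule N K V \<and> N \<subseteq> H"
    then have "submodule N K V" by simp
    note N = submoduleD[OF this]
    show "submodule N K (V\<lparr>carrier := H\<rparr>)"
      using N * by (intro H.submoduleI) auto
  qed
qed

lemma lin_span_restrict:
  assumes H: "submodule H K V" and X: "X \<subseteq> H"
  shows "lin_span K (V\<lparr>carrier := H\<rparr>) X = lin_span K V X"
proof
  interpret H: left_vector_space K "V\<lparr>carrier := H\<rparr>" by (rule left_vector_space_submodule[OF H])
  have S: "submodule (lin_span K V X) K V" using X submoduleD(1)[OF H] by (intro lin_span_submodule) blast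
  moreover have "lin_span K V X \<subseteq> H" using lin_span_least[OF H X] .
  ultimately have "submodule (lin_span K V X) K (V\<lparr>carrier := H\<rparr>)"
    unfolding submodule_restrict_iff[OF H] by simp
  then show "lin_span K (V\<lparr>carrier := H\<rparr>) X \<subseteq> lin_span K V X"
    using H.lin_span_least lin_span_incl by blast
  have "submodule (lin_span K (V\<lparr>carrier := H\<rparr>) X) K (V\<lparr>carrier := H\<rparr>)"
    using X by (intro H.lin_span_submodule) simp
  then have "submodule (lin_span K (V\<lparr>carrier := H\<rparr>) X) K V"
    unfolding submodule_restrict_iff[OF H] by simp
  then show "lin_span K V X \<subseteq> lin_span K (V\<lparr>carrier := H\<rparr>) X"
    using lin_span_least H.lin_span_incl by blast
qed

lemma pg_points_restrict:
  assumes H: "submodule H K V"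
  shows "pg_points K (V\<lparr>carrier := H\<rparr>) = {z \<in> pg_points K V. z \<subseteq> H}"
proof -
  have 1: "lin_span K (V\<lparr>carrier := H\<rparr>) {v} = lin_span K V {v}" if "v \<in> H" for v
    using lin_span_restrict[OF H] that by simp
  have 2: "lin_span K V {v} \<subseteq> H \<longleftrightarrow> v \<in> H" for v
    using lin_span_least[OF H, of "{v}"] lin_span_incl[of "{v}"] by auto
  show ?thesis
  proof
    show "pg_points K (V\<lparr>carrier := H\<rparr>) \<subseteq> {z \<in> pg_points K V. z \<subseteq> H}"
    proof
      fix z assume "z \<in> pg_points K (V\<lparr>carrier := H\<rparr>)"
      then obtain v where v: "v \<in> H" "v \<noteq> \<zero>\<^bsub>V\<^esub>" "z = lin_span K V {v}"
        using 1 unfolding pg_points_def by auto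
      then have "z \<subseteq> H" using 2 by simp
      then show "z \<in> {z \<in> pg_points K V. z \<subseteq> H}"
        using v submoduleD(1)[OF H] unfolding pg_points_def by blast
    qed
    show "{z \<in> pg_points K V. z \<subseteq> H} \<subseteq> pg_points K (V\<lparr>carrier := H\<rparr>)"
    proof
      fix z assume "z \<in> {z \<in> pg_points K V. z \<subseteq> H}"
      then obtain v where "v \<in> carrier V" "v \<noteq> \<zero>\<^bsub>V\<^esub>" "z = lin_span K V {v}" "z \<subseteq> H"
        using pg_pointE by blast
      then show "z \<in> pg_points K (V\<lparr>carrier := H\<rparr>)"
        using 1[of v] 2[of v] unfolding pg_points_def by auto
    qed
  qed
qed

text \<open>
  An embedding has to span. This can always be achieved by shrinking the vector space.
\<close>

lemma embedding_into_span:
  assumes \<epsilon>: "\<epsilon> \<in> points \<Gamma> \<rightarrow> pg_points K V" "inj_on \<epsilon> (points \<Gamma>)"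
    and ln: "\<And>l. l \<in> lines \<Gamma> \<Longrightarrow> l \<subseteq> points \<Gamma> \<and> \<epsilon> ` l \<in> pg_lines K V"
  shows "embedding \<Gamma> K (V\<lparr>carrier := lin_span K V (\<Union>p\<in>points \<Gamma>. \<epsilon> p)\<rparr>) \<epsilon>"
proof -
  let ?X = "\<Union>p\<in>points \<Gamma>. \<epsilon> p"
  let ?H = "lin_span K V ?X"
  have "\<epsilon> p \<subseteq> carrier V" if "p \<in> points \<Gamma>" for p
    using \<epsilon>(1) that submoduleD(1)[OF pg_point_submodule] by blast
  then have H: "submodule ?H K V" by (intro lin_span_submodule) blast
  interpret H: left_vector_space K "V\<lparr>carrier := ?H\<rparr>" by (rule left_vector_space_submodule[OF H])
  have pts: "\<epsilon> p \<in> pg_points K (V\<lparr>carrier := ?H\<rparr>)" if "p \<in> points \<Gamma>" for p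
    unfolding pg_points_restrict[OF H] using \<epsilon>(1) that lin_span_incl[of ?X] by blast
  have "\<epsilon> ` l \<in> pg_lines K (V\<lparr>carrier := ?H\<rparr>)" if l: "l \<in> lines \<Gamma>" for l
  proof -
    obtain x y where xy: "x \<in> pg_points K V" "y \<in> pg_points K V" "x \<noteq> y"
      and L: "\<epsilon> ` l = {z \<in> pg_points K V. z \<subseteq> lin_span K V (x \<union> y)}"
      using ln[OF l] unfolding pg_lines_def by blast
    have "x \<in> \<epsilon> ` l" "y \<in> \<epsilon> ` l"
      unfolding L using xy(1,2) lin_span_incl[of "x \<union> y"] by auto
    then have xy': "x \<in> pg_points K (V\<lparr>carrier := ?H\<rparr>)" "y \<in> pg_points K (V\<lparr>carrier := ?H\<rparr>)"
      using pts ln[OF l] by auto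
    then have "x \<union> y \<subseteq> ?H" unfolding pg_points_restrict[OF H] by blast
    note s = lin_span_restrict[OF H this] lin_span_least[OF H this]
    have "\<epsilon> ` l = {z \<in> pg_points K (V\<lparr>carrier := ?H\<rparr>). z \<subseteq> lin_span K (V\<lparr>carrier := ?H\<rparr>) (x \<union> y)}"
      unfolding L s(1) pg_points_restrict[OF H] using s(2) by blast
    then show ?thesis using xy' xy(3) unfolding pg_lines_def by blast
  qed
  moreover have "lin_span K (V\<lparr>carrier := ?H\<rparr>) ?X = ?H"
    using lin_span_restrict[OF H lin_span_incl] .
  ultimately show ?thesis
    unfolding embedding_def using H.left_vector_space_axioms \<epsilon>(2) pts by simp
qed

end

context left_vector_space
begin

lemma lin_span_exchange:
  assumes x: "x \<in> pg_points K V" and y: "y \<in> pg_points K V" and p: "p \<in> pg_points K V"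
    and p_in: "p \<subseteq> lin_span K V (x \<union> y)" and ne: "p \<noteq> x"
  shows "lin_span K V (x \<union> y) = lin_span K V (x \<union> p)"
proof
  note sx = pg_point_submodule[OF x] and sy = pg_point_submodule[OF y] and sp = pg_point_submodule[OF p]
  have sub: "submodule (lin_span K V (x \<union> y)) K V" "submodule (lin_span K V (x \<union> p)) K V"
    using submoduleD(1)[OF sx] submoduleD(1)[OF sy] submoduleD(1)[OF sp] by (simp_all add: lin_span_submodule)
  obtain u where u: "u \<in> p" "u \<noteq> \<zero>\<^bsub>V\<^esub>"
    using pg_pointE[OF p] lin_span_incl by (metis insert_subset)
  obtain x1 y1 where xy: "x1 \<in> x" "y1 \<in> y" "u = x1 \<oplus>\<^bsub>V\<^esub> y1"
    using u p_in unfolding lin_span_Un[OF sx sy] by blast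
  have c: "x1 \<in> carrier V" "y1 \<in> carrier V" "u \<in> carrier V"
    using xy u submoduleD(1)[OF sx] submoduleD(1)[OF sy] submoduleD(1)[OF sp] by auto
  have "y1 \<noteq> \<zero>\<^bsub>V\<^esub>"
  proof
    assume "y1 = \<zero>\<^bsub>V\<^esub>"
    then have "u \<in> x" using xy c by simp
    then show False using pg_points_eq[OF p x u(1) _ u(2)] ne by blast
  qed
  moreover have "y1 = u \<oplus>\<^bsub>V\<^esub> \<ominus>\<^bsub>V\<^esub> x1"
    using xy(3) c by (simp add: V.a_comm[of x1 y1] add_minus_cancel)
  moreover have "u \<in> lin_span K V (x \<union> p)" "\<ominus>\<^bsub>V\<^esub> x1 \<in> lin_span K V (x \<union> p)"
    using lin_span_incl[of "x \<union> p"] u(1) submodule_minus[OF sx xy(1)] by auto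
  ultimately have "y1 \<noteq> \<zero>\<^bsub>V\<^esub>" "y1 \<in> lin_span K V (x \<union> p)" using submoduleD(3)[OF sub(2)] by metis+
  then have "y \<subseteq> lin_span K V (x \<union> p)" using pg_point_subset[OF y xy(2) _ sub(2)] by simp
  then show "lin_span K V (x \<union> y) \<subseteq> lin_span K V (x \<union> p)"
    using lin_span_incl[of "x \<union> p"] by (intro lin_span_least[OF sub(2)]) simp
  show "lin_span K V (x \<union> p) \<subseteq> lin_span K V (x \<union> y)"
    using lin_span_incl[of "x \<union> y"] p_in by (intro lin_span_least[OF sub(1)]) simp
qed

lemma pg_line_span:
  assumes L: "L \<in> pg_lines K V" and p: "p \<in> L" and q: "q \<in> L" and ne: "p \<noteq> q"
  shows "L = {z \<in> pg_points K V. z \<subseteq> lin_span K V (p \<union> q)}"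
proof -
  obtain x y where xy: "x \<in> pg_points K V" "y \<in> pg_points K V" "x \<noteq> y"
    and L': "L = {z \<in> pg_points K V. z \<subseteq> lin_span K V (x \<union> y)}"
    using L unfolding pg_lines_def by blast
  have pq: "p \<in> pg_points K V" "q \<in> pg_points K V" "p \<subseteq> lin_span K V (x \<union> y)" "q \<subseteq> lin_span K V (x \<union> y)"
    using p q unfolding L' by auto
  have "lin_span K V (x \<union> y) = lin_span K V (p \<union> q)"
  proof (cases "p = x")
    case True
    then show ?thesis using lin_span_exchange[OF xy(1,2) pq(2,4)] ne by simp
  next
    case False
    then have 1: "lin_span K V (x \<union> y) = lin_span K V (p \<union> x)"
      using lin_span_exchange[OF xy(1,2) pq(1,3)] by (simp add: Un_commute)
    then show ?thesis using lin_span_exchange[OF pq(1) xy(1) pq(2)] pq(4) ne by simp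
  qed
  then show ?thesis unfolding L' by simp
qed

end

section \<open>Embedded polar spaces\<close>

locale embedded_polar_space = left_vector_space K V
  for K :: "('k, 'm) ring_scheme" and V :: "('k, 'v, 'w) module_scheme" +
  fixes \<Gamma> :: "'p geometry" and \<epsilon> :: "'p \<Rightarrow> 'v set"
  assumes is_polar: "polar_space \<Gamma>" and is_nondegenerate: "nondegenerate \<Gamma>"
    and has_line: "lines \<Gamma> \<noteq> {}" and emb: "embedding \<Gamma> K V \<epsilon>"
begin

lemma point_image: "p \<in> points \<Gamma> \<Longrightarrow> \<epsilon> p \<in> pg_points K V"
  using emb unfolding embedding_def by auto

lemma line_image: "l \<in> lines \<Gamma> \<Longrightarrow> \<epsilon> ` l \<in> pg_lines K V"
  using emb unfolding embedding_def by auto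

lemma image_inj: "inj_on \<epsilon> (points \<Gamma>)"
  using emb unfolding embedding_def by auto

lemma line_points': "l \<in> lines \<Gamma> \<Longrightarrow> l \<subseteq> points \<Gamma>"
  using is_polar unfolding polar_space_def point_line_geometry_def by auto

lemmas point_submodule = pg_point_submodule[OF point_image]

lemma point_carrier: "p \<in> points \<Gamma> \<Longrightarrow> v \<in> \<epsilon> p \<Longrightarrow> v \<in> carrier V"
  using submoduleD(1)[OF point_submodule] by blast

lemma nonzero_vector:
  assumes "p \<in> points \<Gamma>" obtains v where "v \<in> \<epsilon> p" "v \<noteq> \<zero>\<^bsub>V\<^esub>"
  using pg_pointE[OF point_image[OF assms]] lin_span_incl by (metis insert_subset)

lemma vector_point_unique:
  "\<lbrakk>p \<in> points \<Gamma>; q \<in> points \<Gamma>; v \<in> \<epsilon> p; v \<in> \<epsilon> q; v \<noteq> \<zero>\<^bsub>V\<^esub>\<rbrakk> \<Longrightarrow> p = q"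
  using pg_points_eq[OF point_image point_image] image_inj by (simp add: inj_on_def)

lemma point_multiples:
  assumes "p \<in> points \<Gamma>" "v \<in> \<epsilon> p" "v \<noteq> \<zero>\<^bsub>V\<^esub>"
  shows "\<epsilon> p = {a \<odot>\<^bsub>V\<^esub> v | a. a \<in> carrier K}"
  using pg_point_span[OF point_image] lin_span_singleton[OF point_carrier] assms by simp

lemma line_span:
  assumes l: "l \<in> lines \<Gamma>" and pq: "p \<in> l" "q \<in> l" "p \<noteq> q"
  shows "\<epsilon> ` l = {z \<in> pg_points K V. z \<subseteq> lin_span K V (\<epsilon> p \<union> \<epsilon> q)}"
proof -
  have "\<epsilon> p \<noteq> \<epsilon> q" using image_inj pq line_points'[OF l] unfolding inj_on_def by blast
  then show ?thesis using pg_line_span[OF line_image[OF l]] pq by simp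
qed

lemma line_add:
  assumes l: "l \<in> lines \<Gamma>" and p: "p \<in> l" "v \<in> \<epsilon> p" and q: "q \<in> l" "w \<in> \<epsilon> q"
  shows "\<exists>r\<in>l. v \<oplus>\<^bsub>V\<^esub> w \<in> \<epsilon> r"
proof -
  have P: "p \<in> points \<Gamma>" "q \<in> points \<Gamma>" using line_points'[OF l] p q by auto
  show ?thesis
  proof (cases "p = q \<or> v \<oplus>\<^bsub>V\<^esub> w = \<zero>\<^bsub>V\<^esub>")
    case True
    then have "v \<oplus>\<^bsub>V\<^esub> w \<in> \<epsilon> p"
      using submoduleD(2,3)[OF point_submodule[OF P(1)]] p(2) q(2) by auto
    then show ?thesis using p(1) by blast
  next
    case False
    let ?u = "v \<oplus>\<^bsub>V\<^esub> w"
    have u: "?u \<in> carrier V" using point_carrier P p q by simp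
    have "?u \<in> lin_span K V (\<epsilon> p \<union> \<epsilon> q)"
      unfolding lin_span_Un[OF point_submodule[OF P(1)] point_submodule[OF P(2)]] using p q by blast
    moreover have "submodule (lin_span K V (\<epsilon> p \<union> \<epsilon> q)) K V"
      using point_carrier P by (intro lin_span_submodule) blast
    ultimately have "lin_span K V {?u} \<subseteq> lin_span K V (\<epsilon> p \<union> \<epsilon> q)"
      by (intro lin_span_least) simp_all
    moreover have "lin_span K V {?u} \<in> pg_points K V" using u False unfolding pg_points_def by blast
    ultimately have "lin_span K V {?u} \<in> \<epsilon> ` l" using line_span[OF l p(1) q(1)] False by simp
    then obtain r where "r \<in> l" "lin_span K V {?u} = \<epsilon> r" by blast
    then show ?thesis using lin_span_incl[of "{?u}"] by blast
  qed
qed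

lemma line_split:
  assumes l: "l \<in> lines \<Gamma>" and pq: "p \<in> l" "q \<in> l" "p \<noteq> q" and r: "r \<in> l" "u \<in> \<epsilon> r"
  obtains v w where "v \<in> \<epsilon> p" "w \<in> \<epsilon> q" "u = v \<oplus>\<^bsub>V\<^esub> w"
proof -
  have P: "p \<in> points \<Gamma>" "q \<in> points \<Gamma>" using line_points'[OF l] pq by auto
  have "\<epsilon> r \<subseteq> lin_span K V (\<epsilon> p \<union> \<epsilon> q)" using line_span[OF l pq] r(1) by blast
  then have "u \<in> lin_span K V (\<epsilon> p \<union> \<epsilon> q)" using r(2) by blast
  then show thesis
    unfolding lin_span_Un[OF point_submodule[OF P(1)] point_submodule[OF P(2)]] using that by blast
qed

lemma add_nonzero:
  assumes P: "p \<in> points \<Gamma>" "q \<in> points \<Gamma>" "p \<noteq> q" and v: "v \<in> \<epsilon> p" and w: "w \<in> \<epsilon> q"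
    and nz: "v \<noteq> \<zero>\<^bsub>V\<^esub> \<or> w \<noteq> \<zero>\<^bsub>V\<^esub>"
  shows "v \<oplus>\<^bsub>V\<^esub> w \<noteq> \<zero>\<^bsub>V\<^esub>"
proof
  assume 0: "v \<oplus>\<^bsub>V\<^esub> w = \<zero>\<^bsub>V\<^esub>"
  have c: "v \<in> carrier V" "w \<in> carrier V" using point_carrier P v w by auto
  then have eq: "v = \<ominus>\<^bsub>V\<^esub> w" using 0 by (simp add: V.minus_equality)
  then have "v \<in> \<epsilon> q" using submodule_minus[OF point_submodule[OF P(2)] w] by simp
  then have "v = \<zero>\<^bsub>V\<^esub>" using vector_point_unique[OF P(1,2) v] P(3) by blast
  then show False using nz 0 c by simp
qed

lemma add_notin_point:
  assumes P: "p \<in> points \<Gamma>" "q \<in> points \<Gamma>" "p \<noteq> q" and v: "v \<in> \<epsilon> p" and w: "w \<in> \<epsilon> q" "w \<noteq> \<zero>\<^bsub>V\<^esub>"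
  shows "v \<oplus>\<^bsub>V\<^esub> w \<notin> \<epsilon> p"
proof
  assume u: "v \<oplus>\<^bsub>V\<^esub> w \<in> \<epsilon> p"
  have c: "v \<in> carrier V" "w \<in> carrier V" using point_carrier P v w by auto
  have "(v \<oplus>\<^bsub>V\<^esub> w) \<oplus>\<^bsub>V\<^esub> \<ominus>\<^bsub>V\<^esub> v = w"
    using add_minus_cancel[of w v] c by (simp add: V.a_comm)
  then have "w \<in> \<epsilon> p"
    using submoduleD(3)[OF point_submodule[OF P(1)] u submodule_minus[OF point_submodule[OF P(1)] v]] by simp
  then show False using vector_point_unique[OF P(1,2)] w P(3) by blast
qed

end

sublocale embedded_polar_space \<subseteq> nondegenerate_polar_space \<Gamma>
proof
  show "polar_space \<Gamma>" by (rule is_polar)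
  show "nondegenerate \<Gamma>" by (rule is_nondegenerate)
  show two: "\<exists>p\<in>l. \<exists>q\<in>l. p \<noteq> q" if l: "l \<in> lines \<Gamma>" for l
  proof -
    obtain x y where xy: "x \<in> pg_points K V" "y \<in> pg_points K V" "x \<noteq> y"
      and L: "\<epsilon> ` l = {z \<in> pg_points K V. z \<subseteq> lin_span K V (x \<union> y)}"
      using line_image[OF l] unfolding pg_lines_def by blast
    have "x \<in> \<epsilon> ` l" "y \<in> \<epsilon> ` l"
      unfolding L using xy(1,2) lin_span_incl[of "x \<union> y"] by auto
    then obtain p q where "p \<in> l" "q \<in> l" "x = \<epsilon> p" "y = \<epsilon> q" by blast
    then show ?thesis using xy(3) by (intro bexI[of _ p] bexI[of _ q]) auto
  qed
  show "\<exists>r\<in>l. r \<noteq> p \<and> r \<noteq> q" if l: "l \<in> lines \<Gamma>" "p \<in> l" "q \<in> l" for l p q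
  proof (cases "p = q")
    case True
    then show ?thesis using two[OF l(1)] by metis
  next
    case False
    have P: "p \<in> points \<Gamma>" "q \<in> points \<Gamma>" using line_points'[OF l(1)] l by auto
    obtain v where v: "v \<in> \<epsilon> p" "v \<noteq> \<zero>\<^bsub>V\<^esub>" using nonzero_vector[OF P(1)] .
    obtain w where w: "w \<in> \<epsilon> q" "w \<noteq> \<zero>\<^bsub>V\<^esub>" using nonzero_vector[OF P(2)] .
    obtain r where r: "r \<in> l" "v \<oplus>\<^bsub>V\<^esub> w \<in> \<epsilon> r" using line_add[OF l(1,2) v(1) l(3) w(1)] by blast
    have "w \<oplus>\<^bsub>V\<^esub> v = v \<oplus>\<^bsub>V\<^esub> w" using V.a_comm point_carrier P v w by simp
    then have "r \<noteq> p" "r \<noteq> q"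
      using add_notin_point[OF P False v(1) w] add_notin_point[OF P(2,1) _ w(1) v] False r(2) by auto
    then show ?thesis using r by blast
  qed
  show "l = m" if "l \<in> lines \<Gamma>" "m \<in> lines \<Gamma>" "p \<in> l" "q \<in> l" "p \<in> m" "q \<in> m" "p \<noteq> q" for l m p q
  proof -
    have "\<epsilon> ` l = \<epsilon> ` m" using line_span[OF that(1,3,4,7)] line_span[OF that(2,5,6,7)] by simp
    then show ?thesis
      using inj_on_image_eq_iff[OF image_inj line_points'[OF that(1)] line_points'[OF that(2)]] by simp
  qed
qed

context embedded_polar_space
begin

text \<open>
  The vectors that represent a point of \<open>X\<close>, including zero, so that sums need no case distinction.
\<close>

definition cone :: "'p set \<Rightarrow> 'v set" where
  "cone X = {v. v = \<zero>\<^bsub>V\<^esub> \<or> (\<exists>p\<in>X. v \<in> \<epsilon> p)}"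

abbreviation spn :: "'p set \<Rightarrow> 'v set" where
  "spn X \<equiv> lin_span K V (\<Union>p\<in>X. \<epsilon> p)"

definition pts :: "'v set \<Rightarrow> 'p set" where
  "pts H = {p \<in> points \<Gamma>. \<epsilon> p \<subseteq> H}"

lemma coneI: "p \<in> X \<Longrightarrow> v \<in> \<epsilon> p \<Longrightarrow> v \<in> cone X"
  unfolding cone_def by blast

lemma coneE:
  assumes "v \<in> cone X" "v \<noteq> \<zero>\<^bsub>V\<^esub>" obtains p where "p \<in> X" "v \<in> \<epsilon> p"
  using assms unfolding cone_def by blast

lemma cone_carrier: "X \<subseteq> points \<Gamma> \<Longrightarrow> cone X \<subseteq> carrier V"
  unfolding cone_def using point_carrier by auto

lemma UN_carrier: "X \<subseteq> points \<Gamma> \<Longrightarrow> (\<Union>p\<in>X. \<epsilon> p) \<subseteq> carrier V"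
  using point_carrier by blast

lemma spn_submodule: "X \<subseteq> points \<Gamma> \<Longrightarrow> submodule (spn X) K V"
  using UN_carrier by (intro lin_span_submodule)

lemma spn_points: "spn (points \<Gamma>) = carrier V"
  using emb unfolding embedding_def by simp

lemma spn_incl: "p \<in> X \<Longrightarrow> \<epsilon> p \<subseteq> spn X"
  using lin_span_incl[of "\<Union>p\<in>X. \<epsilon> p"] by blast

lemma spn_least: "\<lbrakk>submodule H K V; \<And>p. p \<in> X \<Longrightarrow> \<epsilon> p \<subseteq> H\<rbrakk> \<Longrightarrow> spn X \<subseteq> H"
  by (intro lin_span_least) auto

lemma ptsI:
  "\<lbrakk>submodule H K V; p \<in> points \<Gamma>; v \<in> \<epsilon> p; v \<noteq> \<zero>\<^bsub>V\<^esub>; v \<in> H\<rbrakk> \<Longrightarrow> p \<in> pts H"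
  unfolding pts_def using pg_point_subset[OF point_image] by simp

lemma cone_add:
  assumes S: "geo_subspace \<Gamma> S" and p: "p \<in> S" "v \<in> \<epsilon> p" and q: "q \<in> S" "w \<in> \<epsilon> q" and pq: "col p q"
  shows "v \<oplus>\<^bsub>V\<^esub> w \<in> cone S"
proof (cases "p = q")
  case True
  then show ?thesis
    using submoduleD(3)[OF point_submodule p(2)] p q geo_subspace_points[OF S] by (blast intro: coneI)
next
  case False
  obtain l where l: "l \<in> lines \<Gamma>" "p \<in> l" "q \<in> l" using col_lineE[OF pq False] .
  then have "l \<subseteq> S" using geo_subspaceD[OF S l] p q False by simp
  then show ?thesis using line_add[OF l(1,2) p(2) l(3) q(2)] by (blast intro: coneI)
qed

lemma pts_subspace:
  assumes H: "submodule H K V" shows "geo_subspace \<Gamma> (pts H)"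
  unfolding geo_subspace_def
proof (intro conjI ballI impI)
  fix l assume l: "l \<in> lines \<Gamma>" "\<exists>p\<in>l \<inter> pts H. \<exists>q\<in>l \<inter> pts H. p \<noteq> q"
  from l(2) obtain p q where pq: "p \<in> l" "q \<in> l" "p \<noteq> q" "p \<in> pts H" "q \<in> pts H" by blast
  then have "\<epsilon> p \<union> \<epsilon> q \<subseteq> H" unfolding pts_def by simp
  then have "lin_span K V (\<epsilon> p \<union> \<epsilon> q) \<subseteq> H" by (rule lin_span_least[OF H])
  then have "\<epsilon> r \<subseteq> H" if "r \<in> l" for r using line_span[OF l(1) pq(1-3)] that by blast
  then show "l \<subseteq> pts H" using line_points[OF l(1)] unfolding pts_def by blast
qed (auto simp: pts_def)

lemma pts_mono: "H \<subseteq> H' \<Longrightarrow> pts H \<subseteq> pts H'"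
  unfolding pts_def by blast

lemma pts_spn: "X \<subseteq> points \<Gamma> \<Longrightarrow> X \<subseteq> pts (spn X)"
  unfolding pts_def using spn_incl by blast

lemma pts_proper:
  assumes H: "submodule H K V" "H \<noteq> carrier V" shows "proper_subspace \<Gamma> (pts H)"
proof -
  have "pts H \<noteq> points \<Gamma>"
  proof
    assume "pts H = points \<Gamma>"
    then have "spn (points \<Gamma>) \<subseteq> H" using spn_least[OF H(1), of "points \<Gamma>"] unfolding pts_def by blast
    then show False using spn_points H(2) submoduleD(1)[OF H(1)] by simp
  qed
  then show ?thesis using pts_subspace[OF H(1)] unfolding proper_subspace_def by simp
qed

lemma lin_span_insert_point:
  assumes A: "A \<subseteq> carrier V" and F: "F \<subseteq> points \<Gamma>" and y: "y \<in> points \<Gamma>"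
  shows "lin_span K V (A \<union> (\<Union>p\<in>insert y F. \<epsilon> p)) =
    {h \<oplus>\<^bsub>V\<^esub> n | h n. h \<in> lin_span K V (A \<union> (\<Union>p\<in>F. \<epsilon> p)) \<and> n \<in> \<epsilon> y}"
proof -
  let ?B = "A \<union> (\<Union>p\<in>F. \<epsilon> p)"
  have B: "?B \<subseteq> carrier V" using A UN_carrier[OF F] by simp
  have y': "\<epsilon> y \<subseteq> carrier V" using point_carrier[OF y] by blast
  have "A \<union> (\<Union>p\<in>insert y F. \<epsilon> p) = ?B \<union> \<epsilon> y" by auto
  then show ?thesis
    using lin_span_Un_lin_span[OF B y'] lin_span_Un[OF lin_span_submodule[OF B] point_submodule[OF y]]
    by simp
qed

text \<open>
  The preimage of \<open>spn S + \<epsilon> x\<close> is a subspace larger than \<open>S\<close>, hence not a proper one.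
\<close>

lemma maximal_subspace_span:
  assumes S: "maximal_subspace \<Gamma> S" and x: "x \<in> points \<Gamma>" "x \<notin> S"
  shows "carrier V = {h \<oplus>\<^bsub>V\<^esub> n | h n. h \<in> spn S \<and> n \<in> \<epsilon> x}"
proof -
  have SP: "S \<subseteq> points \<Gamma>"
    using S geo_subspace_points unfolding maximal_subspace_def proper_subspace_def by blast
  have c: "spn S \<union> \<epsilon> x \<subseteq> carrier V"
    using submoduleD(1)[OF spn_submodule[OF SP]] point_carrier[OF x(1)] by blast
  note sub = lin_span_submodule[OF c]
  have "S \<subseteq> pts (lin_span K V (spn S \<union> \<epsilon> x))" "x \<in> pts (lin_span K V (spn S \<union> \<epsilon> x))"
    using pts_spn[OF SP] pts_mono[of "spn S" "lin_span K V (spn S \<union> \<epsilon> x)"] x(1)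
      lin_span_incl[of "spn S \<union> \<epsilon> x"] unfolding pts_def by auto
  then have "\<not> proper_subspace \<Gamma> (pts (lin_span K V (spn S \<union> \<epsilon> x)))"
    using maximal_subspaceD[OF S] x(2) by blast
  then have "lin_span K V (spn S \<union> \<epsilon> x) = carrier V" using pts_proper[OF sub] by blast
  then show ?thesis using lin_span_Un[OF spn_submodule[OF SP] point_submodule[OF x(1)]] by simp
qed

text \<open>
  The reason why \<open>p\<^sup>\<bottom>\<close> does not span a point \<open>q\<close> outside it. Suppose that \<open>u \<in> \<epsilon> q\<close> is a combination of
  vectors from \<open>p\<close> and from neighbours of \<open>p\<close>. Modulo \<open>p\<close>, the last neighbour may be moved to a point
  \<open>y'\<close> collinear with \<open>q\<close>. Subtracting its contribution \<open>w'\<close> from \<open>u\<close> gives a vector that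
  has a shorter combination and belongs to a point of the line \<open>qy'\<close>, still not collinear with \<open>p\<close>.
\<close>

lemma perp_span_avoids:
  assumes p: "p \<in> points \<Gamma>" and F: "finite F" "F \<subseteq> perp \<Gamma> {p}"
    and q: "q \<in> points \<Gamma>" "\<not> col p q" and u: "u \<in> \<epsilon> q" "u \<noteq> \<zero>\<^bsub>V\<^esub>"
  shows "u \<notin> lin_span K V (\<epsilon> p \<union> (\<Union>y\<in>F. \<epsilon> y))"
  using F q u
proof (induction F arbitrary: q u rule: finite_induct)
  case empty
  have "lin_span K V (\<epsilon> p) = \<epsilon> p" by (rule lin_span_idem[OF point_submodule[OF p]])
  then show ?case using vector_point_unique[OF p empty(2) _ empty(4,5)] empty(3) by auto
next
  case (insert y F)
  let ?H = "lin_span K V (\<epsilon> p \<union> (\<Union>y\<in>F. \<epsilon> y))"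
  have FP: "F \<subseteq> points \<Gamma>" and y: "y \<in> points \<Gamma>" "col p y" using insert.prems(1) unfolding perp_def by auto
  have pc: "\<epsilon> p \<subseteq> carrier V" using point_carrier[OF p] by blast
  have HC: "\<epsilon> p \<union> (\<Union>y\<in>F. \<epsilon> y) \<subseteq> carrier V" using pc UN_carrier[OF FP] by simp
  note H = lin_span_submodule[OF HC]
  have pH: "\<epsilon> p \<subseteq> ?H" using lin_span_incl[of "\<epsilon> p \<union> (\<Union>y\<in>F. \<epsilon> y)"] by simp
  have IH: "w \<notin> ?H" if "r \<in> points \<Gamma>" "\<not> col p r" "w \<in> \<epsilon> r" "w \<noteq> \<zero>\<^bsub>V\<^esub>" for r w
    using insert.IH[of r w] insert.prems(1) that by simp
  show ?case
  proof
    assume "u \<in> lin_span K V (\<epsilon> p \<union> (\<Union>y\<in>insert y F. \<epsilon> y))"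
    then obtain h w where hw: "h \<in> ?H" "w \<in> \<epsilon> y" "u = h \<oplus>\<^bsub>V\<^esub> w"
      unfolding lin_span_insert_point[OF pc FP y(1)] by blast
    obtain a y' w' where y': "a \<in> \<epsilon> p" "y' \<in> points \<Gamma>" "w' \<in> \<epsilon> y'" "w = a \<oplus>\<^bsub>V\<^esub> w'"
      "w' \<noteq> \<zero>\<^bsub>V\<^esub> \<Longrightarrow> col p y' \<and> col q y'"
    proof (cases "y = p")
      case True
      have "w = w \<oplus>\<^bsub>V\<^esub> \<zero>\<^bsub>V\<^esub>" using point_carrier[OF y(1) hw(2)] by simp
      then show ?thesis using that[of w p "\<zero>\<^bsub>V\<^esub>"] hw(2) True p submoduleD(2)[OF point_submodule[OF p]] by simp
    next
      case False
      obtain l where l: "l \<in> lines \<Gamma>" "p \<in> l" "y \<in> l" using col_lineE[OF y(2)] False by blast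
      obtain z where z: "z \<in> l" "col q z" using ex_col[OF insert.prems(2) l(1)] .
      have "p \<noteq> z" using z insert.prems(3) by (auto simp: col_sym)
      obtain a w' where "a \<in> \<epsilon> p" "w' \<in> \<epsilon> z" "w = a \<oplus>\<^bsub>V\<^esub> w'"
        using line_split[OF l(1,2) z(1) \<open>p \<noteq> z\<close> l(3) hw(2)] .
      then show ?thesis using that[of a z w'] z line_points[OF l(1)] col_line[OF l(1,2) z(1)] by blast
    qed
    have c: "h \<in> carrier V" "a \<in> carrier V" "w' \<in> carrier V" "u \<in> carrier V"
      using hw(1) submoduleD(1)[OF H] point_carrier[OF p y'(1)] point_carrier[OF y'(2,3)]
        point_carrier[OF insert.prems(2,4)] by auto
    have ha: "h \<oplus>\<^bsub>V\<^esub> a \<in> ?H" using submoduleD(3)[OF H hw(1)] y'(1) pH by blast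
    have u_eq: "u = (h \<oplus>\<^bsub>V\<^esub> a) \<oplus>\<^bsub>V\<^esub> w'" using hw(3) y'(4) c by (simp add: V.a_assoc)
    show False
    proof (cases "w' = \<zero>\<^bsub>V\<^esub>")
      case True
      then show False using IH[OF insert.prems(2-5)] ha u_eq c by simp
    next
      case False
      then have col: "col p y'" "col q y'" using y'(5) by auto
      have qy: "q \<noteq> y'" using col insert.prems(3) by blast
      obtain l where l: "l \<in> lines \<Gamma>" "q \<in> l" "y' \<in> l" using col_lineE[OF col(2) qy] .
      have m: "\<ominus>\<^bsub>V\<^esub> w' \<in> \<epsilon> y'" using submodule_minus[OF point_submodule[OF y'(2)] y'(3)] .
      let ?x = "u \<oplus>\<^bsub>V\<^esub> \<ominus>\<^bsub>V\<^esub> w'"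
      obtain r where r: "r \<in> l" "?x \<in> \<epsilon> r" using line_add[OF l(1,2) insert.prems(4) l(3) m] by blast
      have nz: "?x \<noteq> \<zero>\<^bsub>V\<^esub>" using add_nonzero[OF insert.prems(2) y'(2) qy insert.prems(4) m] insert.prems(5) by blast
      have "?x = h \<oplus>\<^bsub>V\<^esub> a" unfolding u_eq using c by (simp add: add_minus_cancel)
      then have xH: "?x \<in> ?H" using ha by simp
      have "r \<noteq> y'"
      proof
        assume "r = y'"
        then have "\<ominus>\<^bsub>V\<^esub> w' \<oplus>\<^bsub>V\<^esub> u \<in> \<epsilon> y'" using r(2) c by (simp add: V.a_comm)
        then show False
          using add_notin_point[OF y'(2) insert.prems(2) _ m insert.prems(4,5)] qy by blast
      qed
      then have "\<not> col p r"
        using col_all[OF p l(1) r(1) l(3) _ _ col(1) l(2)] insert.prems(3) by blast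
      then show False using IH[OF _ _ r(2) nz] xH r(1) line_points[OF l(1)] by blast
    qed
  qed
qed

lemma tangent_hyperplane:
  assumes p: "p \<in> points \<Gamma>" shows "pts (spn (perp \<Gamma> {p})) = perp \<Gamma> {p}"
proof
  show "perp \<Gamma> {p} \<subseteq> pts (spn (perp \<Gamma> {p}))" by (rule pts_spn[OF perp_points])
  show "pts (spn (perp \<Gamma> {p})) \<subseteq> perp \<Gamma> {p}"
  proof
    fix q assume "q \<in> pts (spn (perp \<Gamma> {p}))"
    then have q: "q \<in> points \<Gamma>" "\<epsilon> q \<subseteq> spn (perp \<Gamma> {p})" unfolding pts_def by auto
    obtain u where u: "u \<in> \<epsilon> q" "u \<noteq> \<zero>\<^bsub>V\<^esub>" using nonzero_vector[OF q(1)] .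
    have pc: "\<epsilon> p \<subseteq> carrier V" using point_carrier[OF p] by blast
    have yc: "\<epsilon> y \<subseteq> carrier V" if "y \<in> perp \<Gamma> {p}" for y
      using point_carrier that perp_points by blast
    have u': "u \<in> lin_span K V (\<epsilon> p \<union> (\<Union>y\<in>perp \<Gamma> {p}. \<epsilon> y))"
      using q(2) u(1) lin_span_mono[OF Un_upper2] by (meson subsetD)
    obtain F where "finite F" "F \<subseteq> perp \<Gamma> {p}" "u \<in> lin_span K V (\<epsilon> p \<union> (\<Union>y\<in>F. \<epsilon> y))"
      using lin_span_finite_support[OF pc yc u'] .
    then have "col p q" using perp_span_avoids[OF p, of F q u] q(1) u by auto
    then show "q \<in> perp \<Gamma> {p}" using q(1) unfolding perp_def by simp
  qed
qed

end

section \<open>The dual embedding\<close>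

definition op_ring :: "('k, 'm) ring_scheme \<Rightarrow> 'k ring" where
  "op_ring K = \<lparr>carrier = carrier K, mult = \<lambda>a b. b \<otimes>\<^bsub>K\<^esub> a, one = \<one>\<^bsub>K\<^esub>, zero = \<zero>\<^bsub>K\<^esub>, add = add K\<rparr>"

text \<open>
  A functional is set to zero outside the carrier, so that functionals equal on the carrier are
  equal. Scalars act on the right, which makes the dual a left vector space over the opposite ring.
\<close>

definition dual_space ::
  "('k, 'm) ring_scheme \<Rightarrow> ('k, 'v, 'w) module_scheme \<Rightarrow> ('k, 'v \<Rightarrow> 'k) module" where
  "dual_space K V =
     \<lparr>carrier = {\<phi>. (\<forall>x\<in>carrier V. \<phi> x \<in> carrier K) \<and>
        (\<forall>x\<in>carrier V. \<forall>y\<in>carrier V. \<phi> (x \<oplus>\<^bsub>V\<^esub> y) = \<phi> x \<oplus>\<^bsub>K\<^esub> \<phi> y) \<and>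
        (\<forall>a\<in>carrier K. \<forall>x\<in>carrier V. \<phi> (a \<odot>\<^bsub>V\<^esub> x) = a \<otimes>\<^bsub>K\<^esub> \<phi> x) \<and>
        (\<forall>x. x \<notin> carrier V \<longrightarrow> \<phi> x = \<zero>\<^bsub>K\<^esub>)},
      mult = undefined, one = undefined, zero = \<lambda>_. \<zero>\<^bsub>K\<^esub>,
      add = \<lambda>\<phi> \<psi> x. \<phi> x \<oplus>\<^bsub>K\<^esub> \<psi> x, smult = \<lambda>a \<phi> x. \<phi> x \<otimes>\<^bsub>K\<^esub> a\<rparr>"

lemma op_ring_simps [simp]:
  "carrier (op_ring K) = carrier K" "mult (op_ring K) a b = b \<otimes>\<^bsub>K\<^esub> a"
  "one (op_ring K) = \<one>\<^bsub>K\<^esub>" "zero (op_ring K) = \<zero>\<^bsub>K\<^esub>" "add (op_ring K) = add K"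
  unfolding op_ring_def by simp_all

lemma dual_space_simps [simp]:
  "zero (dual_space K V) = (\<lambda>_. \<zero>\<^bsub>K\<^esub>)"
  "add (dual_space K V) \<phi> \<psi> = (\<lambda>x. \<phi> x \<oplus>\<^bsub>K\<^esub> \<psi> x)"
  "smult (dual_space K V) a \<phi> = (\<lambda>x. \<phi> x \<otimes>\<^bsub>K\<^esub> a)"
  unfolding dual_space_def by simp_all

lemma skew_field_op_ring:
  assumes "skew_field K" shows "skew_field (op_ring K)"
proof -
  interpret skew_field K by fact
  have "ring (op_ring K)"
  proof (rule ringI)
    show "abelian_group (op_ring K)"
    proof (rule abelian_groupI)
      show "\<exists>y\<in>carrier (op_ring K). y \<oplus>\<^bsub>op_ring K\<^esub> x = \<zero>\<^bsub>op_ring K\<^esub>" if "x \<in> carrier (op_ring K)" for x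
        using that by (intro bexI[of _ "\<ominus>\<^bsub>K\<^esub> x"]) (auto simp: l_neg)
    qed (auto simp: a_ac)
    show "monoid (op_ring K)" by (rule monoidI) (auto simp: m_assoc)
  qed (auto simp: l_distr r_distr)
  moreover have "Units (op_ring K) = Units K" unfolding Units_def by auto
  ultimately show ?thesis
    using skew_field_Units by (intro skew_field.intro skew_field_axioms.intro) simp_all
qed

context left_vector_space
begin

lemma dualI:
  assumes "\<And>x. x \<in> carrier V \<Longrightarrow> \<phi> x \<in> carrier K"
    and "\<And>x y. \<lbrakk>x \<in> carrier V; y \<in> carrier V\<rbrakk> \<Longrightarrow> \<phi> (x \<oplus>\<^bsub>V\<^esub> y) = \<phi> x \<oplus>\<^bsub>K\<^esub> \<phi> y"
    and "\<And>a x. \<lbrakk>a \<in> carrier K; x \<in> carrier V\<rbrakk> \<Longrightarrow> \<phi> (a \<odot>\<^bsub>V\<^esub> x) = a \<otimes>\<^bsub>K\<^esub> \<phi> x"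
    and "\<And>x. x \<notin> carrier V \<Longrightarrow> \<phi> x = \<zero>\<^bsub>K\<^esub>"
  shows "\<phi> \<in> carrier (dual_space K V)"
  using assms unfolding dual_space_def by simp

lemma dualD:
  assumes "\<phi> \<in> carrier (dual_space K V)"
  shows "\<phi> x \<in> carrier K"
    and "\<lbrakk>x \<in> carrier V; y \<in> carrier V\<rbrakk> \<Longrightarrow> \<phi> (x \<oplus>\<^bsub>V\<^esub> y) = \<phi> x \<oplus>\<^bsub>K\<^esub> \<phi> y"
    and "\<lbrakk>a \<in> carrier K; x \<in> carrier V\<rbrakk> \<Longrightarrow> \<phi> (a \<odot>\<^bsub>V\<^esub> x) = a \<otimes>\<^bsub>K\<^esub> \<phi> x"
    and "x \<notin> carrier V \<Longrightarrow> \<phi> x = \<zero>\<^bsub>K\<^esub>"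
    and "\<phi> \<zero>\<^bsub>V\<^esub> = \<zero>\<^bsub>K\<^esub>"
proof -
  show 1: "\<phi> x \<in> carrier K" for x
    using assms K.zero_closed unfolding dual_space_def by (cases "x \<in> carrier V") auto
  show "\<lbrakk>x \<in> carrier V; y \<in> carrier V\<rbrakk> \<Longrightarrow> \<phi> (x \<oplus>\<^bsub>V\<^esub> y) = \<phi> x \<oplus>\<^bsub>K\<^esub> \<phi> y"
    and 2: "\<lbrakk>a \<in> carrier K; x \<in> carrier V\<rbrakk> \<Longrightarrow> \<phi> (a \<odot>\<^bsub>V\<^esub> x) = a \<otimes>\<^bsub>K\<^esub> \<phi> x"
    and "x \<notin> carrier V \<Longrightarrow> \<phi> x = \<zero>\<^bsub>K\<^esub>" for a x
    using assms unfolding dual_space_def by simp_all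
  show "\<phi> \<zero>\<^bsub>V\<^esub> = \<zero>\<^bsub>K\<^esub>"
    using 2[of "\<zero>\<^bsub>K\<^esub>" "\<zero>\<^bsub>V\<^esub>"] 1[of "\<zero>\<^bsub>V\<^esub>"] smult_l_null[of "\<zero>\<^bsub>V\<^esub>"] by simp
qed

lemma dual_left_vector_space: "left_vector_space (op_ring K) (dual_space K V)"
proof -
  have add: "(\<lambda>x. \<phi> x \<oplus>\<^bsub>K\<^esub> \<psi> x) \<in> carrier (dual_space K V)"
    if "\<phi> \<in> carrier (dual_space K V)" "\<psi> \<in> carrier (dual_space K V)" for \<phi> \<psi>
    using dualD[OF that(1)] dualD[OF that(2)] by (intro dualI) (auto simp: K.a_ac K.r_distr)
  have smult: "(\<lambda>x. \<phi> x \<otimes>\<^bsub>K\<^esub> a) \<in> carrier (dual_space K V)"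
    if "\<phi> \<in> carrier (dual_space K V)" "a \<in> carrier K" for \<phi> a
    using dualD[OF that(1)] that(2) by (intro dualI) (auto simp: K.l_distr K.m_assoc)
  have zero: "(\<lambda>_. \<zero>\<^bsub>K\<^esub>) \<in> carrier (dual_space K V)" by (intro dualI) auto
  have neg: "(\<lambda>x. \<ominus>\<^bsub>K\<^esub> \<phi> x) \<in> carrier (dual_space K V)" if "\<phi> \<in> carrier (dual_space K V)" for \<phi>
    using dualD[OF that] by (intro dualI) (auto simp: K.minus_add K.r_minus)
  have "abelian_group (dual_space K V)"
  proof (rule abelian_groupI)
    show "\<exists>\<psi>\<in>carrier (dual_space K V). \<psi> \<oplus>\<^bsub>dual_space K V\<^esub> \<phi> = \<zero>\<^bsub>dual_space K V\<^esub>"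
      if "\<phi> \<in> carrier (dual_space K V)" for \<phi>
      using neg[OF that] dualD(1)[OF that] by (intro bexI[of _ "\<lambda>x. \<ominus>\<^bsub>K\<^esub> \<phi> x"]) (auto simp: K.l_neg)
  qed (use add zero dualD(1) in \<open>auto simp: K.a_ac\<close>)
  moreover have "left_vector_space_axioms (op_ring K) (dual_space K V)"
    by (rule left_vector_space_axioms.intro)
      (use smult dualD(1) in \<open>auto simp: K.l_distr K.r_distr K.m_assoc\<close>)
  ultimately show ?thesis
    using skew_field_op_ring[OF K.skew_field_axioms] by (intro left_vector_space.intro)
qed

lemma equalizer_submodule:
  assumes "\<phi> \<in> carrier (dual_space K V)" "\<psi> \<in> carrier (dual_space K V)"
  shows "submodule {x \<in> carrier V. \<phi> x = \<psi> x} K V"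
  using dualD[OF assms(1)] dualD[OF assms(2)] by (intro submoduleI) auto

lemma dual_eqI:
  assumes "\<phi> \<in> carrier (dual_space K V)" "\<psi> \<in> carrier (dual_space K V)"
    and "\<And>x. x \<in> carrier V \<Longrightarrow> \<phi> x = \<psi> x"
  shows "\<phi> = \<psi>"
proof
  show "\<phi> x = \<psi> x" for x
    using assms(3)[of x] dualD(4)[OF assms(1), of x] dualD(4)[OF assms(2), of x] by (cases "x \<in> carrier V") auto
qed

lemma kernel_submodule:
  assumes "\<phi> \<in> carrier (dual_space K V)" shows "submodule {x \<in> carrier V. \<phi> x = \<zero>\<^bsub>K\<^esub>} K V"
  using dualD[OF assms] by (intro submoduleI) auto

text \<open>
  The coordinate along \<open>v\<close> in \<open>V = T \<oplus> Kv\<close>.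
\<close>

lemma hyperplane_functional:
  assumes T: "submodule T K V" and v: "v \<in> carrier V" "v \<notin> T"
    and span: "\<And>x. x \<in> carrier V \<Longrightarrow> \<exists>t\<in>T. \<exists>a\<in>carrier K. x = t \<oplus>\<^bsub>V\<^esub> a \<odot>\<^bsub>V\<^esub> v"
  shows "\<exists>\<phi>\<in>carrier (dual_space K V). \<phi> v = \<one>\<^bsub>K\<^esub> \<and> (\<forall>x\<in>T. \<phi> x = \<zero>\<^bsub>K\<^esub>)"
proof -
  note TD = submoduleD[OF T]
  let ?R = "\<lambda>x a. a \<in> carrier K \<and> (\<exists>t\<in>T. x = t \<oplus>\<^bsub>V\<^esub> a \<odot>\<^bsub>V\<^esub> v)"
  have uniq: "a = b" if a: "?R x a" and b: "?R x b" for x a b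
  proof (rule ccontr)
    assume ne: "a \<noteq> b"
    obtain t s where ts: "t \<in> T" "x = t \<oplus>\<^bsub>V\<^esub> a \<odot>\<^bsub>V\<^esub> v" "s \<in> T" "x = s \<oplus>\<^bsub>V\<^esub> b \<odot>\<^bsub>V\<^esub> v"
      using a b by blast
    have ab: "a \<in> carrier K" "b \<in> carrier K" "t \<in> carrier V" "s \<in> carrier V"
      using a b ts TD(1) by auto
    have nz: "a \<oplus>\<^bsub>K\<^esub> \<ominus>\<^bsub>K\<^esub> b \<noteq> \<zero>\<^bsub>K\<^esub>" using ne ab by (metis K.minus_equality K.minus_minus K.add.inv_closed)
    have "(a \<oplus>\<^bsub>K\<^esub> \<ominus>\<^bsub>K\<^esub> b) \<odot>\<^bsub>V\<^esub> v = a \<odot>\<^bsub>V\<^esub> v \<oplus>\<^bsub>V\<^esub> \<ominus>\<^bsub>V\<^esub> (b \<odot>\<^bsub>V\<^esub> v)"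
      using ab v smult_minus_one[of "b \<odot>\<^bsub>V\<^esub> v"] smult_assoc[of "\<ominus>\<^bsub>K\<^esub> \<one>\<^bsub>K\<^esub>" b v]
      by (simp add: smult_l_distr K.l_minus)
    also have "\<dots> = s \<oplus>\<^bsub>V\<^esub> \<ominus>\<^bsub>V\<^esub> t"
    proof -
      have "a \<odot>\<^bsub>V\<^esub> v = x \<oplus>\<^bsub>V\<^esub> \<ominus>\<^bsub>V\<^esub> t"
        unfolding ts(2) using ab v add_minus_cancel[of "a \<odot>\<^bsub>V\<^esub> v" t] by (simp add: V.a_comm)
      also have "\<dots> = (s \<oplus>\<^bsub>V\<^esub> b \<odot>\<^bsub>V\<^esub> v) \<oplus>\<^bsub>V\<^esub> \<ominus>\<^bsub>V\<^esub> t" using ts(4) by simp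
      also have "\<dots> = (s \<oplus>\<^bsub>V\<^esub> \<ominus>\<^bsub>V\<^esub> t) \<oplus>\<^bsub>V\<^esub> b \<odot>\<^bsub>V\<^esub> v" using ab v by (simp add: V.a_ac)
      finally show ?thesis using ab v add_minus_cancel[of "s \<oplus>\<^bsub>V\<^esub> \<ominus>\<^bsub>V\<^esub> t" "b \<odot>\<^bsub>V\<^esub> v"] by simp
    qed
    also have "\<dots> \<in> T" using TD(3)[OF ts(3) submodule_minus[OF T ts(1)]] .
    finally have *: "(a \<oplus>\<^bsub>K\<^esub> \<ominus>\<^bsub>K\<^esub> b) \<odot>\<^bsub>V\<^esub> v \<in> T" .
    obtain c where c: "c \<in> carrier K" "c \<otimes>\<^bsub>K\<^esub> (a \<oplus>\<^bsub>K\<^esub> \<ominus>\<^bsub>K\<^esub> b) = \<one>\<^bsub>K\<^esub>"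
      using skew_inverse nz ab by (metis K.a_closed K.add.inv_closed)
    have "v = c \<odot>\<^bsub>V\<^esub> ((a \<oplus>\<^bsub>K\<^esub> \<ominus>\<^bsub>K\<^esub> b) \<odot>\<^bsub>V\<^esub> v)"
      using smult_assoc[of c "a \<oplus>\<^bsub>K\<^esub> \<ominus>\<^bsub>K\<^esub> b" v] c ab v by simp
    then have "v \<in> T" using TD(4)[OF c(1) *] by simp
    then show False using v by simp
  qed
  have "\<forall>x\<in>carrier V. \<exists>a. ?R x a" using span by blast
  then obtain g where g: "\<And>x. x \<in> carrier V \<Longrightarrow> ?R x (g x)" by metis
  define \<phi> where "\<phi> x = (if x \<in> carrier V then g x else \<zero>\<^bsub>K\<^esub>)" for x
  have \<phi>: "\<phi> x = a" if "?R x a" "x \<in> carrier V" for x a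
    using uniq[OF g[OF that(2)] that(1)] that(2) unfolding \<phi>_def by simp
  have "\<phi> \<in> carrier (dual_space K V)"
  proof (rule dualI)
    show "\<phi> x \<in> carrier K" if "x \<in> carrier V" for x using g[OF that] that unfolding \<phi>_def by simp
    show "\<phi> (x \<oplus>\<^bsub>V\<^esub> y) = \<phi> x \<oplus>\<^bsub>K\<^esub> \<phi> y" if xy: "x \<in> carrier V" "y \<in> carrier V" for x y
    proof (rule \<phi>)
      obtain t s where ts: "t \<in> T" "x = t \<oplus>\<^bsub>V\<^esub> g x \<odot>\<^bsub>V\<^esub> v" "s \<in> T" "y = s \<oplus>\<^bsub>V\<^esub> g y \<odot>\<^bsub>V\<^esub> v"
        using g xy by blast
      have c: "g x \<in> carrier K" "g y \<in> carrier K" "t \<in> carrier V" "s \<in> carrier V"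
        using g xy ts TD(1) by auto
      have "x \<oplus>\<^bsub>V\<^esub> y = (t \<oplus>\<^bsub>V\<^esub> g x \<odot>\<^bsub>V\<^esub> v) \<oplus>\<^bsub>V\<^esub> (s \<oplus>\<^bsub>V\<^esub> g y \<odot>\<^bsub>V\<^esub> v)" using ts by simp
      also have "\<dots> = (t \<oplus>\<^bsub>V\<^esub> s) \<oplus>\<^bsub>V\<^esub> (g x \<oplus>\<^bsub>K\<^esub> g y) \<odot>\<^bsub>V\<^esub> v"
        using c v by (simp add: smult_l_distr V.a_ac)
      finally show "?R (x \<oplus>\<^bsub>V\<^esub> y) (\<phi> x \<oplus>\<^bsub>K\<^esub> \<phi> y)"
        using TD(3)[OF ts(1,3)] c xy unfolding \<phi>_def by auto
    qed (use xy in simp)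
    show "\<phi> (a \<odot>\<^bsub>V\<^esub> x) = a \<otimes>\<^bsub>K\<^esub> \<phi> x" if ax: "a \<in> carrier K" "x \<in> carrier V" for a x
    proof (rule \<phi>)
      obtain t where ts: "t \<in> T" "x = t \<oplus>\<^bsub>V\<^esub> g x \<odot>\<^bsub>V\<^esub> v" using g ax by blast
      have c: "g x \<in> carrier K" "t \<in> carrier V" using g ax ts TD(1) by auto
      have "a \<odot>\<^bsub>V\<^esub> x = a \<odot>\<^bsub>V\<^esub> (t \<oplus>\<^bsub>V\<^esub> g x \<odot>\<^bsub>V\<^esub> v)" using ts by simp
      also have "\<dots> = a \<odot>\<^bsub>V\<^esub> t \<oplus>\<^bsub>V\<^esub> (a \<otimes>\<^bsub>K\<^esub> g x) \<odot>\<^bsub>V\<^esub> v"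
        using c v ax by (simp add: smult_r_distr smult_assoc)
      finally show "?R (a \<odot>\<^bsub>V\<^esub> x) (a \<otimes>\<^bsub>K\<^esub> \<phi> x)"
        using TD(4)[OF ax(1) ts(1)] c ax unfolding \<phi>_def by auto
    qed (use ax in simp)
  qed (simp add: \<phi>_def)
  moreover have "\<phi> v = \<one>\<^bsub>K\<^esub>"
  proof (rule \<phi>)
    have "v = \<zero>\<^bsub>V\<^esub> \<oplus>\<^bsub>V\<^esub> \<one>\<^bsub>K\<^esub> \<odot>\<^bsub>V\<^esub> v" using v by simp
    then show "?R v \<one>\<^bsub>K\<^esub>" using TD(2) by blast
  qed (use v in simp)
  moreover have "\<phi> x = \<zero>\<^bsub>K\<^esub>" if x: "x \<in> T" for x
  proof (rule \<phi>)
    have "x \<in> carrier V" using x TD(1) by blast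
    then have "x = x \<oplus>\<^bsub>V\<^esub> \<zero>\<^bsub>K\<^esub> \<odot>\<^bsub>V\<^esub> v" using v by (simp add: smult_l_null)
    then show "?R x \<zero>\<^bsub>K\<^esub>" using x by blast
    show "x \<in> carrier V" by fact
  qed
  ultimately show ?thesis by blast
qed

end

text \<open>
  A point \<open>x\<close> collinear with all points of a line \<open>N\<close> that does not contain it: a singular plane.
\<close>

locale embedded_polar_space_rank3 = embedded_polar_space K V \<Gamma> \<epsilon>
  for K :: "('k, 'm) ring_scheme" and V :: "('k, 'v, 'w) module_scheme"
    and \<Gamma> :: "'p geometry" and \<epsilon> :: "'p \<Rightarrow> 'v set" +
  assumes has_plane: "\<exists>N\<in>lines \<Gamma>. \<exists>x\<in>points \<Gamma>. x \<notin> N \<and> N \<subseteq> perp \<Gamma> {x}"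
begin

abbreviation tang :: "'p \<Rightarrow> 'v set" where "tang p \<equiv> spn (perp \<Gamma> {p})"

abbreviation Ko :: "'k ring" where "Ko \<equiv> op_ring K"
abbreviation Vd :: "('k, 'v \<Rightarrow> 'k) module" where "Vd \<equiv> dual_space K V"

sublocale D: left_vector_space Ko Vd by (rule dual_left_vector_space)

text \<open>
  The embedding \<open>p \<mapsto> p\<^sup>\<bottom>\<close>, with a hyperplane of \<open>V\<close> represented by the functionals vanishing on it.
\<close>

definition delta :: "'p \<Rightarrow> ('v \<Rightarrow> 'k) set" where
  "delta p = {\<phi> \<in> carrier Vd. \<forall>x\<in>tang p. \<phi> x = \<zero>\<^bsub>K\<^esub>}"

lemmas tang_submodule = spn_submodule[OF perp_points]

lemma tang_iff:
  assumes "p \<in> points \<Gamma>" "q \<in> points \<Gamma>" "v \<in> \<epsilon> q" "v \<noteq> \<zero>\<^bsub>V\<^esub>"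
  shows "v \<in> tang p \<longleftrightarrow> col p q"
proof
  assume "v \<in> tang p"
  then have "q \<in> pts (tang p)" using ptsI[OF tang_submodule assms(2-4)] by simp
  then show "col p q" using tangent_hyperplane[OF assms(1)] unfolding perp_def by simp
next
  assume "col p q"
  then have "q \<in> perp \<Gamma> {p}" using assms unfolding perp_def by simp
  then show "v \<in> tang p" using spn_incl assms(3) by blast
qed

lemma tang_span:
  assumes p: "p \<in> points \<Gamma>" and q: "q \<in> points \<Gamma>" "\<not> col p q"
  shows "carrier V = {h \<oplus>\<^bsub>V\<^esub> n | h n. h \<in> tang p \<and> n \<in> \<epsilon> q}"
proof (rule maximal_subspace_span[OF hyperplane_maximal[OF has_line perp_hyperplane[OF p]] q(1)])
  show "q \<notin> perp \<Gamma> {p}" using q unfolding perp_def by simp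
qed

text \<open>
  A functional that vanishes on the tangent hyperplane of \<open>p\<close> is determined by its value at a single
  vector outside it.
\<close>

lemma delta_generator:
  assumes p: "p \<in> points \<Gamma>" and s: "s \<in> points \<Gamma>" "\<not> col p s" "w \<in> \<epsilon> s" "w \<noteq> \<zero>\<^bsub>V\<^esub>"
  obtains \<phi> where "\<phi> \<in> delta p" "\<phi> w = \<one>\<^bsub>K\<^esub>" "delta p = lin_span Ko Vd {\<phi>}"
proof -
  have wV: "w \<in> carrier V" using point_carrier s by blast
  have wT: "w \<notin> tang p" using tang_iff[OF p s(1,3,4)] s(2) by simp
  have dec: "\<exists>t\<in>tang p. \<exists>a\<in>carrier K. x = t \<oplus>\<^bsub>V\<^esub> a \<odot>\<^bsub>V\<^esub> w" if x: "x \<in> carrier V" for x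
  proof -
    obtain t n where t: "t \<in> tang p" "n \<in> \<epsilon> s" "x = t \<oplus>\<^bsub>V\<^esub> n"
      using x unfolding tang_span[OF p s(1,2)] by blast
    obtain a where "a \<in> carrier K" "n = a \<odot>\<^bsub>V\<^esub> w"
      using t(2) unfolding point_multiples[OF s(1,3,4)] by blast
    then show ?thesis using t by blast
  qed
  obtain \<phi> where \<phi>: "\<phi> \<in> carrier Vd" "\<phi> w = \<one>\<^bsub>K\<^esub>" "\<And>x. x \<in> tang p \<Longrightarrow> \<phi> x = \<zero>\<^bsub>K\<^esub>"
    using hyperplane_functional[OF tang_submodule wV wT dec] by blast
  have "delta p = {a \<odot>\<^bsub>Vd\<^esub> \<phi> | a. a \<in> carrier Ko}"
  proof
    show "delta p \<subseteq> {a \<odot>\<^bsub>Vd\<^esub> \<phi> | a. a \<in> carrier Ko}"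
    proof
      fix \<psi> assume "\<psi> \<in> delta p"
      then have \<psi>: "\<psi> \<in> carrier Vd" "\<And>x. x \<in> tang p \<Longrightarrow> \<psi> x = \<zero>\<^bsub>K\<^esub>" unfolding delta_def by auto
      have a: "\<psi> w \<in> carrier K" using dualD(1)[OF \<psi>(1)] .
      have "\<psi> = \<psi> w \<odot>\<^bsub>Vd\<^esub> \<phi>"
      proof (rule dual_eqI[OF \<psi>(1)])
        show "\<psi> w \<odot>\<^bsub>Vd\<^esub> \<phi> \<in> carrier Vd" using D.smult_closed[OF _ \<phi>(1)] a by simp
        fix x assume "x \<in> carrier V"
        then obtain t c where x: "t \<in> tang p" "c \<in> carrier K" "x = t \<oplus>\<^bsub>V\<^esub> c \<odot>\<^bsub>V\<^esub> w" using dec by blast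
        have "t \<in> carrier V" using submoduleD(1)[OF tang_submodule] x by blast
        then show "\<psi> x = (\<psi> w \<odot>\<^bsub>Vd\<^esub> \<phi>) x"
          using x wV a dualD[OF \<psi>(1)] dualD[OF \<phi>(1)] \<phi>(2,3) \<psi>(2) by simp
      qed
      then show "\<psi> \<in> {a \<odot>\<^bsub>Vd\<^esub> \<phi> | a. a \<in> carrier Ko}" using a by auto
    qed
    show "{a \<odot>\<^bsub>Vd\<^esub> \<phi> | a. a \<in> carrier Ko} \<subseteq> delta p"
    proof
      fix \<psi> assume "\<psi> \<in> {a \<odot>\<^bsub>Vd\<^esub> \<phi> | a. a \<in> carrier Ko}"
      then obtain a where a: "a \<in> carrier Ko" "\<psi> = a \<odot>\<^bsub>Vd\<^esub> \<phi>" by blast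
      have "\<psi> \<in> carrier Vd" unfolding a(2) by (rule D.smult_closed[OF a(1) \<phi>(1)])
      moreover have "\<psi> x = \<zero>\<^bsub>K\<^esub>" if "x \<in> tang p" for x using \<phi>(3)[OF that] a by simp
      ultimately show "\<psi> \<in> delta p" unfolding delta_def by simp
    qed
  qed
  then have "delta p = lin_span Ko Vd {\<phi>}" using D.lin_span_singleton[OF \<phi>(1)] by simp
  moreover have "\<phi> \<in> delta p" using \<phi> unfolding delta_def by simp
  ultimately show thesis using that[of \<phi>] \<phi>(2) by simp
qed

lemma delta_point:
  assumes p: "p \<in> points \<Gamma>" shows "delta p \<in> pg_points Ko Vd"
proof -
  obtain s where s: "s \<in> points \<Gamma>" "\<not> col p s" using noncollinear_point[OF p] .
  obtain w where w: "w \<in> \<epsilon> s" "w \<noteq> \<zero>\<^bsub>V\<^esub>" using nonzero_vector[OF s(1)] .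
  obtain \<phi> where \<phi>: "\<phi> \<in> delta p" "\<phi> w = \<one>\<^bsub>K\<^esub>" "delta p = lin_span Ko Vd {\<phi>}"
    using delta_generator[OF p s w] .
  have "\<one>\<^bsub>K\<^esub> \<noteq> \<zero>\<^bsub>K\<^esub>"
    using w(2) smult_l_null[OF point_carrier[OF s(1) w(1)]] smult_one[OF point_carrier[OF s(1) w(1)]]
    by metis
  then have "\<phi> \<noteq> \<zero>\<^bsub>Vd\<^esub>" using \<phi>(2) by auto
  then show ?thesis using \<phi> unfolding pg_points_def delta_def by blast
qed

lemmas delta_submodule = D.pg_point_submodule[OF delta_point]

lemma delta_zero_iff:
  assumes p: "p \<in> points \<Gamma>" and \<psi>: "\<psi> \<in> delta p" "\<psi> \<noteq> \<zero>\<^bsub>Vd\<^esub>"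
    and q: "q \<in> points \<Gamma>" and x: "x \<in> \<epsilon> q" "x \<noteq> \<zero>\<^bsub>V\<^esub>"
  shows "\<psi> x = \<zero>\<^bsub>K\<^esub> \<longleftrightarrow> col p q"
proof
  assume "col p q"
  then have "x \<in> tang p" using tang_iff[OF p q x] by simp
  then show "\<psi> x = \<zero>\<^bsub>K\<^esub>" using \<psi>(1) unfolding delta_def by simp
next
  assume 0: "\<psi> x = \<zero>\<^bsub>K\<^esub>"
  show "col p q"
  proof (rule ccontr)
    assume "\<not> col p q"
    then obtain \<phi> where \<phi>: "\<phi> \<in> delta p" "\<phi> x = \<one>\<^bsub>K\<^esub>" "delta p = lin_span Ko Vd {\<phi>}"
      using delta_generator[OF p q _ x] by blast
    have \<phi>c: "\<phi> \<in> carrier Vd" using \<phi>(1) unfolding delta_def by simp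
    obtain a where a: "a \<in> carrier K" "\<psi> = a \<odot>\<^bsub>Vd\<^esub> \<phi>"
      using \<psi>(1) unfolding \<phi>(3) D.lin_span_singleton[OF \<phi>c] by auto
    then have "\<psi> x = a" using \<phi>(2) by simp
    then show False using 0 a \<psi>(2) D.smult_l_null[OF \<phi>c] by simp
  qed
qed

lemma delta_inj: "inj_on delta (points \<Gamma>)"
proof (rule inj_onI)
  fix p q assume pq: "p \<in> points \<Gamma>" "q \<in> points \<Gamma>" "delta p = delta q"
  obtain \<psi> where \<psi>: "\<psi> \<in> delta p" "\<psi> \<noteq> \<zero>\<^bsub>Vd\<^esub>"
    using D.pg_pointE[OF delta_point[OF pq(1)]] D.lin_span_incl by (metis insert_subset)
  have "col p r \<longleftrightarrow> col q r" if r: "r \<in> points \<Gamma>" for r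
  proof -
    obtain x where x: "x \<in> \<epsilon> r" "x \<noteq> \<zero>\<^bsub>V\<^esub>" using nonzero_vector[OF r] .
    show ?thesis using delta_zero_iff[OF pq(1) \<psi> r x] delta_zero_iff[OF pq(2) _ \<psi>(2) r x] \<psi>(1) pq(3) by simp
  qed
  then have "perp \<Gamma> {p} = perp \<Gamma> {q}" unfolding perp_def by auto
  then show "p = q" by (rule perp_inj[OF has_line pq(1,2)])
qed

text \<open>
  Inside \<open>p\<^sup>\<bottom>\<close> the set \<open>l\<^sup>\<bottom>\<close> is a hyperplane with connected complement, so \<open>l\<^sup>\<bottom>\<close> together with any
  further point \<open>z\<close> generates \<open>p\<^sup>\<bottom>\<close>. This is the place where rank at least 3 is needed: in rank 2 the
  perp of a point contains no opposite lines.
\<close>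

lemma tang_line_span:
  assumes l: "l \<in> lines \<Gamma>" "p \<in> l" and z: "z \<in> perp \<Gamma> {p}" "z \<notin> perp \<Gamma> l"
  shows "tang p \<subseteq> lin_span K V (spn (perp \<Gamma> l) \<union> \<epsilon> z)"
proof -
  have p: "p \<in> points \<Gamma>" using l line_points by blast
  have zP: "z \<in> points \<Gamma>" using z perp_points by blast
  let ?H = "lin_span K V (spn (perp \<Gamma> l) \<union> \<epsilon> z)"
  have c: "spn (perp \<Gamma> l) \<union> \<epsilon> z \<subseteq> carrier V"
    using submoduleD(1)[OF spn_submodule[OF perp_points]] point_carrier[OF zP] by blast
  note H = lin_span_submodule[OF c]
  obtain N x where N: "N \<in> lines \<Gamma>" "N \<subseteq> perp \<Gamma> {x}" "x \<notin> N" "x \<in> points \<Gamma>" using has_plane by blast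
  obtain L M where LM: "opposite \<Gamma> L M" "L \<subseteq> perp \<Gamma> {p}" "M \<subseteq> perp \<Gamma> {p}"
    using opposite_lines_in_perp[OF N p] .
  have X: "geo_subspace \<Gamma> (perp \<Gamma> {p})" using perp_subspace p by simp
  have Y: "geo_subspace \<Gamma> (perp \<Gamma> l)" using perp_subspace line_points[OF l(1)] .
  have YX: "perp \<Gamma> l \<subseteq> perp \<Gamma> {p}" using l unfolding perp_def by blast
  have meets: "m \<inter> perp \<Gamma> l \<noteq> {}" if m: "m \<in> lines \<Gamma>" "m \<subseteq> perp \<Gamma> {p}" for m
  proof -
    obtain q where q: "q \<in> l" "q \<noteq> p" using other_point[OF l(1)] .
    obtain r where r: "r \<in> m" "col q r" using ex_col[OF _ m(1)] q(1) line_points[OF l(1)] by blast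
    have rP: "r \<in> points \<Gamma>" "col p r" using r m unfolding perp_def by auto
    have "col c r" if "c \<in> l" for c
      using col_all[OF rP(1) l(1) q(1) l(2) q(2) _ _ that] r(2) rP(2) by (simp add: col_sym)
    then have "r \<in> perp \<Gamma> l" using rP unfolding perp_def by simp
    then show ?thesis using r by blast
  qed
  have "perp \<Gamma> l \<subseteq> pts ?H"
    using pts_spn[OF perp_points] pts_mono[of "spn (perp \<Gamma> l)" ?H] lin_span_incl[of "spn (perp \<Gamma> l) \<union> \<epsilon> z"]
    by (meson Un_subset_iff subset_trans)
  moreover have "z \<in> pts ?H"
    using zP lin_span_incl[of "spn (perp \<Gamma> l) \<union> \<epsilon> z"] unfolding pts_def by auto
  ultimately have "perp \<Gamma> {p} \<subseteq> pts ?H"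
    using hyperplane_complement_connected[OF X LM Y YX meets pts_subspace[OF H] _ _ z] by simp
  then show ?thesis unfolding pts_def by (intro spn_least[OF H]) auto
qed

lemma perp_line_tang: "\<lbrakk>l \<in> lines \<Gamma>; p \<in> l\<rbrakk> \<Longrightarrow> spn (perp \<Gamma> l) \<subseteq> tang p"
proof (rule lin_span_mono)
  assume "p \<in> l"
  then have "perp \<Gamma> l \<subseteq> perp \<Gamma> {p}" unfolding perp_def by blast
  then show "(\<Union>p\<in>perp \<Gamma> l. \<epsilon> p) \<subseteq> (\<Union>p\<in>perp \<Gamma> {p}. \<epsilon> p)" by blast
qed

lemma vanish_point:
  assumes \<psi>: "\<psi> \<in> carrier Vd" and q: "q \<in> points \<Gamma>" "t \<in> \<epsilon> q" "t \<noteq> \<zero>\<^bsub>V\<^esub>" and 0: "\<psi> t = \<zero>\<^bsub>K\<^esub>" and x: "x \<in> \<epsilon> q"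
  shows "\<psi> x = \<zero>\<^bsub>K\<^esub>"
proof -
  obtain a where "a \<in> carrier K" "x = a \<odot>\<^bsub>V\<^esub> t" using x unfolding point_multiples[OF q] by blast
  then show ?thesis using dualD(3)[OF \<psi>] point_carrier[OF q(1,2)] 0 by simp
qed

text \<open>
  Let \<open>M\<close> be a line opposite to \<open>l\<close>. Then \<open>V\<close> is spanned by \<open>l\<^sup>\<bottom>\<close> and \<open>M\<close>, so the functionals that vanish
  on \<open>l\<^sup>\<bottom>\<close> are determined by their values on the 2-space spanned by \<open>M\<close>. Each nonzero one vanishes at a
  point \<open>z\<close> of \<open>M\<close>, and therefore belongs to the point of \<open>l\<close> collinear with \<open>z\<close>.
\<close>

lemma delta_line:
  assumes l: "l \<in> lines \<Gamma>" shows "delta ` l \<in> pg_lines Ko Vd"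
proof -
  obtain p q where pq: "p \<in> l" "q \<in> l" "p \<noteq> q" using two_points[OF l] by blast
  have P: "p \<in> points \<Gamma>" "q \<in> points \<Gamma>" using pq line_points[OF l] by auto
  obtain M where M: "opposite \<Gamma> l M" using opposite_line_points[OF l] .
  note Ml = oppositeE(2)[OF M]
  obtain x where x: "x \<in> M" "col p x" using ex_col[OF P(1) Ml] .
  obtain y where y: "y \<in> M" "col q y" using ex_col[OF P(2) Ml] .
  have xyP: "x \<in> points \<Gamma>" "y \<in> points \<Gamma>" using x y line_points[OF Ml] by auto
  have nc: "\<not> col q x" "\<not> col p y"
    using oppositeD[OF opposite_sym[OF M] x(1) pq] oppositeD[OF opposite_sym[OF M] y(1) pq] x y
    by (auto simp: col_sym)
  then have xy: "x \<noteq> y" using x by blast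
  obtain u where u: "u \<in> \<epsilon> x" "u \<noteq> \<zero>\<^bsub>V\<^esub>" using nonzero_vector[OF xyP(1)] .
  obtain w where w: "w \<in> \<epsilon> y" "w \<noteq> \<zero>\<^bsub>V\<^esub>" using nonzero_vector[OF xyP(2)] .
  have uwV: "u \<in> carrier V" "w \<in> carrier V" using point_carrier xyP u w by auto
  have on_perp: "\<psi> v = \<zero>\<^bsub>K\<^esub>" if "\<psi> \<in> delta r" "r \<in> l" "v \<in> spn (perp \<Gamma> l)" for \<psi> r v
    using that perp_line_tang[OF l, of r] unfolding delta_def by blast
  have dc: "\<psi> \<in> carrier Vd" if "\<psi> \<in> delta r" for \<psi> r using that unfolding delta_def by simp
  show ?thesis
  proof (rule D.pg_line_imageI[of l delta p q])
    show "delta r \<in> pg_points Ko Vd" if "r \<in> l" for r using delta_point that line_points[OF l] by blast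
    show "p \<in> l" "q \<in> l" by fact+
    show "delta p \<noteq> delta q" using delta_inj P pq(3) unfolding inj_on_def by blast
    show "delta r \<subseteq> lin_span Ko Vd (delta p \<union> delta q)" if r: "r \<in> l" for r
    proof
      fix \<psi> assume \<psi>: "\<psi> \<in> delta r"
      obtain \<phi>1 where \<phi>1: "\<phi>1 \<in> delta p" "\<phi>1 w = \<one>\<^bsub>K\<^esub>"
        using delta_generator[OF P(1) xyP(2) nc(2) w] by metis
      obtain \<phi>2 where \<phi>2: "\<phi>2 \<in> delta q" "\<phi>2 u = \<one>\<^bsub>K\<^esub>"
        using delta_generator[OF P(2) xyP(1) nc(1) u] by metis
      \<comment> \<open>Match the values of \<open>\<psi>\<close> at the two points of \<open>M\<close>.\<close>
      define \<psi>1 where "\<psi>1 = \<psi> w \<odot>\<^bsub>Vd\<^esub> \<phi>1"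
      define \<psi>2 where "\<psi>2 = \<psi> u \<odot>\<^bsub>Vd\<^esub> \<phi>2"
      have \<psi>k: "\<psi> v \<in> carrier K" for v using dualD(1)[OF dc[OF \<psi>]] .
      have in1: "\<psi>1 \<in> delta p" and in2: "\<psi>2 \<in> delta q"
        unfolding \<psi>1_def \<psi>2_def
        using D.submoduleD(4)[OF delta_submodule[OF P(1)] _ \<phi>1(1)]
          D.submoduleD(4)[OF delta_submodule[OF P(2)] _ \<phi>2(1)] \<psi>k op_ring_simps(1) by metis+
      have sum: "\<psi>1 \<oplus>\<^bsub>Vd\<^esub> \<psi>2 \<in> carrier Vd" using D.V.a_closed dc in1 in2 by blast
      have "submodule {v \<in> carrier V. \<psi> v = (\<psi>1 \<oplus>\<^bsub>Vd\<^esub> \<psi>2) v} K V" (is "submodule ?E K V")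
        by (rule equalizer_submodule[OF dc[OF \<psi>] sum])
      note E = this
      have p0: "\<phi>1 u = \<zero>\<^bsub>K\<^esub>" "\<phi>2 w = \<zero>\<^bsub>K\<^esub>"
        using \<phi>1(1) \<phi>2(1) tang_iff[OF P(1) xyP(1) u] tang_iff[OF P(2) xyP(2) w] x y unfolding delta_def by auto
      have uE: "u \<in> ?E" and wE: "w \<in> ?E"
        using uwV \<psi>k \<phi>1(2) \<phi>2(2) p0 unfolding \<psi>1_def \<psi>2_def by auto
      have "\<epsilon> x \<subseteq> ?E" by (rule pg_point_subset[OF point_image[OF xyP(1)] u E uE])
      moreover have "spn (perp \<Gamma> l) \<subseteq> ?E"
      proof
        fix v assume v: "v \<in> spn (perp \<Gamma> l)"
        then have "v \<in> carrier V" using submoduleD(1)[OF spn_submodule[OF perp_points]] by blast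
        then show "v \<in> ?E" using on_perp[OF \<psi> r v] on_perp[OF in1 pq(1) v] on_perp[OF in2 pq(2) v] by simp
      qed
      ultimately have "lin_span K V (spn (perp \<Gamma> l) \<union> \<epsilon> x) \<subseteq> ?E" by (intro lin_span_least[OF E]) simp
      moreover have "x \<in> perp \<Gamma> {p}" "x \<notin> perp \<Gamma> l"
        using x xyP nc pq unfolding perp_def by auto
      ultimately have "tang p \<subseteq> ?E" using tang_line_span[OF l pq(1)] by blast
      moreover have "\<epsilon> y \<subseteq> ?E" by (rule pg_point_subset[OF point_image[OF xyP(2)] w E wE])
      ultimately have "h \<oplus>\<^bsub>V\<^esub> n \<in> ?E" if "h \<in> tang p" "n \<in> \<epsilon> y" for h n
        using that by (intro submoduleD(3)[OF E]) auto
      then have VE: "v \<in> ?E" if "v \<in> carrier V" for v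
        using that unfolding tang_span[OF P(1) xyP(2) nc(2)] by blast
      have "\<psi> = \<psi>1 \<oplus>\<^bsub>Vd\<^esub> \<psi>2"
      proof (rule dual_eqI[OF dc[OF \<psi>] sum])
        show "\<psi> v = (\<psi>1 \<oplus>\<^bsub>Vd\<^esub> \<psi>2) v" if "v \<in> carrier V" for v using VE[OF that] by simp
      qed
      then show "\<psi> \<in> lin_span Ko Vd (delta p \<union> delta q)"
        unfolding D.lin_span_Un[OF delta_submodule[OF P(1)] delta_submodule[OF P(2)]]
        using in1 in2 by blast
    qed
    show "\<exists>r\<in>l. \<phi>1 \<oplus>\<^bsub>Vd\<^esub> \<phi>2 \<in> delta r" if \<phi>: "\<phi>1 \<in> delta p" "\<phi>2 \<in> delta q" for \<phi>1 \<phi>2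
    proof -
      let ?\<psi> = "\<phi>1 \<oplus>\<^bsub>Vd\<^esub> \<phi>2"
      have \<psi>: "?\<psi> \<in> carrier Vd" using D.V.a_closed dc \<phi> by blast
      obtain z t where z: "z \<in> M" "t \<in> \<epsilon> z" "t \<noteq> \<zero>\<^bsub>V\<^esub>" "?\<psi> t = \<zero>\<^bsub>K\<^esub>"
      proof (cases "?\<psi> u = \<zero>\<^bsub>K\<^esub>")
        case True
        then show ?thesis using that x u by blast
      next
        case False
        have k: "?\<psi> u \<in> carrier K" "?\<psi> w \<in> carrier K" using dualD(1)[OF \<psi>] by blast+
        obtain b where b: "b \<in> carrier K" "b \<otimes>\<^bsub>K\<^esub> ?\<psi> u = \<one>\<^bsub>K\<^esub>" using skew_inverse[OF k(1) False] by metis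
        \<comment> \<open>The combination of \<open>u\<close> and \<open>w\<close> that \<open>?\<psi>\<close> kills.\<close>
        define a where "a = \<ominus>\<^bsub>K\<^esub> (?\<psi> w \<otimes>\<^bsub>K\<^esub> b)"
        have a: "a \<in> carrier K" using k b unfolding a_def by simp
        have au: "a \<odot>\<^bsub>V\<^esub> u \<in> \<epsilon> x" using submoduleD(4)[OF point_submodule[OF xyP(1)] a u(1)] .
        obtain z where z: "z \<in> M" "w \<oplus>\<^bsub>V\<^esub> a \<odot>\<^bsub>V\<^esub> u \<in> \<epsilon> z"
          using line_add[OF Ml y(1) w(1) x(1) au] by blast
        have nz: "w \<oplus>\<^bsub>V\<^esub> a \<odot>\<^bsub>V\<^esub> u \<noteq> \<zero>\<^bsub>V\<^esub>"
          using add_nonzero[OF xyP(2,1) _ w(1) au] w(2) xy by blast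
        have "?\<psi> (w \<oplus>\<^bsub>V\<^esub> a \<odot>\<^bsub>V\<^esub> u) = ?\<psi> w \<oplus>\<^bsub>K\<^esub> a \<otimes>\<^bsub>K\<^esub> ?\<psi> u"
          using dualD(2)[OF \<psi>, of w "a \<odot>\<^bsub>V\<^esub> u"] dualD(3)[OF \<psi> a uwV(1)] uwV a smult_closed by metis
        also have "\<dots> = ?\<psi> w \<oplus>\<^bsub>K\<^esub> \<ominus>\<^bsub>K\<^esub> (?\<psi> w \<otimes>\<^bsub>K\<^esub> (b \<otimes>\<^bsub>K\<^esub> ?\<psi> u))"
          unfolding a_def using k b(1) K.l_minus K.m_assoc K.m_closed by metis
        also have "\<dots> = \<zero>\<^bsub>K\<^esub>" unfolding b(2) using k(2) K.r_one K.r_neg by metis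
        finally show ?thesis using that z nz by blast
      qed
      have zP: "z \<in> points \<Gamma>" using z line_points[OF Ml] by blast
      obtain r where r: "r \<in> l" "col z r" using ex_col[OF zP l] .
      have "z \<in> perp \<Gamma> {r}" using zP r unfolding perp_def by (simp add: col_sym)
      moreover have "z \<notin> perp \<Gamma> l" using oppositeE(4)[OF M z(1)] unfolding perp_def by blast
      ultimately have T: "tang r \<subseteq> lin_span K V (spn (perp \<Gamma> l) \<union> \<epsilon> z)" by (rule tang_line_span[OF l r(1)])
      note N = kernel_submodule[OF \<psi>]
      have "spn (perp \<Gamma> l) \<subseteq> {v \<in> carrier V. ?\<psi> v = \<zero>\<^bsub>K\<^esub>}"
      proof
        fix v assume v: "v \<in> spn (perp \<Gamma> l)"
        then have "v \<in> carrier V" using submoduleD(1)[OF spn_submodule[OF perp_points]] by blast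
        then show "v \<in> {v \<in> carrier V. ?\<psi> v = \<zero>\<^bsub>K\<^esub>}"
          using on_perp[OF \<phi>(1) pq(1) v] on_perp[OF \<phi>(2) pq(2) v] by simp
      qed
      moreover have "\<epsilon> z \<subseteq> {v \<in> carrier V. ?\<psi> v = \<zero>\<^bsub>K\<^esub>}"
        using vanish_point[OF \<psi> zP z(2-4)] point_carrier[OF zP] by blast
      ultimately have "lin_span K V (spn (perp \<Gamma> l) \<union> \<epsilon> z) \<subseteq> {v \<in> carrier V. ?\<psi> v = \<zero>\<^bsub>K\<^esub>}"
        by (intro lin_span_least[OF N]) simp
      then have "?\<psi> \<in> delta r" using T \<psi> unfolding delta_def by blast
      then show ?thesis using r by blast
    qed
  qed
qed

lemma dual_embedding:
  "embedding \<Gamma> Ko (Vd\<lparr>carrier := lin_span Ko Vd (\<Union>p\<in>points \<Gamma>. delta p)\<rparr>) delta"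
  using delta_point delta_inj delta_line line_points by (intro D.embedding_into_span) auto

end

section \<open>The sesquilinear form\<close>

context embedded_polar_space
begin

lemma common_neighbour:
  assumes "p \<in> points \<Gamma>" "q \<in> points \<Gamma>"
  obtains r where "r \<in> points \<Gamma>" "col p r" "col q r" "r \<noteq> p" "r \<noteq> q"
proof -
  obtain l where l: "l \<in> lines \<Gamma>" "p \<in> l" "col p q \<Longrightarrow> q \<in> l"
  proof (cases "col p q \<and> p \<noteq> q")
    case True
    then obtain l where "l \<in> lines \<Gamma>" "p \<in> l" "q \<in> l" using col_lineE[of \<Gamma> p q] by blast
    then show ?thesis using that by blast
  next
    case False
    obtain L where L: "L \<in> lines \<Gamma>" using has_line by blast
    obtain x where x: "x \<in> L" "col p x" using ex_col[OF assms(1) L] .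
    obtain l where "l \<in> lines \<Gamma>" "p \<in> l"
    proof (cases "p = x")
      case True then show ?thesis using that x L by blast
    next
      case False then show ?thesis using that col_lineE[OF x(2)] by blast
    qed
    then show ?thesis using that False by blast
  qed
  show thesis
  proof (cases "col p q")
    case True
    then obtain r where r: "r \<in> l" "r \<noteq> p" "r \<noteq> q" using third_point[OF l(1,2)] l(3) by blast
    then show thesis
      using that[of r] line_points[OF l(1)] col_line[OF l(1,2) r(1)] col_line[OF l(1) l(3)[OF True] r(1)] by blast
  next
    case False
    obtain r where r: "r \<in> l" "col q r" using ex_col[OF assms(2) l(1)] .
    have "r \<noteq> p" "r \<noteq> q" using r False col_line[OF l(1,2) r(1)] by (auto simp: col_sym)
    then show thesis using that[of r] line_points[OF l(1)] col_line[OF l(1,2) r(1)] r by blast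
  qed
qed

text \<open>
  If \<open>G\<close> is proportional to \<open>F\<close> at each embedded vector, then the factor is constant: for collinear
  points it is the same at \<open>v\<close>, \<open>w\<close> and \<open>v + w\<close> because \<open>F v\<close> and \<open>F w\<close> are independent, and any two
  points have a common neighbour.
\<close>

lemma constant_ratio:
  assumes W: "left_vector_space K2 W"
    and F: "\<And>x. x \<in> carrier V \<Longrightarrow> F x \<in> carrier W"
      "\<And>x y. \<lbrakk>x \<in> carrier V; y \<in> carrier V\<rbrakk> \<Longrightarrow> F (x \<oplus>\<^bsub>V\<^esub> y) = F x \<oplus>\<^bsub>W\<^esub> F y"
    and G: "\<And>x y. \<lbrakk>x \<in> carrier V; y \<in> carrier V\<rbrakk> \<Longrightarrow> G (x \<oplus>\<^bsub>V\<^esub> y) = G x \<oplus>\<^bsub>W\<^esub> G y"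
    and ratio: "\<And>p v. \<lbrakk>p \<in> points \<Gamma>; v \<in> \<epsilon> p; v \<noteq> \<zero>\<^bsub>V\<^esub>\<rbrakk> \<Longrightarrow> \<exists>c\<in>carrier K2. G v = c \<odot>\<^bsub>W\<^esub> F v"
    and indep: "\<And>p q v w a b. \<lbrakk>p \<in> points \<Gamma>; q \<in> points \<Gamma>; p \<noteq> q; v \<in> \<epsilon> p; w \<in> \<epsilon> q;
        v \<noteq> \<zero>\<^bsub>V\<^esub>; w \<noteq> \<zero>\<^bsub>V\<^esub>; a \<in> carrier K2; b \<in> carrier K2; a \<odot>\<^bsub>W\<^esub> F v \<oplus>\<^bsub>W\<^esub> b \<odot>\<^bsub>W\<^esub> F w = \<zero>\<^bsub>W\<^esub>\<rbrakk>
        \<Longrightarrow> a = \<zero>\<^bsub>K2\<^esub> \<and> b = \<zero>\<^bsub>K2\<^esub>"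
  shows "\<exists>c\<in>carrier K2. \<forall>p\<in>points \<Gamma>. \<forall>v\<in>\<epsilon> p. v \<noteq> \<zero>\<^bsub>V\<^esub> \<longrightarrow> G v = c \<odot>\<^bsub>W\<^esub> F v"
proof -
  interpret W: left_vector_space K2 W by fact
  have "\<forall>v\<in>cone (points \<Gamma>). \<exists>c\<in>carrier K2. v \<noteq> \<zero>\<^bsub>V\<^esub> \<longrightarrow> G v = c \<odot>\<^bsub>W\<^esub> F v"
    using ratio W.K.one_closed by (metis coneE)
  then obtain c where c0: "\<And>v. v \<in> cone (points \<Gamma>) \<Longrightarrow> c v \<in> carrier K2"
    "\<And>v. v \<in> cone (points \<Gamma>) \<Longrightarrow> v \<noteq> \<zero>\<^bsub>V\<^esub> \<Longrightarrow> G v = c v \<odot>\<^bsub>W\<^esub> F v" by metis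
  have c: "c v \<in> carrier K2" "G v = c v \<odot>\<^bsub>W\<^esub> F v"
    if "p \<in> points \<Gamma>" "v \<in> \<epsilon> p" "v \<noteq> \<zero>\<^bsub>V\<^esub>" for p v
    using c0[of v] coneI[OF that(1,2)] that(3) by auto
  have step: "c v = c w" if pq: "p \<in> points \<Gamma>" "q \<in> points \<Gamma>" "col p q" "p \<noteq> q"
    and v: "v \<in> \<epsilon> p" "v \<noteq> \<zero>\<^bsub>V\<^esub>" and w: "w \<in> \<epsilon> q" "w \<noteq> \<zero>\<^bsub>V\<^esub>" for p q v w
  proof -
    obtain l where l: "l \<in> lines \<Gamma>" "p \<in> l" "q \<in> l" using col_lineE[OF pq(3,4)] .
    let ?u = "v \<oplus>\<^bsub>V\<^esub> w"
    obtain r where r: "r \<in> l" "?u \<in> \<epsilon> r" using line_add[OF l(1,2) v(1) l(3) w(1)] by blast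
    have rP: "r \<in> points \<Gamma>" using r line_points[OF l(1)] by blast
    have nz: "?u \<noteq> \<zero>\<^bsub>V\<^esub>" using add_nonzero[OF pq(1,2,4) v(1) w(1)] v(2) by blast
    note cv = c[OF pq(1) v] and cw = c[OF pq(2) w] and cu = c[OF rP r(2) nz]
    have V: "v \<in> carrier V" "w \<in> carrier V" using point_carrier pq v w by auto
    note Fv = F(1)[OF V(1)] and Fw = F(1)[OF V(2)]
    have neg: "(\<ominus>\<^bsub>K2\<^esub> a) \<odot>\<^bsub>W\<^esub> x = \<ominus>\<^bsub>W\<^esub> (a \<odot>\<^bsub>W\<^esub> x)" if "a \<in> carrier K2" "x \<in> carrier W" for a x
      using that W.smult_minus_one[of "a \<odot>\<^bsub>W\<^esub> x"] W.smult_assoc[of "\<ominus>\<^bsub>K2\<^esub> \<one>\<^bsub>K2\<^esub>" a x] W.K.l_minus by simp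
    have "c ?u \<odot>\<^bsub>W\<^esub> F v \<oplus>\<^bsub>W\<^esub> c ?u \<odot>\<^bsub>W\<^esub> F w = c v \<odot>\<^bsub>W\<^esub> F v \<oplus>\<^bsub>W\<^esub> c w \<odot>\<^bsub>W\<^esub> F w"
      using G[OF V] cu cv cw F(2)[OF V] Fv Fw W.smult_r_distr by simp
    then have eq: "c v \<odot>\<^bsub>W\<^esub> F v \<oplus>\<^bsub>W\<^esub> c w \<odot>\<^bsub>W\<^esub> F w \<oplus>\<^bsub>W\<^esub>
        (\<ominus>\<^bsub>W\<^esub> (c ?u \<odot>\<^bsub>W\<^esub> F v) \<oplus>\<^bsub>W\<^esub> \<ominus>\<^bsub>W\<^esub> (c ?u \<odot>\<^bsub>W\<^esub> F w)) = \<zero>\<^bsub>W\<^esub>"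
      using cu cv cw Fv Fw by (metis W.V.minus_add W.V.r_neg W.V.a_closed W.smult_closed)
    have "(c v \<oplus>\<^bsub>K2\<^esub> \<ominus>\<^bsub>K2\<^esub> c ?u) \<odot>\<^bsub>W\<^esub> F v \<oplus>\<^bsub>W\<^esub> (c w \<oplus>\<^bsub>K2\<^esub> \<ominus>\<^bsub>K2\<^esub> c ?u) \<odot>\<^bsub>W\<^esub> F w = \<zero>\<^bsub>W\<^esub>"
      unfolding eq[symmetric] using cu(1) cv(1) cw(1) Fv Fw
      by (simp add: W.smult_l_distr neg W.V.a_ac)
    then have "c v \<oplus>\<^bsub>K2\<^esub> \<ominus>\<^bsub>K2\<^esub> c ?u = \<zero>\<^bsub>K2\<^esub> \<and> c w \<oplus>\<^bsub>K2\<^esub> \<ominus>\<^bsub>K2\<^esub> c ?u = \<zero>\<^bsub>K2\<^esub>"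
      using cu(1) cv(1) cw(1) by (intro indep[OF pq(1,2,4) v(1) w(1) v(2) w(2)]) simp_all
    then show "c v = c w"
      using cu(1) cv(1) cw(1) by (metis W.K.minus_equality W.K.minus_minus W.K.add.inv_closed)
  qed
  obtain p0 where p0: "p0 \<in> points \<Gamma>" using has_line two_points line_points by blast
  obtain v0 where v0: "v0 \<in> \<epsilon> p0" "v0 \<noteq> \<zero>\<^bsub>V\<^esub>" using nonzero_vector[OF p0] .
  have "G v = c v0 \<odot>\<^bsub>W\<^esub> F v" if v: "p \<in> points \<Gamma>" "v \<in> \<epsilon> p" "v \<noteq> \<zero>\<^bsub>V\<^esub>" for p v
  proof -
    obtain r where r: "r \<in> points \<Gamma>" "col p0 r" "col p r" "r \<noteq> p0" "r \<noteq> p"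
      using common_neighbour[OF p0 v(1)] .
    obtain w where w: "w \<in> \<epsilon> r" "w \<noteq> \<zero>\<^bsub>V\<^esub>" using nonzero_vector[OF r(1)] .
    have "c v0 = c w" using step[OF p0 r(1,2) _ v0 w] r(4) by blast
    moreover have "c v = c w" using step[OF v(1) r(1,3) _ v(2,3) w] r(5) by blast
    ultimately show ?thesis using c(2)[OF v] by simp
  qed
  then show ?thesis using c(1)[OF p0 v0] by blast
qed

text \<open>
  The embedded vectors generate \<open>V\<close> even as an additive group, since they are closed under scalars.
\<close>

lemma cone_additive_generators:
  assumes add: "\<And>x y. \<lbrakk>x \<in> carrier V; y \<in> carrier V; x \<in> Z; y \<in> Z\<rbrakk> \<Longrightarrow> x \<oplus>\<^bsub>V\<^esub> y \<in> Z"
    and zero: "\<zero>\<^bsub>V\<^esub> \<in> Z" and pt: "\<And>p v. \<lbrakk>p \<in> points \<Gamma>; v \<in> \<epsilon> p; v \<noteq> \<zero>\<^bsub>V\<^esub>\<rbrakk> \<Longrightarrow> v \<in> Z"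
  shows "carrier V \<subseteq> Z"
proof -
  let ?Y = "{v \<in> carrier V. \<forall>a\<in>carrier K. a \<odot>\<^bsub>V\<^esub> v \<in> Z}"
  have Y: "submodule ?Y K V"
  proof (rule submoduleI)
    show "x \<oplus>\<^bsub>V\<^esub> y \<in> ?Y" if "x \<in> ?Y" "y \<in> ?Y" for x y
      using that add by (auto simp: smult_r_distr)
    show "a \<odot>\<^bsub>V\<^esub> x \<in> ?Y" if "a \<in> carrier K" "x \<in> ?Y" for a x
      using that by (auto simp: smult_assoc[symmetric])
  qed (use zero in \<open>auto simp: smult_r_null\<close>)
  have "\<epsilon> p \<subseteq> ?Y" if p: "p \<in> points \<Gamma>" for p
  proof
    fix v assume v: "v \<in> \<epsilon> p"
    have "a \<odot>\<^bsub>V\<^esub> v \<in> Z" if "a \<in> carrier K" for a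
      using pt[OF p submoduleD(4)[OF point_submodule[OF p] that v]] zero by (cases "a \<odot>\<^bsub>V\<^esub> v = \<zero>\<^bsub>V\<^esub>") auto
    then show "v \<in> ?Y" using point_carrier[OF p v] by simp
  qed
  then have "carrier V \<subseteq> ?Y" using spn_least[OF Y, of "points \<Gamma>"] spn_points by simp
  then show ?thesis using smult_one K.one_closed by fastforce
qed

end

text \<open>
  Orthogonality is prescribed for representatives of points only. Other vectors may be isotropic
  without representing a point, as happens for orthogonal polar spaces in characteristic 2.
\<close>

locale polar_space_form = embedded_polar_space K V \<Gamma> \<epsilon>
  for K :: "('k, 'm) ring_scheme" (structure) and V :: "('k, 'v, 'w) module_scheme"
    and \<Gamma> :: "'p geometry" and \<epsilon> :: "'p \<Rightarrow> 'v set" +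
  fixes f :: "'v \<Rightarrow> 'v \<Rightarrow> 'k" and \<sigma> :: "'k \<Rightarrow> 'k" and e :: 'k
  assumes \<sigma>_bij: "bij_betw \<sigma> (carrier K) (carrier K)"
    and \<sigma>_add: "\<lbrakk>a \<in> carrier K; b \<in> carrier K\<rbrakk> \<Longrightarrow> \<sigma> (a \<oplus> b) = \<sigma> a \<oplus> \<sigma> b"
    and \<sigma>_mult: "\<lbrakk>a \<in> carrier K; b \<in> carrier K\<rbrakk> \<Longrightarrow> \<sigma> (a \<otimes> b) = \<sigma> b \<otimes> \<sigma> a"
    and f_closed: "\<lbrakk>x \<in> carrier V; y \<in> carrier V\<rbrakk> \<Longrightarrow> f x y \<in> carrier K"
    and f_add_l: "\<lbrakk>x \<in> carrier V; y \<in> carrier V; z \<in> carrier V\<rbrakk> \<Longrightarrow> f (x \<oplus>\<^bsub>V\<^esub> y) z = f x z \<oplus> f y z"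
    and f_add_r: "\<lbrakk>x \<in> carrier V; y \<in> carrier V; z \<in> carrier V\<rbrakk> \<Longrightarrow> f x (y \<oplus>\<^bsub>V\<^esub> z) = f x y \<oplus> f x z"
    and f_smult_l: "\<lbrakk>a \<in> carrier K; x \<in> carrier V; y \<in> carrier V\<rbrakk> \<Longrightarrow> f (a \<odot>\<^bsub>V\<^esub> x) y = a \<otimes> f x y"
    and f_smult_r: "\<lbrakk>a \<in> carrier K; x \<in> carrier V; y \<in> carrier V\<rbrakk> \<Longrightarrow> f x (a \<odot>\<^bsub>V\<^esub> y) = f x y \<otimes> \<sigma> a"
    and e_closed: "e \<in> carrier K"
    and f_swap: "\<lbrakk>x \<in> carrier V; y \<in> carrier V\<rbrakk> \<Longrightarrow> f y x = e \<otimes> \<sigma> (f x y)"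
    and f_perp: "\<lbrakk>p \<in> points \<Gamma>; q \<in> points \<Gamma>; v \<in> \<epsilon> p; w \<in> \<epsilon> q; v \<noteq> \<zero>\<^bsub>V\<^esub>; w \<noteq> \<zero>\<^bsub>V\<^esub>\<rbrakk> \<Longrightarrow>
       f v w = \<zero> \<longleftrightarrow> col p q"

text \<open>
  A morphism from \<open>\<epsilon>\<close> to the dual embedding is a semilinear map \<open>F\<close> from \<open>V\<close> to its dual, and
  \<open>f x y = F y x\<close> is the form; \<open>\<sigma>\<close> is an antiautomorphism because the dual is a space over the opposite
  ring. For the symmetry compare \<open>F w\<close> with the functional \<open>G w\<close> obtained by exchanging the arguments
  of \<open>f\<close>: both vanish on the tangent hyperplane of the point of \<open>w\<close>, so they are proportional,
  and the factor is constant.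
\<close>

theorem (in embedded_polar_space_rank3) form_exists:
  assumes univ: "absolutely_universal \<Gamma> K V \<epsilon>"
  shows "\<exists>f \<sigma> e. polar_space_form K V \<Gamma> \<epsilon> f \<sigma> e"
proof -
  let ?H = "lin_span Ko Vd (\<Union>p\<in>points \<Gamma>. delta p)"
  have plg: "point_line_geometry \<Gamma>" using is_polar unfolding polar_space_def by simp
  have "morphism_to \<Gamma> K V \<epsilon> Ko (Vd\<lparr>carrier := ?H\<rparr>) delta"
    by (rule absolutely_universal_morphism[OF plg has_line univ dual_embedding])
  then obtain \<sigma> F where sl: "semilinear K V Ko (Vd\<lparr>carrier := ?H\<rparr>) \<sigma> F"
    and im: "\<And>p. p \<in> points \<Gamma> \<Longrightarrow> F ` \<epsilon> p = delta p"
    unfolding morphism_to_def by blast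
  have iso: "\<sigma> \<in> ring_iso K Ko" using sl unfolding semilinear_def by simp
  have \<sigma>_bij: "bij_betw \<sigma> (carrier K) (carrier K)" using iso unfolding ring_iso_def by simp
  have \<sigma>c: "\<sigma> a \<in> carrier K" if "a \<in> carrier K" for a using bij_betw_apply[OF \<sigma>_bij that] .
  have \<sigma>_add: "\<sigma> (a \<oplus>\<^bsub>K\<^esub> b) = \<sigma> a \<oplus>\<^bsub>K\<^esub> \<sigma> b" if "a \<in> carrier K" "b \<in> carrier K" for a b
    using ring_iso_memE(3)[OF iso that] by simp
  have \<sigma>_mult: "\<sigma> (a \<otimes>\<^bsub>K\<^esub> b) = \<sigma> b \<otimes>\<^bsub>K\<^esub> \<sigma> a" if "a \<in> carrier K" "b \<in> carrier K" for a b
    using ring_iso_memE(2)[OF iso that] by simp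
  have "(\<Union>p\<in>points \<Gamma>. delta p) \<subseteq> carrier Vd" unfolding delta_def by auto
  then have Hc: "?H \<subseteq> carrier Vd" by (rule D.submoduleD(1)[OF D.lin_span_submodule])
  have Fc: "F x \<in> carrier Vd" if "x \<in> carrier V" for x
    using sl that Hc unfolding semilinear_def by auto
  have F_add: "F (x \<oplus>\<^bsub>V\<^esub> y) = F x \<oplus>\<^bsub>Vd\<^esub> F y" if "x \<in> carrier V" "y \<in> carrier V" for x y
    using sl that unfolding semilinear_def by simp
  have F_smult: "F (a \<odot>\<^bsub>V\<^esub> x) = \<sigma> a \<odot>\<^bsub>Vd\<^esub> F x" if "a \<in> carrier K" "x \<in> carrier V" for a x
    using sl that unfolding semilinear_def by simp
  have Fin: "F v \<in> delta p" if "p \<in> points \<Gamma>" "v \<in> \<epsilon> p" for p v using im[OF that(1)] that(2) by blast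
  have Fnz: "F v \<noteq> \<zero>\<^bsub>Vd\<^esub>" if v: "p \<in> points \<Gamma>" "v \<in> \<epsilon> p" "v \<noteq> \<zero>\<^bsub>V\<^esub>" for p v
  proof
    assume 0: "F v = \<zero>\<^bsub>Vd\<^esub>"
    have "\<phi> = \<zero>\<^bsub>Vd\<^esub>" if \<phi>: "\<phi> \<in> delta p" for \<phi>
    proof -
      obtain w where "w \<in> \<epsilon> p" "\<phi> = F w" using \<phi> unfolding im[OF v(1), symmetric] by blast
      moreover from this obtain a where "a \<in> carrier K" "w = a \<odot>\<^bsub>V\<^esub> v" unfolding point_multiples[OF v] by blast
      ultimately show ?thesis
        using F_smult[OF _ point_carrier[OF v(1,2)]] 0 D.smult_r_null[of "\<sigma> a"] \<sigma>c by simp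
    qed
    then show False using D.pg_pointE[OF delta_point[OF v(1)]] D.lin_span_incl by (metis insert_subset)
  qed
  define f where "f x y = F y x" for x y
  have f_closed: "f x y \<in> carrier K" if "y \<in> carrier V" for x y
    unfolding f_def using dualD(1)[OF Fc[OF that]] .
  have f_add_r: "f x (y \<oplus>\<^bsub>V\<^esub> z) = f x y \<oplus>\<^bsub>K\<^esub> f x z" if "y \<in> carrier V" "z \<in> carrier V" for x y z
    unfolding f_def using F_add that by simp
  have f_smult_r: "f x (a \<odot>\<^bsub>V\<^esub> y) = f x y \<otimes>\<^bsub>K\<^esub> \<sigma> a" if "a \<in> carrier K" "y \<in> carrier V" for a x y
    unfolding f_def using F_smult that by simp
  have f_add_l: "f (x \<oplus>\<^bsub>V\<^esub> y) z = f x z \<oplus>\<^bsub>K\<^esub> f y z"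
    if "x \<in> carrier V" "y \<in> carrier V" "z \<in> carrier V" for x y z
    unfolding f_def using dualD(2)[OF Fc] that by simp
  have f_smult_l: "f (a \<odot>\<^bsub>V\<^esub> x) y = a \<otimes>\<^bsub>K\<^esub> f x y"
    if "a \<in> carrier K" "x \<in> carrier V" "y \<in> carrier V" for a x y
    unfolding f_def using dualD(3)[OF Fc] that by simp
  have f_perp: "f v w = \<zero>\<^bsub>K\<^esub> \<longleftrightarrow> col p q"
    if "p \<in> points \<Gamma>" "q \<in> points \<Gamma>" "v \<in> \<epsilon> p" "w \<in> \<epsilon> q" "v \<noteq> \<zero>\<^bsub>V\<^esub>" "w \<noteq> \<zero>\<^bsub>V\<^esub>" for p q v w
    unfolding f_def
    using delta_zero_iff[OF that(2) Fin[OF that(2,4)] Fnz[OF that(2,4,6)] that(1,3,5)] col_sym[of \<Gamma> p q] by simp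
  let ?\<tau> = "inv_into (carrier K) \<sigma>"
  have \<tau>c: "?\<tau> a \<in> carrier K" if "a \<in> carrier K" for a
    using bij_betw_apply[OF bij_betw_inv_into[OF \<sigma>_bij] that] .
  have \<sigma>\<tau>: "\<sigma> (?\<tau> a) = a" if "a \<in> carrier K" for a
    using bij_betw_inv_into_right[OF \<sigma>_bij that] .
  have \<tau>\<sigma>: "?\<tau> (\<sigma> a) = a" if "a \<in> carrier K" for a
    using bij_betw_inv_into_left[OF \<sigma>_bij that] .
  have \<tau>_add: "?\<tau> (a \<oplus>\<^bsub>K\<^esub> b) = ?\<tau> a \<oplus>\<^bsub>K\<^esub> ?\<tau> b" if "a \<in> carrier K" "b \<in> carrier K" for a b
    using \<tau>\<sigma>[of "?\<tau> a \<oplus>\<^bsub>K\<^esub> ?\<tau> b"] \<sigma>_add[of "?\<tau> a" "?\<tau> b"] \<sigma>\<tau> \<tau>c that by simp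
  have \<tau>_mult: "?\<tau> (a \<otimes>\<^bsub>K\<^esub> \<sigma> b) = b \<otimes>\<^bsub>K\<^esub> ?\<tau> a" if "a \<in> carrier K" "b \<in> carrier K" for a b
    using \<tau>\<sigma>[of "b \<otimes>\<^bsub>K\<^esub> ?\<tau> a"] \<sigma>_mult[of b "?\<tau> a"] \<sigma>\<tau> \<tau>c that by simp
  have \<tau>0: "?\<tau> \<zero>\<^bsub>K\<^esub> = \<zero>\<^bsub>K\<^esub>"
    using \<tau>_add[of "\<zero>\<^bsub>K\<^esub>" "\<zero>\<^bsub>K\<^esub>"] \<tau>c[of "\<zero>\<^bsub>K\<^esub>"] by simp
  define G where "G w = (\<lambda>v. if v \<in> carrier V then ?\<tau> (f w v) else \<zero>\<^bsub>K\<^esub>)" for w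
  have Gc: "G w \<in> carrier Vd" if "w \<in> carrier V" for w
    using that f_closed f_add_r f_smult_r \<tau>c \<tau>_add \<tau>_mult unfolding G_def by (intro dualI) simp_all
  have G_add: "G (x \<oplus>\<^bsub>V\<^esub> y) = G x \<oplus>\<^bsub>Vd\<^esub> G y" if "x \<in> carrier V" "y \<in> carrier V" for x y
    using that f_closed f_add_l \<tau>_add unfolding G_def by (intro ext) simp
  have ratio: "\<exists>c\<in>carrier Ko. G v = c \<odot>\<^bsub>Vd\<^esub> F v" if v: "p \<in> points \<Gamma>" "v \<in> \<epsilon> p" "v \<noteq> \<zero>\<^bsub>V\<^esub>" for p v
  proof -
    have vV: "v \<in> carrier V" using point_carrier v by blast
    have "\<epsilon> r \<subseteq> {x \<in> carrier V. G v x = \<zero>\<^bsub>K\<^esub>}" if r: "r \<in> perp \<Gamma> {p}" for r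
    proof
      fix x assume x: "x \<in> \<epsilon> r"
      have rP: "r \<in> points \<Gamma>" "col p r" using r unfolding perp_def by auto
      have "f v x = \<zero>\<^bsub>K\<^esub>"
      proof (cases "x = \<zero>\<^bsub>V\<^esub>")
        case True
        have "f v \<zero>\<^bsub>V\<^esub> = f v \<zero>\<^bsub>V\<^esub> \<oplus>\<^bsub>K\<^esub> f v \<zero>\<^bsub>V\<^esub>" using f_add_r[of "\<zero>\<^bsub>V\<^esub>" "\<zero>\<^bsub>V\<^esub>" v] by simp
        then show ?thesis using True f_closed[of "\<zero>\<^bsub>V\<^esub>" v] by simp
      next
        case False
        then show ?thesis using f_perp[OF v(1) rP(1) v(2) x v(3)] rP by simp
      qed
      then show "x \<in> {x \<in> carrier V. G v x = \<zero>\<^bsub>K\<^esub>}"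
        using point_carrier[OF rP(1) x] \<tau>0 unfolding G_def by simp
    qed
    then have "tang p \<subseteq> {x \<in> carrier V. G v x = \<zero>\<^bsub>K\<^esub>}" by (rule spn_least[OF kernel_submodule[OF Gc[OF vV]]])
    then have "G v \<in> delta p" using Gc[OF vV] unfolding delta_def by blast
    then show ?thesis
      using D.pg_point_span[OF delta_point[OF v(1)] Fin[OF v(1,2)] Fnz[OF v]]
        D.lin_span_singleton[OF Fc[OF vV]] by auto
  qed
  have indep: "a = \<zero>\<^bsub>Ko\<^esub> \<and> b = \<zero>\<^bsub>Ko\<^esub>"
    if pq: "p \<in> points \<Gamma>" "q \<in> points \<Gamma>" "p \<noteq> q" and vw: "v \<in> \<epsilon> p" "w \<in> \<epsilon> q" "v \<noteq> \<zero>\<^bsub>V\<^esub>" "w \<noteq> \<zero>\<^bsub>V\<^esub>"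
    and ab: "a \<in> carrier Ko" "b \<in> carrier Ko" "a \<odot>\<^bsub>Vd\<^esub> F v \<oplus>\<^bsub>Vd\<^esub> b \<odot>\<^bsub>Vd\<^esub> F w = \<zero>\<^bsub>Vd\<^esub>" for p q v w a b
  proof -
    have VW: "F v \<in> carrier Vd" "F w \<in> carrier Vd" using Fc point_carrier pq vw by auto
    have in1: "a \<odot>\<^bsub>Vd\<^esub> F v \<in> delta p" and in2: "b \<odot>\<^bsub>Vd\<^esub> F w \<in> delta q"
      using D.submoduleD(4)[OF delta_submodule[OF pq(1)] ab(1) Fin[OF pq(1) vw(1)]]
        D.submoduleD(4)[OF delta_submodule[OF pq(2)] ab(2) Fin[OF pq(2) vw(2)]] by blast+
    have c: "a \<odot>\<^bsub>Vd\<^esub> F v \<in> carrier Vd" "b \<odot>\<^bsub>Vd\<^esub> F w \<in> carrier Vd"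
      using D.smult_closed ab VW by blast+
    have "a \<odot>\<^bsub>Vd\<^esub> F v = \<ominus>\<^bsub>Vd\<^esub> (b \<odot>\<^bsub>Vd\<^esub> F w)"
      using D.V.minus_equality[OF ab(3) c(2,1)] by simp
    then have "a \<odot>\<^bsub>Vd\<^esub> F v \<in> delta q" using D.submodule_minus[OF delta_submodule[OF pq(2)] in2] by simp
    then have "a \<odot>\<^bsub>Vd\<^esub> F v = \<zero>\<^bsub>Vd\<^esub>"
      using D.pg_points_eq[OF delta_point[OF pq(1)] delta_point[OF pq(2)] in1] delta_inj pq
      unfolding inj_on_def by blast
    moreover from this have "b \<odot>\<^bsub>Vd\<^esub> F w = \<zero>\<^bsub>Vd\<^esub>" using ab(3) D.V.l_zero[OF c(2)] by metis
    ultimately show ?thesis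
      using D.smult_eq_zero[OF ab(1) VW(1)] D.smult_eq_zero[OF ab(2) VW(2)] Fnz[OF pq(1) vw(1,3)]
        Fnz[OF pq(2) vw(2,4)] by blast
  qed
  have "\<exists>c\<in>carrier Ko. \<forall>p\<in>points \<Gamma>. \<forall>v\<in>\<epsilon> p. v \<noteq> \<zero>\<^bsub>V\<^esub> \<longrightarrow> G v = c \<odot>\<^bsub>Vd\<^esub> F v"
    by (rule constant_ratio[OF dual_left_vector_space]) (rule Fc F_add G_add ratio indep; assumption)+
  then obtain c where c: "c \<in> carrier K"
    "\<And>p w. \<lbrakk>p \<in> points \<Gamma>; w \<in> \<epsilon> p; w \<noteq> \<zero>\<^bsub>V\<^esub>\<rbrakk> \<Longrightarrow> G w = c \<odot>\<^bsub>Vd\<^esub> F w"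
    unfolding op_ring_simps(1) by blast
  let ?e = "\<sigma> c"
  have eK: "?e \<in> carrier K" using \<sigma>c[OF c(1)] .
  let ?Z = "{w \<in> carrier V. \<forall>v\<in>carrier V. f w v = ?e \<otimes>\<^bsub>K\<^esub> \<sigma> (f v w)}"
  have "carrier V \<subseteq> ?Z"
  proof (rule cone_additive_generators)
    show "x \<oplus>\<^bsub>V\<^esub> y \<in> ?Z" if xy: "x \<in> carrier V" "y \<in> carrier V" "x \<in> ?Z" "y \<in> ?Z" for x y
    proof -
      have "f (x \<oplus>\<^bsub>V\<^esub> y) v = ?e \<otimes>\<^bsub>K\<^esub> \<sigma> (f v (x \<oplus>\<^bsub>V\<^esub> y))" if v: "v \<in> carrier V" for v
      proof -
        have "f (x \<oplus>\<^bsub>V\<^esub> y) v = ?e \<otimes>\<^bsub>K\<^esub> \<sigma> (f v x) \<oplus>\<^bsub>K\<^esub> ?e \<otimes>\<^bsub>K\<^esub> \<sigma> (f v y)"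
          using f_add_l[OF xy(1,2) v] xy(3,4) v by simp
        also have "\<dots> = ?e \<otimes>\<^bsub>K\<^esub> \<sigma> (f v x \<oplus>\<^bsub>K\<^esub> f v y)"
          using xy f_closed eK \<sigma>c \<sigma>_add by (simp add: K.r_distr)
        finally show ?thesis using f_add_r[OF xy(1,2)] by simp
      qed
      then show ?thesis using xy by simp
    qed
    show "w \<in> ?Z" if w: "p \<in> points \<Gamma>" "w \<in> \<epsilon> p" "w \<noteq> \<zero>\<^bsub>V\<^esub>" for p w
    proof -
      have wV: "w \<in> carrier V" using point_carrier w by blast
      have "f w v = ?e \<otimes>\<^bsub>K\<^esub> \<sigma> (f v w)" if v: "v \<in> carrier V" for v
      proof -
        have "?\<tau> (f w v) = f v w \<otimes>\<^bsub>K\<^esub> c"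
          using fun_cong[OF c(2)[OF w], of v] v unfolding G_def f_def by simp
        then have "f w v = \<sigma> (f v w \<otimes>\<^bsub>K\<^esub> c)" using \<sigma>\<tau>[OF f_closed[OF v]] by metis
        then show ?thesis using \<sigma>_mult[OF f_closed[OF wV] c(1)] by simp
      qed
      then show ?thesis using wV by simp
    qed
    show "\<zero>\<^bsub>V\<^esub> \<in> ?Z"
    proof -
      have "f \<zero>\<^bsub>V\<^esub> v = \<zero>\<^bsub>K\<^esub>" if "v \<in> carrier V" for v
        using f_smult_l[of "\<zero>\<^bsub>K\<^esub>" "\<zero>\<^bsub>V\<^esub>" v] that smult_l_null[of "\<zero>\<^bsub>V\<^esub>"] f_closed[OF that, of "\<zero>\<^bsub>V\<^esub>"] by simp
      moreover have "f v \<zero>\<^bsub>V\<^esub> = \<zero>\<^bsub>K\<^esub>" for v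
        using f_add_r[of "\<zero>\<^bsub>V\<^esub>" "\<zero>\<^bsub>V\<^esub>" v] f_closed[of "\<zero>\<^bsub>V\<^esub>" v] by simp
      moreover have "\<sigma> \<zero>\<^bsub>K\<^esub> = \<zero>\<^bsub>K\<^esub>" using \<sigma>_add[of "\<zero>\<^bsub>K\<^esub>" "\<zero>\<^bsub>K\<^esub>"] \<sigma>c[of "\<zero>\<^bsub>K\<^esub>"] by simp
      ultimately show ?thesis using eK by simp
    qed
  qed
  then have f_swap: "f y x = ?e \<otimes>\<^bsub>K\<^esub> \<sigma> (f x y)" if "x \<in> carrier V" "y \<in> carrier V" for x y
    using that by blast
  have "polar_space_form_axioms K V \<Gamma> \<epsilon> f \<sigma> ?e"
    by (rule polar_space_form_axioms.intro)
      ((rule \<sigma>_bij eK \<sigma>_add \<sigma>_mult f_closed f_add_l f_add_r f_smult_l f_smult_r f_swap f_perp; assumption?)+)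
  then have "polar_space_form K V \<Gamma> \<epsilon> f \<sigma> ?e"
    using embedded_polar_space_axioms by (intro polar_space_form.intro)
  then show ?thesis by blast
qed

section \<open>Minimality of the form\<close>

context polar_space_form
begin

lemma \<sigma>_closed [simp]: "a \<in> carrier K \<Longrightarrow> \<sigma> a \<in> carrier K"
  by (rule bij_betw_apply[OF \<sigma>_bij])

lemma \<sigma>_zero [simp]: "\<sigma> \<zero> = \<zero>"
  using \<sigma>_add[of "\<zero>" "\<zero>"] \<sigma>_closed[of "\<zero>"] by simp

lemma \<sigma>_one [simp]: "\<sigma> \<one> = \<one>"
proof -
  obtain a where a: "a \<in> carrier K" "\<sigma> a = \<one>"
    using \<sigma>_bij K.one_closed unfolding bij_betw_def by (metis imageE)
  then show ?thesis using \<sigma>_mult[of a "\<one>"] \<sigma>_closed[of "\<one>"] by simp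
qed

lemma \<sigma>_minus: assumes "a \<in> carrier K" shows "\<sigma> (\<ominus> a) = \<ominus> \<sigma> a"
  using \<sigma>_add[of "\<ominus> a" a] assms by (simp add: K.l_neg K.minus_equality)

declare f_closed [simp]
declare e_closed [simp]

lemma f_zero_l [simp]: "x \<in> carrier V \<Longrightarrow> f \<zero>\<^bsub>V\<^esub> x = \<zero>"
  using f_smult_l[of "\<zero>" "\<zero>\<^bsub>V\<^esub>" x] smult_l_null[of "\<zero>\<^bsub>V\<^esub>"] by simp

lemma f_zero_r [simp]: "x \<in> carrier V \<Longrightarrow> f x \<zero>\<^bsub>V\<^esub> = \<zero>"
  using f_swap[of "\<zero>\<^bsub>V\<^esub>" x] by simp

lemma f_minus_l: "\<lbrakk>x \<in> carrier V; y \<in> carrier V\<rbrakk> \<Longrightarrow> f (\<ominus>\<^bsub>V\<^esub> x) y = \<ominus> f x y"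
  using f_smult_l[of "\<ominus> \<one>" x y] smult_minus_one[of x] by (simp add: K.l_minus)

lemma f_minus_r: "\<lbrakk>x \<in> carrier V; y \<in> carrier V\<rbrakk> \<Longrightarrow> f x (\<ominus>\<^bsub>V\<^esub> y) = \<ominus> f x y"
  using f_smult_r[of "\<ominus> \<one>" x y] smult_minus_one[of y] by (simp add: \<sigma>_minus K.r_minus)

lemma f_isotropic:
  assumes "p \<in> points \<Gamma>" "v \<in> \<epsilon> p" shows "f v v = \<zero>"
proof (cases "v = \<zero>\<^bsub>V\<^esub>")
  case False
  then show ?thesis using f_perp[OF assms(1,1,2,2)] by simp
qed simp

lemma f_collinear:
  assumes "p \<in> points \<Gamma>" "q \<in> points \<Gamma>" "v \<in> \<epsilon> p" "w \<in> \<epsilon> q" "col p q" shows "f v w = \<zero>"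
  using f_perp[OF assms(1-4)] assms point_carrier[OF assms(1,3)] point_carrier[OF assms(2,4)]
  by (cases "v = \<zero>\<^bsub>V\<^esub> \<or> w = \<zero>\<^bsub>V\<^esub>") auto

lemma f_one_exists: "\<exists>v\<in>carrier V. \<exists>w\<in>carrier V. f v w = \<one>"
proof -
  obtain p where p: "p \<in> points \<Gamma>" using has_line two_points line_points by blast
  obtain q where q: "q \<in> points \<Gamma>" "\<not> col p q" using noncollinear_point[OF p] .
  obtain v where v: "v \<in> \<epsilon> p" "v \<noteq> \<zero>\<^bsub>V\<^esub>" using nonzero_vector[OF p] .
  obtain w where w: "w \<in> \<epsilon> q" "w \<noteq> \<zero>\<^bsub>V\<^esub>" using nonzero_vector[OF q(1)] .
  have c: "v \<in> carrier V" "w \<in> carrier V" using point_carrier p q v w by auto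
  have "f v w \<noteq> \<zero>" using f_perp[OF p q(1) v(1) w(1) v(2) w(2)] q(2) by simp
  then obtain b where b: "b \<in> carrier K" "b \<otimes> f v w = \<one>" using skew_inverse c f_closed by metis
  then have "f (b \<odot>\<^bsub>V\<^esub> v) w = \<one>" using f_smult_l c by simp
  then show ?thesis using b c smult_closed by blast
qed

text \<open>
  Exchanging the arguments of \<open>f\<close> twice gives \<open>e \<sigma>(\<sigma>(t)) \<sigma>(e) = t\<close> for every value \<open>t\<close> of \<open>f\<close>, and every
  scalar is a value. The case \<open>t = 1\<close> shows that \<open>\<sigma>(e)\<close> is the inverse of \<open>e\<close>.
\<close>

lemma e_\<sigma>\<sigma>: assumes t: "t \<in> carrier K" shows "e \<otimes> \<sigma> (\<sigma> t) = t \<otimes> e"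
proof -
  obtain v w where vw: "v \<in> carrier V" "w \<in> carrier V" "f v w = \<one>" using f_one_exists by blast
  have key: "e \<otimes> (\<sigma> (\<sigma> t) \<otimes> \<sigma> e) = t" if t: "t \<in> carrier K" for t
  proof -
    have "f w (t \<odot>\<^bsub>V\<^esub> v) = e \<otimes> \<sigma> t"
      using f_smult_r[OF t vw(2,1)] f_swap[OF vw(1,2)] vw(3) by simp
    moreover have "f (t \<odot>\<^bsub>V\<^esub> v) w = t" using f_smult_l[OF t vw(1,2)] vw(3) t by simp
    moreover have "f (t \<odot>\<^bsub>V\<^esub> v) w = e \<otimes> \<sigma> (f w (t \<odot>\<^bsub>V\<^esub> v))"
      using f_swap[of w "t \<odot>\<^bsub>V\<^esub> v"] vw t by simp
    ultimately show ?thesis using \<sigma>_mult[of e "\<sigma> t"] t by simp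
  qed
  have 1: "e \<otimes> \<sigma> e = \<one>" using key[of "\<one>"] by simp
  have nz: "\<one> \<noteq> \<zero>"
  proof
    assume "\<one> = \<zero>"
    then have "x = \<zero>\<^bsub>V\<^esub>" if "x \<in> carrier V" for x using smult_one[OF that] smult_l_null[OF that] by simp
    moreover obtain p where "p \<in> points \<Gamma>" using has_line two_points line_points by blast
    ultimately show False using nonzero_vector point_carrier by metis
  qed
  then have "e \<noteq> \<zero>" using 1 by auto
  then obtain b where b: "b \<in> carrier K" "b \<otimes> e = \<one>" using skew_inverse e_closed by metis
  have "\<sigma> e = b \<otimes> (e \<otimes> \<sigma> e)" using b by (simp add: K.m_assoc[symmetric])
  then have 2: "\<sigma> e \<otimes> e = \<one>" using 1 b by simp
  have "t \<otimes> e = e \<otimes> (\<sigma> (\<sigma> t) \<otimes> \<sigma> e) \<otimes> e" using key[OF t] by simp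
  also have "\<dots> = e \<otimes> \<sigma> (\<sigma> t)" using t 2 by (simp add: K.m_assoc)
  finally show ?thesis by simp
qed

lemma e_\<sigma>_sandwich:
  assumes "a \<in> carrier K" "s \<in> carrier K" "b \<in> carrier K"
  shows "e \<otimes> \<sigma> (b \<otimes> (s \<otimes> \<sigma> a)) = a \<otimes> (e \<otimes> \<sigma> s \<otimes> \<sigma> b)"
proof -
  have "e \<otimes> \<sigma> (b \<otimes> (s \<otimes> \<sigma> a)) = (e \<otimes> \<sigma> (\<sigma> a)) \<otimes> (\<sigma> s \<otimes> \<sigma> b)"
    using assms \<sigma>_mult by (simp add: K.m_assoc)
  then show ?thesis using assms e_\<sigma>\<sigma>[of a] by (simp add: K.m_assoc)
qed

text \<open>
  The smallest form parameter, in the terminology of pseudoquadratic forms.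
\<close>

definition Lam :: "'k set" where
  "Lam = {t \<oplus> \<ominus> (e \<otimes> \<sigma> t) | t. t \<in> carrier K}"

lemma LamI: "t \<in> carrier K \<Longrightarrow> t \<oplus> \<ominus> (e \<otimes> \<sigma> t) \<in> Lam"
  unfolding Lam_def by blast

lemma LamE:
  assumes "s \<in> Lam" obtains t where "t \<in> carrier K" "s = t \<oplus> \<ominus> (e \<otimes> \<sigma> t)"
  using assms unfolding Lam_def by blast

lemma Lam_closed: "s \<in> Lam \<Longrightarrow> s \<in> carrier K"
  by (auto elim: LamE)

lemma Lam_zero: "\<zero> \<in> Lam"
  using LamI[of "\<zero>"] by simp

lemma Lam_add: assumes "s \<in> Lam" "t \<in> Lam" shows "s \<oplus> t \<in> Lam"
proof -
  obtain a b where *: "a \<in> carrier K" "b \<in> carrier K" "s = a \<oplus> \<ominus> (e \<otimes> \<sigma> a)"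
    "t = b \<oplus> \<ominus> (e \<otimes> \<sigma> b)" using assms by (meson LamE)
  then have "s \<oplus> t = (a \<oplus> b) \<oplus> \<ominus> (e \<otimes> \<sigma> (a \<oplus> b))"
    by (simp add: \<sigma>_add K.r_distr K.minus_add K.a_ac)
  then show ?thesis using LamI[of "a \<oplus> b"] * by simp
qed

lemma Lam_minus: assumes "s \<in> Lam" shows "\<ominus> s \<in> Lam"
proof -
  obtain a where *: "a \<in> carrier K" "s = a \<oplus> \<ominus> (e \<otimes> \<sigma> a)" using assms by (meson LamE)
  then have "\<ominus> s = \<ominus> a \<oplus> \<ominus> (e \<otimes> \<sigma> (\<ominus> a))"
    by (simp add: \<sigma>_minus K.r_minus K.minus_add)
  then show ?thesis using LamI[of "\<ominus> a"] * by simp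
qed

lemma Lam_sandwich:
  assumes "s \<in> Lam" "a \<in> carrier K" shows "a \<otimes> (s \<otimes> \<sigma> a) \<in> Lam"
proof -
  obtain t where t: "t \<in> carrier K" "s = t \<oplus> \<ominus> (e \<otimes> \<sigma> t)" using assms by (meson LamE)
  have "a \<otimes> (s \<otimes> \<sigma> a) =
      a \<otimes> (t \<otimes> \<sigma> a) \<oplus> \<ominus> (a \<otimes> (e \<otimes> \<sigma> t \<otimes> \<sigma> a))"
    using t assms(2) by (simp add: K.l_distr K.r_distr K.l_minus K.r_minus)
  also have "\<dots> = a \<otimes> (t \<otimes> \<sigma> a) \<oplus> \<ominus> (e \<otimes> \<sigma> (a \<otimes> (t \<otimes> \<sigma> a)))"
    using e_\<sigma>_sandwich[of a t a] t assms(2) by simp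
  finally show ?thesis using LamI[of "a \<otimes> (t \<otimes> \<sigma> a)"] t assms(2) by simp
qed

lemma cancel_add:
  "\<lbrakk>x \<in> carrier K; y \<in> carrier K; z \<in> carrier K\<rbrakk> \<Longrightarrow> (x \<oplus> z) \<oplus> (y \<oplus> \<ominus> z) = x \<oplus> y"
proof -
  assume *: "x \<in> carrier K" "y \<in> carrier K" "z \<in> carrier K"
  then have "(x \<oplus> z) \<oplus> (y \<oplus> \<ominus> z) = (x \<oplus> y) \<oplus> (z \<oplus> \<ominus> z)"
    by (simp add: K.a_ac del: K.r_neg)
  then show ?thesis using * by (simp add: K.r_neg)
qed

text \<open>
  A canonical representative of the coset of \<open>s\<close> modulo \<open>Lam\<close>; working with representatives instead of
  cosets keeps the second component of the extension below in \<open>K\<close>.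
\<close>

definition rep :: "'k \<Rightarrow> 'k" where
  "rep s = (SOME t. t \<in> carrier K \<and> (\<exists>d\<in>Lam. s = t \<oplus> d))"

lemma rep_props:
  assumes "s \<in> carrier K" shows "rep s \<in> carrier K" "\<exists>d\<in>Lam. s = rep s \<oplus> d"
proof -
  have "s \<in> carrier K \<and> (\<exists>d\<in>Lam. s = s \<oplus> d)" using assms Lam_zero by (intro conjI bexI[of _ "\<zero>"]) auto
  then have "rep s \<in> carrier K \<and> (\<exists>d\<in>Lam. s = rep s \<oplus> d)" unfolding rep_def by (rule someI)
  then show "rep s \<in> carrier K" "\<exists>d\<in>Lam. s = rep s \<oplus> d" by blast+
qed

declare rep_props(1) [simp]

lemma rep_add_Lam:
  assumes s: "s \<in> carrier K" and m: "m \<in> Lam" shows "rep (s \<oplus> m) = rep s"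
proof -
  have "(\<exists>d\<in>Lam. s \<oplus> m = t \<oplus> d) \<longleftrightarrow> (\<exists>d\<in>Lam. s = t \<oplus> d)" if t: "t \<in> carrier K" for t
  proof
    assume "\<exists>d\<in>Lam. s \<oplus> m = t \<oplus> d"
    then obtain n where n: "n \<in> Lam" "s \<oplus> m = t \<oplus> n" by blast
    have "s = (s \<oplus> m) \<oplus> \<ominus> m" using s Lam_closed[OF m] by (simp add: K.a_assoc K.r_neg)
    also have "\<dots> = t \<oplus> (n \<oplus> \<ominus> m)" unfolding n(2) using t Lam_closed[OF n(1)] Lam_closed[OF m] by (simp add: K.a_assoc)
    finally show "\<exists>d\<in>Lam. s = t \<oplus> d" using Lam_add[OF n(1) Lam_minus[OF m]] by blast
  next
    assume "\<exists>d\<in>Lam. s = t \<oplus> d"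
    then obtain n where n: "n \<in> Lam" "s = t \<oplus> n" by blast
    then have "s \<oplus> m = t \<oplus> (n \<oplus> m)" using t Lam_closed[OF n(1)] Lam_closed[OF m] by (simp add: K.a_assoc)
    then show "\<exists>d\<in>Lam. s \<oplus> m = t \<oplus> d" using Lam_add[OF n(1) m] by blast
  qed
  then show ?thesis unfolding rep_def by (intro arg_cong[where f = Eps] ext conj_cong) auto
qed

lemma rep_eq_imp:
  assumes "s \<in> carrier K" "rep s = rep \<zero>" shows "s \<in> Lam"
proof -
  obtain m n where m: "m \<in> Lam" "s = rep s \<oplus> m" and n: "n \<in> Lam" "\<zero> = rep \<zero> \<oplus> n"
    using rep_props(2)[OF assms(1)] rep_props(2)[OF K.zero_closed] by blast
  have "rep \<zero> = \<ominus> n" using K.minus_equality[OF n(2)[symmetric]] Lam_closed[OF n(1)] by simp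
  then have "s = \<ominus> n \<oplus> m" using m(2) assms(2) by simp
  then show ?thesis using Lam_add[OF Lam_minus[OF n(1)] m(1)] by simp
qed

lemma rep_rep [simp]: assumes "s \<in> carrier K" shows "rep (rep s) = rep s"
proof -
  obtain m where "m \<in> Lam" "s = rep s \<oplus> m" using rep_props(2)[OF assms] by blast
  then show ?thesis using rep_add_Lam[of "rep s" m] assms by simp
qed

lemma rep_add_l [simp]:
  assumes s: "s \<in> carrier K" "t \<in> carrier K" shows "rep (rep s \<oplus> t) = rep (s \<oplus> t)"
proof -
  obtain m where m: "m \<in> Lam" "s = rep s \<oplus> m" using rep_props(2)[OF s(1)] by blast
  have "(rep s \<oplus> m) \<oplus> t = (rep s \<oplus> t) \<oplus> m"
    using s Lam_closed[OF m(1)] by (simp add: K.a_ac)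
  then have "s \<oplus> t = (rep s \<oplus> t) \<oplus> m" using m(2) by simp
  then show ?thesis using rep_add_Lam[of "rep s \<oplus> t" m] m(1) s by simp
qed

lemma rep_add_r [simp]:
  "\<lbrakk>s \<in> carrier K; t \<in> carrier K\<rbrakk> \<Longrightarrow> rep (t \<oplus> rep s) = rep (t \<oplus> s)"
  using rep_add_l[of s t] by (simp add: K.a_comm del: rep_add_l)

lemma rep_sandwich [simp]:
  assumes s: "s \<in> carrier K" "a \<in> carrier K"
  shows "rep (a \<otimes> (rep s \<otimes> \<sigma> a)) = rep (a \<otimes> (s \<otimes> \<sigma> a))"
proof -
  obtain m where m: "m \<in> Lam" "s = rep s \<oplus> m" using rep_props(2)[OF s(1)] by blast
  have "a \<otimes> ((rep s \<oplus> m) \<otimes> \<sigma> a) =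
      a \<otimes> (rep s \<otimes> \<sigma> a) \<oplus> a \<otimes> (m \<otimes> \<sigma> a)"
    using s Lam_closed[OF m(1)] by (simp add: K.l_distr K.r_distr)
  then have "a \<otimes> (s \<otimes> \<sigma> a) =
      a \<otimes> (rep s \<otimes> \<sigma> a) \<oplus> a \<otimes> (m \<otimes> \<sigma> a)" using m(2) by simp
  then show ?thesis using rep_add_Lam[of "a \<otimes> (rep s \<otimes> \<sigma> a)"] Lam_sandwich[OF m(1) s(2)] s by simp
qed

lemma rep_swap:
  assumes "x \<in> carrier V" "y \<in> carrier V" "s \<in> carrier K"
  shows "rep (s \<oplus> f x y) = rep (s \<oplus> f y x)"
proof -
  have "s \<oplus> f x y = (s \<oplus> f y x) \<oplus> (f x y \<oplus> \<ominus> f y x)"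
    using cancel_add[of s "f x y" "f y x"] assms by simp
  moreover have "f x y \<oplus> \<ominus> f y x \<in> Lam"
    using LamI[of "f x y"] f_swap[OF assms(1,2)] assms by simp
  ultimately show ?thesis using rep_add_Lam[of "s \<oplus> f y x"] assms by simp
qed

definition tr :: "'k \<Rightarrow> 'k" where "tr s = s \<oplus> e \<otimes> \<sigma> s"

lemma tr_add: "\<lbrakk>s \<in> carrier K; t \<in> carrier K\<rbrakk> \<Longrightarrow> tr (s \<oplus> t) = tr s \<oplus> tr t"
  unfolding tr_def by (simp add: \<sigma>_add K.r_distr K.a_ac)

lemma tr_closed [simp]: "s \<in> carrier K \<Longrightarrow> tr s \<in> carrier K"
  unfolding tr_def by simp

lemma tr_minus: "s \<in> carrier K \<Longrightarrow> tr (\<ominus> s) = \<ominus> tr s"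
  unfolding tr_def by (simp add: \<sigma>_minus K.r_minus K.minus_add)

lemma tr_e\<sigma>: assumes "s \<in> carrier K" shows "tr (e \<otimes> \<sigma> s) = tr s"
proof -
  have "e \<otimes> \<sigma> (e \<otimes> \<sigma> s) = s"
  proof -
    obtain v w where vw: "v \<in> carrier V" "w \<in> carrier V" "f v w = \<one>" using f_one_exists by blast
    have "f (s \<odot>\<^bsub>V\<^esub> v) w = s" using f_smult_l[OF assms vw(1,2)] vw(3) assms by simp
    moreover have "f (s \<odot>\<^bsub>V\<^esub> v) w = e \<otimes> \<sigma> (f w (s \<odot>\<^bsub>V\<^esub> v))"
      "f w (s \<odot>\<^bsub>V\<^esub> v) = e \<otimes> \<sigma> (f (s \<odot>\<^bsub>V\<^esub> v) w)"
      using vw assms by (auto intro: f_swap)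
    ultimately show ?thesis by metis
  qed
  then show ?thesis unfolding tr_def using assms by (simp add: K.a_comm)
qed

lemma tr_Lam: assumes "m \<in> Lam" shows "tr m = \<zero>"
proof -
  obtain t where "t \<in> carrier K" "m = t \<oplus> \<ominus> (e \<otimes> \<sigma> t)" using assms by (meson LamE)
  then show ?thesis by (simp add: tr_add tr_minus tr_e\<sigma> K.r_neg)
qed

lemma tr_rep [simp]: assumes "s \<in> carrier K" shows "tr (rep s) = tr s"
proof -
  obtain m where m: "m \<in> Lam" "s = rep s \<oplus> m" using rep_props(2)[OF assms] by blast
  have "tr (rep s \<oplus> m) = tr (rep s)" using tr_add[of "rep s" m] tr_Lam[OF m(1)] Lam_closed[OF m(1)] assms by simp
  then show ?thesis using m(2) by simp
qed

lemma tr_f: "\<lbrakk>x \<in> carrier V; y \<in> carrier V\<rbrakk> \<Longrightarrow> tr (f x y) = f x y \<oplus> f y x"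
  unfolding tr_def using f_swap[of x y] by simp

lemma tr_sandwich:
  assumes "s \<in> carrier K" "a \<in> carrier K"
  shows "tr (a \<otimes> (s \<otimes> \<sigma> a)) = a \<otimes> (tr s \<otimes> \<sigma> a)"
  unfolding tr_def using e_\<sigma>_sandwich[of a s a] assms by (simp add: K.l_distr K.r_distr)

text \<open>
  The extension of \<open>V\<close> with cocycle \<open>f\<close>, which is symmetric modulo \<open>Lam\<close>. Its elements \<open>(v, s)\<close> are
  restricted by \<open>tr s = f v v\<close>, a condition that does not depend on the representative \<open>s\<close>.
\<close>

definition ext_space :: "('k, 'v \<times> 'k) module" where
  "ext_space = \<lparr>carrier = {(v, s). v \<in> carrier V \<and> s \<in> carrier K \<and> rep s = s \<and> tr s = f v v},
     mult = undefined, one = undefined, zero = (\<zero>\<^bsub>V\<^esub>, rep \<zero>),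
     add = \<lambda>(v, s) (w, t). (v \<oplus>\<^bsub>V\<^esub> w, rep (s \<oplus> t \<oplus> f v w)),
     smult = \<lambda>a (v, s). (a \<odot>\<^bsub>V\<^esub> v, rep (a \<otimes> (s \<otimes> \<sigma> a)))\<rparr>"

lemma ext_simps [simp]:
  "(v, s) \<in> carrier ext_space \<longleftrightarrow> v \<in> carrier V \<and> s \<in> carrier K \<and> rep s = s \<and> tr s = f v v"
  "\<zero>\<^bsub>ext_space\<^esub> = (\<zero>\<^bsub>V\<^esub>, rep \<zero>)"
  "(v, s) \<oplus>\<^bsub>ext_space\<^esub> (w, t) = (v \<oplus>\<^bsub>V\<^esub> w, rep (s \<oplus> t \<oplus> f v w))"
  "a \<odot>\<^bsub>ext_space\<^esub> (v, s) = (a \<odot>\<^bsub>V\<^esub> v, rep (a \<otimes> (s \<otimes> \<sigma> a)))"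
  unfolding ext_space_def by simp_all

lemma tr_zero [simp]: "tr \<zero> = \<zero>"
  unfolding tr_def by simp

lemma ext_abelian_group: "abelian_group ext_space"
proof (rule abelian_groupI)
  fix x y z assume "x \<in> carrier ext_space" "y \<in> carrier ext_space" "z \<in> carrier ext_space"
  then obtain v s w t u r where *: "x = (v, s)" "y = (w, t)" "z = (u, r)"
    "v \<in> carrier V" "s \<in> carrier K" "w \<in> carrier V" "t \<in> carrier K" "u \<in> carrier V" "r \<in> carrier K"
    by (cases x, cases y, cases z) auto
  have "rep (rep (s \<oplus> t \<oplus> f v w) \<oplus> (r \<oplus> f (v \<oplus>\<^bsub>V\<^esub> w) u)) =
      rep (s \<oplus> t \<oplus> f v w \<oplus> (r \<oplus> f (v \<oplus>\<^bsub>V\<^esub> w) u))"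
    using * by (intro rep_add_l) simp_all
  also have "\<dots> = rep ((s \<oplus> f v (w \<oplus>\<^bsub>V\<^esub> u)) \<oplus> (t \<oplus> r \<oplus> f w u))"
    using * by (simp add: f_add_l f_add_r K.a_ac)
  also have "\<dots> = rep ((s \<oplus> f v (w \<oplus>\<^bsub>V\<^esub> u)) \<oplus> rep (t \<oplus> r \<oplus> f w u))"
    using * by (intro rep_add_r[symmetric]) simp_all
  finally show "x \<oplus>\<^bsub>ext_space\<^esub> y \<oplus>\<^bsub>ext_space\<^esub> z = x \<oplus>\<^bsub>ext_space\<^esub> (y \<oplus>\<^bsub>ext_space\<^esub> z)"
    using * by (simp add: K.a_ac V.a_ac del: rep_add_l rep_add_r)
next
  fix x y assume "x \<in> carrier ext_space" "y \<in> carrier ext_space"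
  then obtain v s w t where *: "x = (v, s)" "y = (w, t)"
    "v \<in> carrier V" "s \<in> carrier K" "w \<in> carrier V" "t \<in> carrier K" "tr s = f v v" "tr t = f w w"
    by (cases x, cases y) auto
  show "x \<oplus>\<^bsub>ext_space\<^esub> y \<in> carrier ext_space"
    using * by (simp add: tr_add tr_f f_add_l f_add_r K.a_ac)
  show "x \<oplus>\<^bsub>ext_space\<^esub> y = y \<oplus>\<^bsub>ext_space\<^esub> x"
    using * rep_swap[of v w "s \<oplus> t"] by (simp add: K.a_comm[of s t] V.a_comm)
next
  show "\<zero>\<^bsub>ext_space\<^esub> \<in> carrier ext_space" by simp
next
  fix x assume "x \<in> carrier ext_space"
  then obtain v s where *: "x = (v, s)" "v \<in> carrier V" "s \<in> carrier K" "tr s = f v v" "rep s = s"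
    by (cases x) auto
  show "\<zero>\<^bsub>ext_space\<^esub> \<oplus>\<^bsub>ext_space\<^esub> x = x" using * by simp
  let ?y = "(\<ominus>\<^bsub>V\<^esub> v, rep (\<ominus> s \<oplus> f v v))"
  have "tr (\<ominus> s \<oplus> f v v) = f v v \<oplus> (f v v \<oplus> \<ominus> f v v)"
    using * by (simp add: tr_add tr_minus tr_f K.a_ac del: K.r_neg)
  then have "tr (\<ominus> s \<oplus> f v v) = f v v" using * by (simp add: K.r_neg)
  then have 1: "?y \<in> carrier ext_space" using * by (simp add: f_minus_l f_minus_r)
  have "rep (rep (\<ominus> s \<oplus> f v v) \<oplus> (s \<oplus> \<ominus> f v v)) =
      rep (\<ominus> s \<oplus> f v v \<oplus> (s \<oplus> \<ominus> f v v))"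
    using * by (intro rep_add_l) simp_all
  also have "\<dots> = rep \<zero>" using * cancel_add[of "\<ominus> s" s "f v v"] by (simp add: K.l_neg)
  finally have "?y \<oplus>\<^bsub>ext_space\<^esub> x = \<zero>\<^bsub>ext_space\<^esub>"
    using * by (simp add: f_minus_l V.l_neg K.a_assoc del: rep_add_l)
  then show "\<exists>y\<in>carrier ext_space. y \<oplus>\<^bsub>ext_space\<^esub> x = \<zero>\<^bsub>ext_space\<^esub>" using 1 by blast
qed

text \<open>
  The map \<open>a \<mapsto> a s \<sigma>(a)\<close> is not additive. Its deviation \<open>a s \<sigma>(b) + b s \<sigma>(a)\<close> agrees modulo \<open>Lam\<close> with
  \<open>a (s + e \<sigma>(s)) \<sigma>(b)\<close>, and the condition \<open>tr s = f v v\<close> makes this the value of the cocycle.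
\<close>

lemma ext_left_vector_space: "left_vector_space K ext_space"
proof (intro left_vector_space.intro ext_abelian_group K.skew_field_axioms left_vector_space_axioms.intro)
  fix a x assume "a \<in> carrier K" "x \<in> carrier ext_space"
  then obtain v s where *: "x = (v, s)" "v \<in> carrier V" "s \<in> carrier K" "tr s = f v v" "a \<in> carrier K"
    by (cases x) auto
  then show "a \<odot>\<^bsub>ext_space\<^esub> x \<in> carrier ext_space"
    by (simp add: tr_sandwich f_smult_l f_smult_r K.m_assoc)
next
  fix a b x assume "a \<in> carrier K" "b \<in> carrier K" "x \<in> carrier ext_space"
  then obtain v s where *: "x = (v, s)" "v \<in> carrier V" "s \<in> carrier K" "tr s = f v v"
    "a \<in> carrier K" "b \<in> carrier K" by (cases x) auto
  let ?A = "a \<otimes> (e \<otimes> \<sigma> s \<otimes> \<sigma> b)" and ?t = "b \<otimes> (s \<otimes> \<sigma> a)"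
  let ?aa = "a \<otimes> (s \<otimes> \<sigma> a)" and ?bb = "b \<otimes> (s \<otimes> \<sigma> b)" and ?ab = "a \<otimes> (s \<otimes> \<sigma> b)"
  have fvv: "f v v = s \<oplus> e \<otimes> \<sigma> s" using *(4) unfolding tr_def by simp
  have fab: "f (a \<odot>\<^bsub>V\<^esub> v) (b \<odot>\<^bsub>V\<^esub> v) = ?ab \<oplus> ?A"
    using * by (simp add: f_smult_l f_smult_r fvv K.l_distr K.r_distr K.m_assoc)
  have "rep (rep ?aa \<oplus> (rep ?bb \<oplus> (?ab \<oplus> ?A))) = rep (?aa \<oplus> (rep ?bb \<oplus> (?ab \<oplus> ?A)))"
    using * by (intro rep_add_l) simp_all
  also have "\<dots> = rep (rep ?bb \<oplus> (?aa \<oplus> (?ab \<oplus> ?A)))"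
    using * by (simp add: K.a_lcomm del: rep_add_l rep_add_r)
  also have "\<dots> = rep (?bb \<oplus> (?aa \<oplus> (?ab \<oplus> ?A)))"
    using * by (intro rep_add_l) simp_all
  also have "\<dots> = rep (?bb \<oplus> ?aa \<oplus> ?ab \<oplus> ?A)" using * by (simp add: K.a_assoc)
  also have "\<dots> = rep ((?bb \<oplus> ?aa \<oplus> ?ab \<oplus> ?A) \<oplus> (?t \<oplus> \<ominus> ?A))"
    using * LamI[of ?t] e_\<sigma>_sandwich[of a s b] by (intro rep_add_Lam[symmetric]) simp_all
  also have "\<dots> = rep (?bb \<oplus> ?aa \<oplus> ?ab \<oplus> ?t)"
    using * by (subst cancel_add) simp_all
  also have "\<dots> = rep ((a \<oplus> b) \<otimes> (s \<otimes> \<sigma> (a \<oplus> b)))"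
    using * by (simp add: \<sigma>_add K.l_distr K.r_distr K.a_ac)
  finally show "(a \<oplus> b) \<odot>\<^bsub>ext_space\<^esub> x = a \<odot>\<^bsub>ext_space\<^esub> x \<oplus>\<^bsub>ext_space\<^esub> b \<odot>\<^bsub>ext_space\<^esub> x"
    using * by (simp add: fab smult_l_distr K.a_assoc del: rep_add_l rep_add_r)
next
  fix a x y assume "a \<in> carrier K" "x \<in> carrier ext_space" "y \<in> carrier ext_space"
  then obtain v s w t where *: "x = (v, s)" "y = (w, t)" "a \<in> carrier K"
    "v \<in> carrier V" "s \<in> carrier K" "w \<in> carrier V" "t \<in> carrier K" by (cases x, cases y) auto
  let ?s = "a \<otimes> (s \<otimes> \<sigma> a)" and ?t = "a \<otimes> (t \<otimes> \<sigma> a)" and ?f = "a \<otimes> (f v w \<otimes> \<sigma> a)"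
  have "rep (rep ?s \<oplus> (rep ?t \<oplus> ?f)) = rep (?s \<oplus> (rep ?t \<oplus> ?f))"
    using * by (intro rep_add_l) simp_all
  also have "\<dots> = rep (rep ?t \<oplus> (?s \<oplus> ?f))" using * by (simp add: K.a_lcomm del: rep_add_l rep_add_r)
  also have "\<dots> = rep (?t \<oplus> (?s \<oplus> ?f))" using * by (intro rep_add_l) simp_all
  also have "\<dots> = rep (a \<otimes> ((s \<oplus> t \<oplus> f v w) \<otimes> \<sigma> a))"
    using * by (simp add: K.l_distr K.r_distr K.a_ac)
  finally show "a \<odot>\<^bsub>ext_space\<^esub> (x \<oplus>\<^bsub>ext_space\<^esub> y) = a \<odot>\<^bsub>ext_space\<^esub> x \<oplus>\<^bsub>ext_space\<^esub> a \<odot>\<^bsub>ext_space\<^esub> y"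
    using * by (simp add: f_smult_l f_smult_r smult_r_distr K.a_assoc K.m_assoc del: rep_add_l rep_add_r)
next
  fix a b x assume "a \<in> carrier K" "b \<in> carrier K" "x \<in> carrier ext_space"
  then obtain v s where *: "x = (v, s)" "v \<in> carrier V" "s \<in> carrier K" "a \<in> carrier K" "b \<in> carrier K"
    by (cases x) auto
  then show "(a \<otimes> b) \<odot>\<^bsub>ext_space\<^esub> x = a \<odot>\<^bsub>ext_space\<^esub> (b \<odot>\<^bsub>ext_space\<^esub> x)"
    by (simp add: \<sigma>_mult smult_assoc K.m_assoc)
next
  fix x assume "x \<in> carrier ext_space"
  then show "\<one> \<odot>\<^bsub>ext_space\<^esub> x = x" by (cases x) simp
qed

definition lift :: "'p \<Rightarrow> ('v \<times> 'k) set" where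
  "lift p = {(v, rep \<zero>) | v. v \<in> \<epsilon> p}"

lemma lift_iff: "(v, s) \<in> lift p \<longleftrightarrow> v \<in> \<epsilon> p \<and> s = rep \<zero>"
  unfolding lift_def by auto

lemma lift_carrier: "p \<in> points \<Gamma> \<Longrightarrow> lift p \<subseteq> carrier ext_space"
  unfolding lift_def using point_carrier f_isotropic by auto

lemma lift_point:
  assumes p: "p \<in> points \<Gamma>" shows "lift p \<in> pg_points K ext_space"
proof -
  interpret E: left_vector_space K ext_space by (rule ext_left_vector_space)
  obtain v where v: "v \<in> \<epsilon> p" "v \<noteq> \<zero>\<^bsub>V\<^esub>" using nonzero_vector[OF p] .
  have vE: "(v, rep \<zero>) \<in> carrier ext_space" using lift_carrier[OF p] v lift_iff by blast
  have a: "a \<odot>\<^bsub>ext_space\<^esub> (v, rep \<zero>) = (a \<odot>\<^bsub>V\<^esub> v, rep \<zero>)" if "a \<in> carrier K" for a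
    using that by simp
  have "lift p = {a \<odot>\<^bsub>ext_space\<^esub> (v, rep \<zero>) | a. a \<in> carrier K}"
  proof
    show "lift p \<subseteq> {a \<odot>\<^bsub>ext_space\<^esub> (v, rep \<zero>) | a. a \<in> carrier K}"
    proof
      fix x assume "x \<in> lift p"
      then obtain b where "b \<in> carrier K" "x = (b \<odot>\<^bsub>V\<^esub> v, rep \<zero>)"
        unfolding lift_def point_multiples[OF p v] by blast
      then show "x \<in> {a \<odot>\<^bsub>ext_space\<^esub> (v, rep \<zero>) | a. a \<in> carrier K}" using a[of b] by (intro CollectI exI[of _ b]) metis
    qed
    show "{a \<odot>\<^bsub>ext_space\<^esub> (v, rep \<zero>) | a. a \<in> carrier K} \<subseteq> lift p"
      using a lift_iff submoduleD(4)[OF point_submodule[OF p] _ v(1)] by auto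
  qed
  then have "lift p = lin_span K ext_space {(v, rep \<zero>)}" using E.lin_span_singleton[OF vE] by simp
  then show ?thesis using vE v(2) unfolding pg_points_def by (auto simp del: ext_simps(1)) 
qed

lemma lift_add:
  assumes "p \<in> points \<Gamma>" "q \<in> points \<Gamma>" "v \<in> \<epsilon> p" "w \<in> \<epsilon> q" "col p q"
  shows "(v, rep \<zero>) \<oplus>\<^bsub>ext_space\<^esub> (w, rep \<zero>) = (v \<oplus>\<^bsub>V\<^esub> w, rep \<zero>)"
  using f_collinear[OF assms] by simp

lemma lift_inj: "inj_on lift (points \<Gamma>)"
proof (rule inj_onI)
  fix p q assume pq: "p \<in> points \<Gamma>" "q \<in> points \<Gamma>" "lift p = lift q"
  obtain v where v: "v \<in> \<epsilon> p" "v \<noteq> \<zero>\<^bsub>V\<^esub>" using nonzero_vector[OF pq(1)] .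
  then have "v \<in> \<epsilon> q" using pq(3) lift_iff by blast
  then show "p = q" using vector_point_unique[OF pq(1,2) v(1) _ v(2)] by simp
qed

lemma lift_line:
  assumes l: "l \<in> lines \<Gamma>" shows "lift ` l \<in> pg_lines K ext_space"
proof -
  interpret E: left_vector_space K ext_space by (rule ext_left_vector_space)
  obtain p q where pq: "p \<in> l" "q \<in> l" "p \<noteq> q" using two_points[OF l] by blast
  have P: "r \<in> points \<Gamma>" if "r \<in> l" for r using that line_points[OF l] by blast
  have add: "(v, rep \<zero>) \<oplus>\<^bsub>ext_space\<^esub> (w, rep \<zero>) = (v \<oplus>\<^bsub>V\<^esub> w, rep \<zero>)"
    if "v \<in> \<epsilon> p" "w \<in> \<epsilon> q" for v w
    using lift_add[OF P[OF pq(1)] P[OF pq(2)] that col_line[OF l pq(1,2)]] .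
  show ?thesis
  proof (rule E.pg_line_imageI[of l lift p q])
    show "lift r \<in> pg_points K ext_space" if "r \<in> l" for r by (rule lift_point[OF P[OF that]])
    show "p \<in> l" "q \<in> l" by fact+
    show "lift p \<noteq> lift q" using lift_inj P pq unfolding inj_on_def by blast
    show "lift r \<subseteq> lin_span K ext_space (lift p \<union> lift q)" if r: "r \<in> l" for r
    proof
      fix x assume "x \<in> lift r"
      then obtain u where u: "u \<in> \<epsilon> r" "x = (u, rep \<zero>)" unfolding lift_def by blast
      obtain v w where vw: "v \<in> \<epsilon> p" "w \<in> \<epsilon> q" "u = v \<oplus>\<^bsub>V\<^esub> w" using line_split[OF l pq r u(1)] .
      have "x = (v, rep \<zero>) \<oplus>\<^bsub>ext_space\<^esub> (w, rep \<zero>)" unfolding add[OF vw(1,2)] using u vw by simp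
      then show "x \<in> lin_span K ext_space (lift p \<union> lift q)"
        unfolding E.lin_span_Un[OF E.pg_point_submodule[OF lift_point[OF P[OF pq(1)]]]
            E.pg_point_submodule[OF lift_point[OF P[OF pq(2)]]]]
        using vw lift_iff by blast
    qed
    show "\<exists>r\<in>l. x \<oplus>\<^bsub>ext_space\<^esub> y \<in> lift r" if "x \<in> lift p" "y \<in> lift q" for x y
    proof -
      obtain v w where vw: "v \<in> \<epsilon> p" "w \<in> \<epsilon> q" "x = (v, rep \<zero>)" "y = (w, rep \<zero>)"
        using \<open>x \<in> lift p\<close> \<open>y \<in> lift q\<close> unfolding lift_def by blast
      obtain r where "r \<in> l" "v \<oplus>\<^bsub>V\<^esub> w \<in> \<epsilon> r" using line_add[OF l pq(1) vw(1) pq(2) vw(2)] by blast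
      then show ?thesis unfolding vw(3,4) add[OF vw(1,2)] using lift_iff by blast
    qed
  qed
qed

text \<open>
  By universality there is a semilinear map \<open>g\<close> from \<open>V\<close> to the extension that carries \<open>\<epsilon>\<close> to the lifted
  embedding. Followed by the projection to \<open>V\<close> it fixes all embedded points, so it is multiplication
  by a constant \<open>c\<close> on embedded vectors. Thus \<open>g x = (c x, 0)\<close> and \<open>g y = (c y, 0)\<close>, and their sum has
  second component \<open>f (c x) (c y)\<close>; but if \<open>x + y\<close> is an embedded vector, this component is zero modulo
  \<open>Lam\<close>.
\<close>

theorem hyperbolic_value:
  assumes univ: "absolutely_universal \<Gamma> K V \<epsilon>"
    and P: "p \<in> points \<Gamma>" "q \<in> points \<Gamma>" "r \<in> points \<Gamma>"
    and x: "x \<in> \<epsilon> p" and y: "y \<in> \<epsilon> q" and xy: "x \<oplus>\<^bsub>V\<^esub> y \<in> \<epsilon> r"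
  shows "f x y \<in> Lam"
proof -
  interpret E: left_vector_space K ext_space by (rule ext_left_vector_space)
  let ?H = "lin_span K ext_space (\<Union>p\<in>points \<Gamma>. lift p)"
  have plg: "point_line_geometry \<Gamma>" using is_polar unfolding polar_space_def by simp
  have "embedding \<Gamma> K (ext_space\<lparr>carrier := ?H\<rparr>) lift"
    using lift_point lift_inj lift_line line_points by (intro E.embedding_into_span) auto
  then have "morphism_to \<Gamma> K V \<epsilon> K (ext_space\<lparr>carrier := ?H\<rparr>) lift"
    by (rule absolutely_universal_morphism[OF plg has_line univ])
  then obtain \<tau> g where sl: "semilinear K V K (ext_space\<lparr>carrier := ?H\<rparr>) \<tau> g"
    and im: "\<And>p. p \<in> points \<Gamma> \<Longrightarrow> g ` \<epsilon> p = lift p"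
    unfolding morphism_to_def by blast
  have "(\<Union>p\<in>points \<Gamma>. lift p) \<subseteq> carrier ext_space" using lift_carrier by blast
  then have Hc: "?H \<subseteq> carrier ext_space" by (rule E.submoduleD(1)[OF E.lin_span_submodule])
  have gc: "g v \<in> carrier ext_space" if "v \<in> carrier V" for v
    using sl that Hc unfolding semilinear_def by auto
  have g_add: "g (v \<oplus>\<^bsub>V\<^esub> w) = g v \<oplus>\<^bsub>ext_space\<^esub> g w" if "v \<in> carrier V" "w \<in> carrier V" for v w
    using sl that unfolding semilinear_def by simp
  have gin: "g v \<in> lift p" if "p \<in> points \<Gamma>" "v \<in> \<epsilon> p" for p v using im[OF that(1)] that(2) by blast
  \<comment> \<open>\<open>h\<close> is \<open>g\<close> followed by the projection to \<open>V\<close>.\<close>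
  define h where "h v = fst (g v)" for v
  have h_add: "h (v \<oplus>\<^bsub>V\<^esub> w) = h v \<oplus>\<^bsub>V\<^esub> h w" if "v \<in> carrier V" "w \<in> carrier V" for v w
    unfolding h_def g_add[OF that] by (cases "g v", cases "g w") simp
  have hin: "h v \<in> \<epsilon> p" if "p \<in> points \<Gamma>" "v \<in> \<epsilon> p" for p v
    using gin[OF that] unfolding h_def lift_def by auto
  have g_eq: "g v = (h v, rep \<zero>)" if "p \<in> points \<Gamma>" "v \<in> \<epsilon> p" for p v
    using gin[OF that] unfolding h_def lift_def by auto
  have ratio: "\<exists>c\<in>carrier K. h v = c \<odot>\<^bsub>V\<^esub> v" if v: "p \<in> points \<Gamma>" "v \<in> \<epsilon> p" "v \<noteq> \<zero>\<^bsub>V\<^esub>" for p v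
    using hin[OF v(1,2)] unfolding point_multiples[OF v] by blast
  have indep: "a = \<zero> \<and> b = \<zero>"
    if pq: "p \<in> points \<Gamma>" "q \<in> points \<Gamma>" "p \<noteq> q" and vw: "v \<in> \<epsilon> p" "w \<in> \<epsilon> q" "v \<noteq> \<zero>\<^bsub>V\<^esub>" "w \<noteq> \<zero>\<^bsub>V\<^esub>"
    and ab: "a \<in> carrier K" "b \<in> carrier K" "a \<odot>\<^bsub>V\<^esub> v \<oplus>\<^bsub>V\<^esub> b \<odot>\<^bsub>V\<^esub> w = \<zero>\<^bsub>V\<^esub>" for p q v w a b
  proof -
    have "a \<odot>\<^bsub>V\<^esub> v \<in> \<epsilon> p" "b \<odot>\<^bsub>V\<^esub> w \<in> \<epsilon> q"
      using submoduleD(4)[OF point_submodule[OF pq(1)] ab(1) vw(1)]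
        submoduleD(4)[OF point_submodule[OF pq(2)] ab(2) vw(2)] by auto
    then have "a \<odot>\<^bsub>V\<^esub> v = \<zero>\<^bsub>V\<^esub>" "b \<odot>\<^bsub>V\<^esub> w = \<zero>\<^bsub>V\<^esub>" using add_nonzero[OF pq] ab(3) by blast+
    then show ?thesis
      using smult_eq_zero[OF ab(1) point_carrier[OF pq(1) vw(1)]]
        smult_eq_zero[OF ab(2) point_carrier[OF pq(2) vw(2)]] vw by blast
  qed
  have "\<exists>c\<in>carrier K. \<forall>p\<in>points \<Gamma>. \<forall>v\<in>\<epsilon> p. v \<noteq> \<zero>\<^bsub>V\<^esub> \<longrightarrow> h v = c \<odot>\<^bsub>V\<^esub> v"
    by (rule constant_ratio[OF left_vector_space_axioms, where F = "\<lambda>x. x" and G = h])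
      ((rule h_add ratio indep refl; assumption) | assumption | rule refl)+
  then obtain c where c: "c \<in> carrier K"
    "\<And>p v. \<lbrakk>p \<in> points \<Gamma>; v \<in> \<epsilon> p; v \<noteq> \<zero>\<^bsub>V\<^esub>\<rbrakk> \<Longrightarrow> h v = c \<odot>\<^bsub>V\<^esub> v" by blast
  have "c \<noteq> \<zero>"
  proof
    assume "c = \<zero>"
    obtain v where v: "v \<in> \<epsilon> p" "v \<noteq> \<zero>\<^bsub>V\<^esub>" using nonzero_vector[OF P(1)] .
    have h0: "h \<zero>\<^bsub>V\<^esub> = \<zero>\<^bsub>V\<^esub>"
      using h_add[of "\<zero>\<^bsub>V\<^esub>" "\<zero>\<^bsub>V\<^esub>"] point_carrier[OF P(1) hin[OF P(1) submoduleD(2)[OF point_submodule[OF P(1)]]]]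
      by simp
    have "(v, rep \<zero>) \<in> g ` \<epsilon> p" using v lift_iff im[OF P(1)] by simp
    then obtain w where w: "w \<in> \<epsilon> p" "g w = (v, rep \<zero>)" by auto
    then have "h w = v" unfolding h_def by simp
    moreover have "h w = \<zero>\<^bsub>V\<^esub>"
      using c(2)[OF P(1) w(1)] \<open>c = \<zero>\<close> smult_l_null[OF point_carrier[OF P(1) w(1)]] h0 by (cases "w = \<zero>\<^bsub>V\<^esub>") auto
    ultimately show False using v by simp
  qed
  then obtain d where d: "d \<in> carrier K" "d \<otimes> c = \<one>" using skew_inverse[OF c(1)] by metis
  have V: "x \<in> carrier V" "y \<in> carrier V" using point_carrier P x y by auto
  show ?thesis
  proof (cases "x = \<zero>\<^bsub>V\<^esub> \<or> y = \<zero>\<^bsub>V\<^esub> ")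
    case True
    then show ?thesis using V Lam_zero by auto
  next
    case False
    have "g (x \<oplus>\<^bsub>V\<^esub> y) = g x \<oplus>\<^bsub>ext_space\<^esub> g y" by (rule g_add[OF V])
    then have "rep \<zero> = rep (rep \<zero> \<oplus> rep \<zero> \<oplus> f (h x) (h y))"
      unfolding g_eq[OF P(1) x] g_eq[OF P(2) y] g_eq[OF P(3) xy] by simp
    also have "\<dots> = rep (f (h x) (h y))"
      using point_carrier[OF P(1) hin[OF P(1) x]] point_carrier[OF P(2) hin[OF P(2) y]] by (simp add: K.a_assoc)
    also have "f (h x) (h y) = c \<otimes> (f x y \<otimes> \<sigma> c)"
      using c(2)[OF P(1) x] c(2)[OF P(2) y] False c(1) V by (simp add: f_smult_l f_smult_r K.m_assoc)
    finally have "c \<otimes> (f x y \<otimes> \<sigma> c) \<in> Lam" using rep_eq_imp c(1) V by simp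
    then have "d \<otimes> ((c \<otimes> (f x y \<otimes> \<sigma> c)) \<otimes> \<sigma> d) \<in> Lam" using Lam_sandwich d(1) by blast
    moreover have "d \<otimes> ((c \<otimes> (f x y \<otimes> \<sigma> c)) \<otimes> \<sigma> d) = (d \<otimes> c) \<otimes> (f x y \<otimes> \<sigma> (d \<otimes> c))"
      using c(1) d(1) V \<sigma>_mult by (simp add: K.m_assoc)
    ultimately show ?thesis using d V by simp
  qed
qed

end

section \<open>Subspaces and their spans\<close>

context embedded_polar_space
begin

lemma spn_line:
  assumes l: "l \<in> lines \<Gamma>" and v: "v \<in> spn l" shows "\<exists>p\<in>l. v \<in> \<epsilon> p"
proof -
  obtain a b where ab: "a \<in> l" "b \<in> l" "a \<noteq> b" using two_points[OF l] by blast
  have P: "a \<in> points \<Gamma>" "b \<in> points \<Gamma>" using ab line_points[OF l] by auto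
  have "\<epsilon> a \<union> \<epsilon> b \<subseteq> carrier V" using point_carrier P by blast
  then have "submodule (lin_span K V (\<epsilon> a \<union> \<epsilon> b)) K V" by (rule lin_span_submodule)
  then have "spn l \<subseteq> lin_span K V (\<epsilon> a \<union> \<epsilon> b)"
    using line_span[OF l ab] by (intro spn_least) auto
  then obtain x y where "x \<in> \<epsilon> a" "y \<in> \<epsilon> b" "v = x \<oplus>\<^bsub>V\<^esub> y"
    using v unfolding lin_span_Un[OF point_submodule[OF P(1)] point_submodule[OF P(2)]] by blast
  then show ?thesis using line_add[OF l ab(1) _ ab(2)] by blast
qed

text \<open>
  A combination of two vectors of the line in which the components along \<open>s\<close> cancel.
\<close>

lemma line_meets_codimension_one:
  assumes H: "submodule H K V" and s: "s \<in> points \<Gamma>" and l: "l \<in> lines \<Gamma>"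
    and dec: "\<And>r. r \<in> l \<Longrightarrow> \<epsilon> r \<subseteq> {h \<oplus>\<^bsub>V\<^esub> n | h n. h \<in> H \<and> n \<in> \<epsilon> s}"
  shows "l \<inter> pts H \<noteq> {}"
proof -
  obtain p q where pq: "p \<in> l" "q \<in> l" "p \<noteq> q" using two_points[OF l] by blast
  have P: "p \<in> points \<Gamma>" "q \<in> points \<Gamma>" using pq line_points[OF l] by auto
  obtain v where v: "v \<in> \<epsilon> p" "v \<noteq> \<zero>\<^bsub>V\<^esub>" using nonzero_vector[OF P(1)] .
  obtain w where w: "w \<in> \<epsilon> q" "w \<noteq> \<zero>\<^bsub>V\<^esub>" using nonzero_vector[OF P(2)] .
  obtain h n where hn: "h \<in> H" "n \<in> \<epsilon> s" "v = h \<oplus>\<^bsub>V\<^esub> n" using dec[OF pq(1)] v(1) by blast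
  obtain h' n' where hn': "h' \<in> H" "n' \<in> \<epsilon> s" "w = h' \<oplus>\<^bsub>V\<^esub> n'" using dec[OF pq(2)] w(1) by blast
  have c: "h \<in> carrier V" "h' \<in> carrier V" "n \<in> carrier V" "n' \<in> carrier V" "v \<in> carrier V" "w \<in> carrier V"
    using hn hn' submoduleD(1)[OF H] point_carrier[OF s] point_carrier[OF P(1) v(1)] point_carrier[OF P(2) w(1)]
    by auto
  show ?thesis
  proof (cases "n = \<zero>\<^bsub>V\<^esub>")
    case True
    then have "v \<in> H" using hn c by simp
    then show ?thesis using ptsI[OF H P(1) v] pq(1) by blast
  next
    case False
    then obtain a where a: "a \<in> carrier K" "n' = a \<odot>\<^bsub>V\<^esub> n"
      using hn'(2) unfolding point_multiples[OF s hn(2) False] by blast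
    \<comment> \<open>The component of \<open>w\<close> along \<open>s\<close> is \<open>a\<close> times that of \<open>v\<close>.\<close>
    let ?m = "\<ominus>\<^bsub>V\<^esub> (a \<odot>\<^bsub>V\<^esub> v)"
    have m: "?m \<in> \<epsilon> p"
      using submodule_minus[OF point_submodule[OF P(1)] submoduleD(4)[OF point_submodule[OF P(1)] a(1) v(1)]] .
    have "w \<oplus>\<^bsub>V\<^esub> ?m = (h' \<oplus>\<^bsub>V\<^esub> n') \<oplus>\<^bsub>V\<^esub> (\<ominus>\<^bsub>V\<^esub> (a \<odot>\<^bsub>V\<^esub> h) \<oplus>\<^bsub>V\<^esub> \<ominus>\<^bsub>V\<^esub> n')"
      using hn(3) hn'(3) a c by (simp add: smult_r_distr V.minus_add)
    also have "\<dots> = ((h' \<oplus>\<^bsub>V\<^esub> \<ominus>\<^bsub>V\<^esub> (a \<odot>\<^bsub>V\<^esub> h)) \<oplus>\<^bsub>V\<^esub> n') \<oplus>\<^bsub>V\<^esub> \<ominus>\<^bsub>V\<^esub> n'"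
      using a c by (simp add: V.a_ac del: V.r_neg)
    also have "\<dots> = h' \<oplus>\<^bsub>V\<^esub> \<ominus>\<^bsub>V\<^esub> (a \<odot>\<^bsub>V\<^esub> h)" using a c by (intro add_minus_cancel) simp_all
    also have "\<dots> \<in> H"
      using submoduleD(3)[OF H hn'(1) submodule_minus[OF H submoduleD(4)[OF H a(1) hn(1)]]] .
    finally have inH: "w \<oplus>\<^bsub>V\<^esub> ?m \<in> H" .
    obtain r where r: "r \<in> l" "w \<oplus>\<^bsub>V\<^esub> ?m \<in> \<epsilon> r" using line_add[OF l pq(2) w(1) pq(1) m] by blast
    have "w \<oplus>\<^bsub>V\<^esub> ?m \<noteq> \<zero>\<^bsub>V\<^esub>" using add_nonzero[OF P(2,1) _ w(1) m] w(2) pq(3) by blast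
    then have "r \<in> pts H" using ptsI[OF H _ r(2) _ inH] r(1) line_points[OF l] by blast
    then show ?thesis using r(1) by blast
  qed
qed

lemma maximal_nonspanning_hyperplane:
  assumes S: "maximal_subspace \<Gamma> S" and span: "spn S \<noteq> carrier V"
  shows "geo_hyperplane \<Gamma> S"
proof -
  have proper: "proper_subspace \<Gamma> S" using S unfolding maximal_subspace_def by simp
  then have SP: "S \<subseteq> points \<Gamma>" unfolding proper_subspace_def using geo_subspace_points by blast
  have pts: "pts (spn S) = S"
    by (rule maximal_subspaceD[OF S pts_proper[OF spn_submodule[OF SP] span] pts_spn[OF SP]])
  have "l \<inter> S \<noteq> {}" if l: "l \<in> lines \<Gamma>" for l
  proof (cases "l \<subseteq> S")
    case True
    then show ?thesis using two_points[OF l] by blast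
  next
    case False
    then obtain p where p: "p \<in> l" "p \<notin> S" by blast
    then have pP: "p \<in> points \<Gamma>" using line_points[OF l] by blast
    have "\<epsilon> r \<subseteq> {h \<oplus>\<^bsub>V\<^esub> n | h n. h \<in> spn S \<and> n \<in> \<epsilon> p}" if "r \<in> l" for r
      using that line_points[OF l] point_carrier
      unfolding maximal_subspace_span[OF S pP p(2), symmetric] by blast
    then show ?thesis using line_meets_codimension_one[OF spn_submodule[OF SP] pP l] unfolding pts by blast
  qed
  then show ?thesis using proper unfolding geo_hyperplane_def by simp
qed

end

context polar_space_form
begin

lemma cone_add_form:
  assumes S: "geo_subspace \<Gamma> S" and vw: "v \<in> cone S" "w \<in> cone S" "f v w = \<zero>"
  shows "v \<oplus>\<^bsub>V\<^esub> w \<in> cone S"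
proof -
  have SP: "S \<subseteq> points \<Gamma>" using geo_subspace_points[OF S] .
  have c: "v \<in> carrier V" "w \<in> carrier V" using cone_carrier[OF SP] vw by auto
  show ?thesis
  proof (cases "v = \<zero>\<^bsub>V\<^esub> \<or> w = \<zero>\<^bsub>V\<^esub>")
    case True
    then show ?thesis using vw c by auto
  next
    case False
    obtain p where p: "p \<in> S" "v \<in> \<epsilon> p" using coneE[OF vw(1)] False by blast
    obtain q where q: "q \<in> S" "w \<in> \<epsilon> q" using coneE[OF vw(2)] False by blast
    have "p \<in> points \<Gamma>" "q \<in> points \<Gamma>" using p q SP by auto
    then have "col p q" using f_perp[OF _ _ p(2) q(2)] False vw(3) by blast
    then show ?thesis by (rule cone_add[OF S p q])
  qed
qed

text \<open>
  Let \<open>x'\<close> and \<open>y'\<close> be the points of \<open>L\<close> and \<open>M\<close> collinear with \<open>y\<close> and \<open>x\<close>. Split \<open>x = x1 + x2\<close> within \<open>L\<close> and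
  \<open>y = y1 + y2\<close> within \<open>M\<close> so that \<open>x1\<close> is orthogonal to \<open>y1\<close> and \<open>x2\<close> to \<open>y2\<close>. Then \<open>x1 + y1\<close> and \<open>x2 + y2\<close>
  represent points of \<open>S\<close>, and they are orthogonal to each other if \<open>f x2 y1 = t\<close> and
  \<open>f x1 y2 = - e \<sigma>(t)\<close>. As \<open>f x y\<close> is the sum of these two values, this is possible just because \<open>f x y\<close>
  belongs to \<open>Lam\<close>.
\<close>

lemma regulus_closed:
  assumes univ: "absolutely_universal \<Gamma> K V \<epsilon>" and S: "geo_subspace \<Gamma> S"
    and LM: "opposite \<Gamma> L M" "L \<subseteq> S" "M \<subseteq> S"
    and p: "p \<in> L" "x \<in> \<epsilon> p" and q: "q \<in> M" "y \<in> \<epsilon> q"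
    and r: "r \<in> points \<Gamma>" "x \<oplus>\<^bsub>V\<^esub> y \<in> \<epsilon> r"
  shows "x \<oplus>\<^bsub>V\<^esub> y \<in> cone S"
proof (cases "f x y = \<zero>")
  case True
  then show ?thesis using cone_add_form[OF S coneI coneI] p q LM by blast
next
  case False
  note L = oppositeE(1)[OF LM(1)] and M = oppositeE(2)[OF LM(1)]
  have LP: "c \<in> points \<Gamma>" if "c \<in> L" for c using that line_points[OF L] by blast
  have MP: "c \<in> points \<Gamma>" if "c \<in> M" for c using that line_points[OF M] by blast
  have xy: "x \<in> carrier V" "y \<in> carrier V" using point_carrier[OF LP[OF p(1)] p(2)] point_carrier[OF MP[OF q(1)] q(2)] .
  have nc: "\<not> col p q" using f_collinear[OF LP[OF p(1)] MP[OF q(1)] p(2) q(2)] False by blast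
  define a where "a = f x y"
  have aK: "a \<in> carrier K" "a \<noteq> \<zero>" using False xy unfolding a_def by auto
  have "a \<in> Lam" unfolding a_def by (rule hyperbolic_value[OF univ LP[OF p(1)] MP[OF q(1)] r(1) p(2) q(2) r(2)])
  then obtain t where t: "t \<in> carrier K" "a = t \<oplus> \<ominus> (e \<otimes> \<sigma> t)" by (rule LamE)
  obtain p' where p': "p' \<in> L" "col q p'" using ex_col[OF MP[OF q(1)] L] .
  obtain q' where q': "q' \<in> M" "col p q'" using ex_col[OF LP[OF p(1)] M] .
  have pp': "p \<noteq> p'" using p' nc by (auto simp: col_sym)
  have nc': "\<not> col p' q'"
    using oppositeD[OF opposite_sym[OF LM(1)] q'(1) p(1) p'(1) pp'] q'(2) by (auto simp: col_sym)
  obtain x' where x': "x' \<in> \<epsilon> p'" "x' \<noteq> \<zero>\<^bsub>V\<^esub>" using nonzero_vector[OF LP[OF p'(1)]] .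
  obtain y' where y': "y' \<in> \<epsilon> q'" "y' \<noteq> \<zero>\<^bsub>V\<^esub>" using nonzero_vector[OF MP[OF q'(1)]] .
  have xy': "x' \<in> carrier V" "y' \<in> carrier V"
    using point_carrier[OF LP[OF p'(1)] x'(1)] point_carrier[OF MP[OF q'(1)] y'(1)] .
  define b where "b = f x' y'"
  have bK: "b \<in> carrier K" "b \<noteq> \<zero>"
    using xy' f_perp[OF LP[OF p'(1)] MP[OF q'(1)] x'(1) y'(1) x'(2) y'(2)] nc' unfolding b_def by auto
  have fz: "f x y' = \<zero>" "f x' y = \<zero>"
    using f_collinear[OF LP[OF p(1)] MP[OF q'(1)] p(2) y'(1) q'(2)]
      f_collinear[OF LP[OF p'(1)] MP[OF q(1)] x'(1) q(2)] p'(2) by (auto simp: col_sym)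
  obtain A where A: "A \<in> carrier K" "A \<otimes> a = \<one>" "a \<otimes> A = \<one>" using skew_inverse[OF aK] by metis
  obtain B where B: "B \<in> carrier K" "b \<otimes> B = \<one>" using skew_inverse[OF bK] by metis
  have surj: "\<exists>c\<in>carrier K. \<sigma> c = k" if "k \<in> carrier K" for k
    using \<sigma>_bij that unfolding bij_betw_def by (metis imageE)
  \<comment> \<open>The splitting \<open>x2 = \<alpha> x + x'\<close>, \<open>y2 = \<beta> y + \<gamma> y'\<close> leads to the equations \<open>\<alpha> a = t\<close>, \<open>a \<sigma>(\<beta>) = a - t\<close> and
    \<open>\<alpha> a \<sigma>(\<beta>) + b \<sigma>(\<gamma>) = 0\<close>, where \<open>b = f x' y'\<close>. With \<open>A\<close> and \<open>B\<close> the inverses of \<open>a\<close> and \<open>b\<close> their solution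
    is as follows, \<open>k\<close> being the value of \<open>\<sigma>(\<beta>)\<close>.\<close>
  define k where "k = \<one> \<oplus> \<ominus> (A \<otimes> t)"
  have kK: "k \<in> carrier K" unfolding k_def using A(1) t(1) by simp
  obtain \<beta> where \<beta>: "\<beta> \<in> carrier K" "\<sigma> \<beta> = k" using surj[OF kK] by blast
  obtain \<gamma> where \<gamma>: "\<gamma> \<in> carrier K" "\<sigma> \<gamma> = \<ominus> (B \<otimes> (t \<otimes> k))"
    using surj[of "\<ominus> (B \<otimes> (t \<otimes> k))"] B(1) t(1) kK by auto
  define x2 where "x2 = (t \<otimes> A) \<odot>\<^bsub>V\<^esub> x \<oplus>\<^bsub>V\<^esub> x'"
  define y2 where "y2 = \<beta> \<odot>\<^bsub>V\<^esub> y \<oplus>\<^bsub>V\<^esub> \<gamma> \<odot>\<^bsub>V\<^esub> y'"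
  define x1 where "x1 = x \<oplus>\<^bsub>V\<^esub> \<ominus>\<^bsub>V\<^esub> x2"
  define y1 where "y1 = y \<oplus>\<^bsub>V\<^esub> \<ominus>\<^bsub>V\<^esub> y2"
  have c2: "x2 \<in> carrier V" "y2 \<in> carrier V"
    unfolding x2_def y2_def using xy xy' t(1) A(1) \<beta>(1) \<gamma>(1) by simp_all
  have c1: "x1 \<in> carrier V" "y1 \<in> carrier V" unfolding x1_def y1_def using xy c2 by simp_all
  obtain p2 where p2: "p2 \<in> L" "x2 \<in> \<epsilon> p2"
    using line_add[OF L p(1) submoduleD(4)[OF point_submodule[OF LP[OF p(1)]] _ p(2)] p'(1) x'(1), of "t \<otimes> A"]
      t(1) A(1) unfolding x2_def by auto
  obtain p1 where p1: "p1 \<in> L" "x1 \<in> \<epsilon> p1"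
    using line_add[OF L p p2(1) submodule_minus[OF point_submodule[OF LP[OF p2(1)]] p2(2)]] unfolding x1_def by blast
  obtain q2 where q2: "q2 \<in> M" "y2 \<in> \<epsilon> q2"
    using line_add[OF M q(1) submoduleD(4)[OF point_submodule[OF MP[OF q(1)]] \<beta>(1) q(2)] q'(1)
        submoduleD(4)[OF point_submodule[OF MP[OF q'(1)]] \<gamma>(1) y'(1)]] unfolding y2_def by blast
  obtain q1 where q1: "q1 \<in> M" "y1 \<in> \<epsilon> q1"
    using line_add[OF M q q2(1) submodule_minus[OF point_submodule[OF MP[OF q2(1)]] q2(2)]] unfolding y1_def by blast
  have tk: "a \<otimes> k = a \<oplus> \<ominus> t"
  proof -
    have "a \<otimes> (A \<otimes> t) = t" using A t(1) aK(1) by (simp add: K.m_assoc[symmetric])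
    then show ?thesis unfolding k_def using A(1) t(1) aK(1) by (simp add: K.r_distr K.r_minus)
  qed
  have f_x_y2: "f x y2 = a \<oplus> \<ominus> t"
    unfolding y2_def using xy xy' \<beta> \<gamma>(1) fz(1) tk a_def[symmetric] kK aK(1) t(1) by (simp add: f_add_r f_smult_r)
  have f_x2_y: "f x2 y = t"
    unfolding x2_def using xy xy' A t(1) aK(1) fz(2) a_def[symmetric]
    by (simp add: f_add_l f_smult_l K.m_assoc)
  have f_x2_y2: "f x2 y2 = \<zero>"
  proof -
    have "f x2 y' = b" unfolding x2_def using xy xy' A(1) t(1) fz(1) b_def[symmetric] bK(1)
      by (simp add: f_add_l f_smult_l)
    then have "f x2 y2 = t \<otimes> k \<oplus> b \<otimes> \<sigma> \<gamma>"
      unfolding y2_def using xy xy' c2 \<beta> \<gamma>(1) f_x2_y by (simp add: f_add_r f_smult_r)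
    also have "b \<otimes> \<sigma> \<gamma> = \<ominus> (b \<otimes> B \<otimes> (t \<otimes> k))"
      unfolding \<gamma>(2) using bK(1) B(1) t(1) kK by (simp add: K.r_minus K.m_assoc)
    also have "\<dots> = \<ominus> (t \<otimes> k)" unfolding B(2) using t(1) kK by simp
    finally show ?thesis using t(1) kK by (simp add: K.r_neg)
  qed
  have f_x1_y2: "f x1 y2 = a \<oplus> \<ominus> t"
    unfolding x1_def using xy c2 f_x_y2 f_x2_y2 aK(1) t(1) by (simp add: f_add_l f_minus_l)
  have f_x2_y1: "f x2 y1 = t"
    unfolding y1_def using xy c2 f_x2_y f_x2_y2 t(1) by (simp add: f_add_r f_minus_r)
  have f_x1_y: "f x1 y = a \<oplus> \<ominus> t"
    unfolding x1_def using xy c2 f_x2_y a_def[symmetric] by (simp add: f_add_l f_minus_l)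
  have f_x1_y1: "f x1 y1 = \<zero>"
  proof -
    have "f x1 y1 = (a \<oplus> \<ominus> t) \<oplus> \<ominus> (a \<oplus> \<ominus> t)"
      unfolding y1_def using xy c1(1) c2 f_x1_y f_x1_y2 by (simp add: f_add_r f_minus_r del: K.r_neg)
    then show ?thesis using aK(1) t(1) K.r_neg[of "a \<oplus> \<ominus> t"] by simp
  qed
  let ?u = "x1 \<oplus>\<^bsub>V\<^esub> y1" and ?w = "x2 \<oplus>\<^bsub>V\<^esub> y2"
  have u: "?u \<in> cone S" using cone_add_form[OF S coneI coneI f_x1_y1] p1 q1 LM by blast
  have w: "?w \<in> cone S" using cone_add_form[OF S coneI coneI f_x2_y2] p2 q2 LM by blast
  have f_xx: "f x1 x2 = \<zero>"
    by (rule f_collinear[OF LP[OF p1(1)] LP[OF p2(1)] p1(2) p2(2) col_line[OF L p1(1) p2(1)]])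
  have f_yy: "f y1 y2 = \<zero>"
    by (rule f_collinear[OF MP[OF q1(1)] MP[OF q2(1)] q1(2) q2(2) col_line[OF M q1(1) q2(1)]])
  have "f y1 x2 = e \<otimes> \<sigma> t" using f_swap[OF c2(1) c1(2)] f_x2_y1 by simp
  then have "f ?u ?w = (a \<oplus> \<ominus> t) \<oplus> e \<otimes> \<sigma> t"
    using c1 c2 f_xx f_yy f_x1_y2 aK(1) t(1) by (simp add: f_add_l f_add_r K.a_comm)
  also have "\<dots> = (t \<oplus> \<ominus> t) \<oplus> (e \<otimes> \<sigma> t \<oplus> \<ominus> (e \<otimes> \<sigma> t))"
    unfolding t(2) using t(1) by (simp add: K.a_ac del: K.r_neg)
  also have "\<dots> = \<zero>" using t(1) by (simp add: K.r_neg)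
  finally have "?u \<oplus>\<^bsub>V\<^esub> ?w \<in> cone S" by (rule cone_add_form[OF S u w])
  moreover have "?u \<oplus>\<^bsub>V\<^esub> ?w = x \<oplus>\<^bsub>V\<^esub> y"
  proof -
    have "x1 \<oplus>\<^bsub>V\<^esub> x2 = x" "y1 \<oplus>\<^bsub>V\<^esub> y2 = y"
      unfolding x1_def y1_def using xy c2 by (simp_all add: V.a_assoc V.l_neg)
    moreover have "?u \<oplus>\<^bsub>V\<^esub> ?w = (x1 \<oplus>\<^bsub>V\<^esub> x2) \<oplus>\<^bsub>V\<^esub> (y1 \<oplus>\<^bsub>V\<^esub> y2)" using c1 c2 by (simp add: V.a_ac)
    ultimately show ?thesis by simp
  qed
  ultimately show ?thesis by simp
qed

text \<open>
  Induction on the number of points of \<open>S\<close> adjoined to \<open>L \<union> M\<close>: the points embedded in the span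
  always belong to \<open>S\<close>. As every vector lies in the span of finitely many points of \<open>S\<close>, this
  exhausts the polar space.
\<close>

theorem spanning_subspace:
  assumes univ: "absolutely_universal \<Gamma> K V \<epsilon>" and S: "geo_subspace \<Gamma> S"
    and LM: "opposite \<Gamma> L M" "L \<subseteq> S" "M \<subseteq> S" and span: "spn S = carrier V"
  shows "S = points \<Gamma>"
proof -
  note SP = geo_subspace_points[OF S]
  note L = oppositeE(1)[OF LM(1)] and M = oppositeE(2)[OF LM(1)]
  note LP = line_points[OF L] and MP = line_points[OF M]
  let ?W = "\<Union>p\<in>L \<union> M. \<epsilon> p"
  have Wc: "?W \<subseteq> carrier V" using UN_carrier[of "L \<union> M"] LP MP by blast
  have main: "pts (lin_span K V (?W \<union> (\<Union>s\<in>F. \<epsilon> s))) \<subseteq> S" if "finite F" "F \<subseteq> S" for F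
    using that
  proof (induction F rule: finite_induct)
    case empty
    show ?case
    proof
      fix r assume "r \<in> pts (lin_span K V (?W \<union> (\<Union>s\<in>{}. \<epsilon> s)))"
      then have r: "r \<in> points \<Gamma>" "\<epsilon> r \<subseteq> lin_span K V ?W" unfolding pts_def by auto
      obtain u where u: "u \<in> \<epsilon> r" "u \<noteq> \<zero>\<^bsub>V\<^esub>" using nonzero_vector[OF r(1)] .
      have "?W \<subseteq> spn L \<union> spn M" using spn_incl[of _ L] spn_incl[of _ M] by blast
      then have "u \<in> lin_span K V (spn L \<union> spn M)" using r(2) u(1) lin_span_mono[of ?W] by blast
      then obtain x y where xy: "x \<in> spn L" "y \<in> spn M" "u = x \<oplus>\<^bsub>V\<^esub> y"
        unfolding lin_span_Un[OF spn_submodule[OF LP] spn_submodule[OF MP]] by blast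
      obtain p where p: "p \<in> L" "x \<in> \<epsilon> p" using spn_line[OF L xy(1)] by blast
      obtain q where q: "q \<in> M" "y \<in> \<epsilon> q" using spn_line[OF M xy(2)] by blast
      have "u \<in> cone S"
        unfolding xy(3) using regulus_closed[OF univ S LM p q r(1)] u(1) xy(3) by simp
      then obtain s where "s \<in> S" "u \<in> \<epsilon> s" using coneE u(2) by blast
      then show "r \<in> S" using vector_point_unique[OF r(1) _ u(1) _ u(2)] SP by blast
    qed
  next
    case (insert s F)
    have sF: "s \<in> S" "F \<subseteq> S" using insert.prems by auto
    then have FP: "F \<subseteq> points \<Gamma>" and sP: "s \<in> points \<Gamma>" using SP by auto
    let ?H = "lin_span K V (?W \<union> (\<Union>s\<in>F. \<epsilon> s))"
    let ?H' = "lin_span K V (?W \<union> (\<Union>s\<in>insert s F. \<epsilon> s))"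
    have Hc: "?W \<union> (\<Union>s\<in>F. \<epsilon> s) \<subseteq> carrier V" using Wc UN_carrier[OF FP] by simp
    have Hc': "?W \<union> (\<Union>s\<in>insert s F. \<epsilon> s) \<subseteq> carrier V" using Wc UN_carrier[of "insert s F"] FP sP by simp
    note H = lin_span_submodule[OF Hc] and H' = lin_span_submodule[OF Hc']
    have IH: "pts ?H \<subseteq> S" using insert.IH sF by simp
    have dec: "?H' = {h \<oplus>\<^bsub>V\<^esub> n | h n. h \<in> ?H \<and> n \<in> \<epsilon> s}" by (rule lin_span_insert_point[OF Wc FP sP])
    have HH': "?H \<subseteq> ?H'" by (intro lin_span_mono) blast
    show ?case
    proof (cases "s \<in> pts ?H")
      case True
      then have "\<epsilon> s \<subseteq> ?H" unfolding pts_def by simp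
      then have "?H' \<subseteq> ?H" unfolding dec using submoduleD(3)[OF H] by blast
      then show ?thesis using IH pts_mono by blast
    next
      case False
      have X: "geo_subspace \<Gamma> (pts ?H')" and Y: "geo_subspace \<Gamma> (pts ?H)"
        using pts_subspace[OF H'] pts_subspace[OF H] .
      have LX: "L \<subseteq> pts ?H'" "M \<subseteq> pts ?H'"
        using lin_span_incl[of "?W \<union> (\<Union>s\<in>insert s F. \<epsilon> s)"] LP MP unfolding pts_def by blast+
      have YX: "pts ?H \<subseteq> pts ?H'" by (rule pts_mono[OF HH'])
      have sX: "s \<in> pts ?H'"
        using lin_span_incl[of "?W \<union> (\<Union>s\<in>insert s F. \<epsilon> s)"] sP unfolding pts_def by blast
      have meets: "l \<inter> pts ?H \<noteq> {}" if l: "l \<in> lines \<Gamma>" "l \<subseteq> pts ?H'" for l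
      proof (rule line_meets_codimension_one[OF H sP l(1)])
        show "\<epsilon> r \<subseteq> {h \<oplus>\<^bsub>V\<^esub> n | h n. h \<in> ?H \<and> n \<in> \<epsilon> s}" if "r \<in> l" for r
          using l(2) that unfolding dec[symmetric] pts_def by blast
      qed
      show ?thesis
        by (rule hyperplane_complement_connected[OF X LM(1) LX Y YX meets S IH sF(1) sX False])
    qed
  qed
  have "points \<Gamma> \<subseteq> S"
  proof
    fix r assume r: "r \<in> points \<Gamma>"
    obtain u where u: "u \<in> \<epsilon> r" "u \<noteq> \<zero>\<^bsub>V\<^esub>" using nonzero_vector[OF r] .
    have "u \<in> spn S" using span point_carrier[OF r u(1)] by simp
    then have u': "u \<in> lin_span K V (?W \<union> (\<Union>s\<in>S. \<epsilon> s))" by (rule subsetD[OF lin_span_mono, rotated]) simp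
    have sc: "\<epsilon> s \<subseteq> carrier V" if "s \<in> S" for s using point_carrier that SP by blast
    obtain F where F: "finite F" "F \<subseteq> S" "u \<in> lin_span K V (?W \<union> (\<Union>s\<in>F. \<epsilon> s))"
      using lin_span_finite_support[OF Wc sc u'] .
    have "?W \<union> (\<Union>s\<in>F. \<epsilon> s) \<subseteq> carrier V" using Wc sc F(2) by blast
    then have "r \<in> pts (lin_span K V (?W \<union> (\<Union>s\<in>F. \<epsilon> s)))"
      using ptsI[OF lin_span_submodule r u F(3)] by simp
    then show "r \<in> S" using main[OF F(1,2)] by blast
  qed
  then show ?thesis using SP by blast
qed

end

section \<open>Hyperplanes and maximal subspaces\<close>

theorem corollary3:
  fixes \<Gamma> :: "'p geometry"
    and K :: "('k, 'm) ring_scheme" and V :: "('k, 'v, 'w) module_scheme"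
    and \<epsilon> :: "'p \<Rightarrow> 'v set" and n :: nat
  assumes "polar_space \<Gamma>" and "nondegenerate \<Gamma>"
    and "polar_rank \<Gamma> = enat n" and "n > 2"
    and "absolutely_universal \<Gamma> K V \<epsilon>"
  shows "{S. geo_hyperplane \<Gamma> S} = {S. maximal_subspace \<Gamma> S \<and> subspace_rank \<Gamma> S \<ge> 2} \<and>
    (\<forall>S. geo_hyperplane \<Gamma> S \<longrightarrow>
       subspace_rank \<Gamma> S = enat (n - 1) \<or> subspace_rank \<Gamma> S = enat n)"
proof -
  note univ = assms(5)
  have emb: "embedding \<Gamma> K V \<epsilon>"
    using univ unfolding absolutely_universal_def relatively_universal_def by simp
  have rk: "enat 2 < polar_rank \<Gamma>" using assms(3,4) by simp
  have ln: "lines \<Gamma> \<noteq> {}"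
  proof
    assume "lines \<Gamma> = {}"
    \<comment> \<open>Without lines the conditions on lines are vacuous, yet rank 3 yields a line.\<close>
    then interpret thick_polar_space \<Gamma> using assms(1) by unfold_locales simp_all
    obtain N x where "N \<in> lines \<Gamma>" using rank_3_plane[OF rk] .
    then show False using \<open>lines \<Gamma> = {}\<close> by simp
  qed
  have "left_vector_space K V" using emb unfolding embedding_def by simp
  then interpret embedded_polar_space K V \<Gamma> \<epsilon>
    using assms(1,2) ln emb by (intro embedded_polar_space.intro embedded_polar_space_axioms.intro)
  obtain N x where "N \<in> lines \<Gamma>" "N \<subseteq> perp \<Gamma> {x}" "x \<notin> N" "x \<in> points \<Gamma>"
    using rank_3_plane[OF rk] .
  then have "\<exists>N\<in>lines \<Gamma>. \<exists>x\<in>points \<Gamma>. x \<notin> N \<and> N \<subseteq> perp \<Gamma> {x}" by blast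
  then interpret embedded_polar_space_rank3 K V \<Gamma> \<epsilon> by unfold_locales
  obtain f \<sigma> e where "polar_space_form K V \<Gamma> \<epsilon> f \<sigma> e" using form_exists[OF univ] by blast
  then interpret polar_space_form K V \<Gamma> \<epsilon> f \<sigma> e .
  have ranks: "subspace_rank \<Gamma> S = enat (n - 1) \<or> subspace_rank \<Gamma> S = enat n"
    if "geo_hyperplane \<Gamma> S" for S
    using hyperplane_rank[OF assms(3) _ that] assms(4) by simp
  have "maximal_subspace \<Gamma> S \<and> subspace_rank \<Gamma> S \<ge> 2" if S: "geo_hyperplane \<Gamma> S" for S
    using hyperplane_maximal[OF ln S] ranks[OF S] assms(4) by (auto simp: numeral_eq_enat)
  moreover have "geo_hyperplane \<Gamma> S" if S: "maximal_subspace \<Gamma> S" "subspace_rank \<Gamma> S \<ge> 2" for S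
  proof -
    have sub: "geo_subspace \<Gamma> S" "S \<noteq> points \<Gamma>"
      using S(1) unfolding maximal_subspace_def proper_subspace_def by simp_all
    note SP = geo_subspace_points[OF sub(1)]
    show ?thesis
    proof (cases "Rad \<Gamma> S = {}")
      case True
      obtain L where L: "L \<in> lines \<Gamma>" "L \<subseteq> S" using rank_2_line[OF sub(1) S(2)] .
      obtain M where M: "M \<subseteq> S" "opposite \<Gamma> L M" using opposite_line[OF sub(1) True L] .
      have "spn S \<noteq> carrier V" using spanning_subspace[OF univ sub(1) M(2) L(2) M(1)] sub(2) by blast
      then show ?thesis by (rule maximal_nonspanning_hyperplane[OF S(1)])
    next
      case False
      then obtain r where r: "r \<in> perp \<Gamma> S" "r \<in> S" unfolding Rad_def by blast
      then have rP: "r \<in> points \<Gamma>" using SP by blast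
      have "S \<subseteq> perp \<Gamma> {r}"
      proof
        fix s assume s: "s \<in> S"
        then have "col s r" using r(1) unfolding perp_iff by simp
        then show "s \<in> perp \<Gamma> {r}" using s SP unfolding perp_iff by (auto simp: col_sym)
      qed
      moreover have H: "geo_hyperplane \<Gamma> (perp \<Gamma> {r})" by (rule perp_hyperplane[OF rP])
      ultimately have "perp \<Gamma> {r} = S"
        using maximal_subspaceD[OF S(1)] unfolding geo_hyperplane_def by simp
      then show ?thesis using H by simp
    qed
  qed
  ultimately show ?thesis using ranks by blast
qed

end
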